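(* There is an absolute constant $C>0$ such that for all integers $d\ge 78$ and $n\ge e^{e}d$ there exist real numbers $\theta=\theta(n,d)\in[-34,2]$ and $R=R(n,d)$ with $|R|\le C\sqrt d\,e^{-\frac1{10}d}$ such that $$ \mathbb{E} f_{d-1}(P^{(d)}_n) = 2^d\,\pi^{\frac{d-1}{2}}\,d^{-\frac12}\, \exp\left(\frac{d-1}{2}\ln\ln\frac nd-\frac{d-1}{4}\,\frac{\ln\ln\frac nd}{\ln\frac nd}+(d-1)\frac{\theta}{\ln\frac nd}+R\right). $$
   Context: For integers $n,d\ge1$, the Gaussian polytope $P^{(d)}_n=[X_1,\dots,X_n]$ is the convex hull of $n$ independent standard Gaussian random points $X_1,\dots,X_n$ in $\mathbb{R}^d$. For a polytope $Q$, $f_{i}(Q)$ denotes the number of $i$-dimensional faces of $Q$; thus $f_{d-1}(P^{(d)}_n)$ is its number of facets. *)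

theory Defs
  imports "HOL-Probability.Probability" "HOL-Library.Function_Algebras"
begin

text \<open>
  The dimension \<open>d\<close> is quantified inside the statement (under the absolute constant), so
  \<open>\<real>\<^sup>d\<close> cannot be a type such as \<^typ>\<open>real ^ 'd\<close>. It is represented as the linear subspace
  of those \<^typ>\<open>nat \<Rightarrow> real\<close> that vanish outside \<open>{..<d}\<close>. The pointwise
  vector space structure below makes the library notions \<^const>\<open>convex\<close>,
  \<^const>\<open>affine_dependent\<close> and \<^const>\<open>face_of\<close> available on this type.
\<close>

instantiation "fun" :: (type, real_vector) real_vector
begin

definition scaleR_fun :: "real \<Rightarrow> ('a \<Rightarrow> 'b) \<Rightarrow> 'a \<Rightarrow> 'b" where
  "scaleR_fun r f = (\<lambda>x. r *\<^sub>R f x)"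

instance
  by standard (simp_all add: scaleR_fun_def fun_eq_iff scaleR_add_right scaleR_add_left)

end

lemma scaleR_fun_apply [simp]: "(r *\<^sub>R f) x = r *\<^sub>R f x"
  by (simp add: scaleR_fun_def)

text \<open>
  \<^const>\<open>aff_dim\<close> is restricted to class \<^class>\<open>euclidean_space\<close>, to which \<^typ>\<open>nat \<Rightarrow> real\<close>
  does not belong. The following is its definition over an arbitrary real vector space. The
  condition \<^term>\<open>finite B\<close>, automatic in Euclidean spaces, is needed as
  \<^const>\<open>card\<close> is \<open>0\<close> on infinite sets. The value is meaningful for finite-dimensional sets only,
  such as the subsets of a polytope.
\<close>

definition affine_dim :: "'a::real_vector set \<Rightarrow> int" where
  "affine_dim V = (SOME k :: int. \<exists>B. affine hull B = affine hull V \<and> \<not> affine_dependent B \<and>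
      finite B \<and> of_nat (card B) = k + 1)"

lemma affine_dim_eq_aff_dim: "affine_dim V = aff_dim V"
  for V :: "'a::euclidean_space set"
  unfolding affine_dim_def aff_dim_def by (metis aff_independent_finite)

definition num_faces :: "nat \<Rightarrow> 'a::real_vector set \<Rightarrow> nat" where
  "num_faces i Q = card {F. F face_of Q \<and> affine_dim F = int i}"

definition std_gaussian :: "nat \<Rightarrow> (nat \<Rightarrow> real) measure" where
  "std_gaussian d = (\<Pi>\<^sub>M k\<in>{..<d}. density lborel (\<lambda>x. ennreal (std_normal_density x)))"

definition gaussian_sample :: "nat \<Rightarrow> nat \<Rightarrow> (nat \<Rightarrow> nat \<Rightarrow> real) measure" where
  "gaussian_sample n d = (\<Pi>\<^sub>M i\<in>{..<n}. std_gaussian d)"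

lemma prob_space_gaussian_sample: "prob_space (gaussian_sample n d)"
proof -
  have "prob_space (density lborel (\<lambda>x. ennreal (std_normal_density x)))"
    by (simp add: prob_space_normal_density)
  then show ?thesis
    unfolding gaussian_sample_def std_gaussian_def by (intro prob_space_PiM)
qed

text \<open>
  Elements of a finite product space are \<^const>\<open>undefined\<close> outside the index set; they are
  turned into points of \<open>\<real>\<^sup>d\<close> by setting the remaining coordinates to \<open>0\<close>.
\<close>

definition to_euclidean :: "nat \<Rightarrow> (nat \<Rightarrow> real) \<Rightarrow> nat \<Rightarrow> real" where
  "to_euclidean d x = (\<lambda>k. if k < d then x k else 0)"

definition gaussian_polytope :: "nat \<Rightarrow> nat \<Rightarrow> (nat \<Rightarrow> nat \<Rightarrow> real) \<Rightarrow> (nat \<Rightarrow> real) set" where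
  "gaussian_polytope n d X = convex hull ((\<lambda>i. to_euclidean d (X i)) ` {..<n})"

definition expected_facets :: "nat \<Rightarrow> nat \<Rightarrow> real" where
  "expected_facets n d =
     (\<integral>X. real (num_faces (d - 1) (gaussian_polytope n d X)) \<partial>gaussian_sample n d)"

end

theory Submission
  imports Defs "HOL-Real_Asymp.Real_Asymp" "Jordan_Normal_Form.Determinant"
begin

text \<open>
  Why the theorem holds. Almost surely the \<open>n\<close> points are in general position, so a facet is the
  convex hull of exactly \<open>d\<close> of them, and \<open>d\<close> given points span a facet if and only if all the
  others lie strictly on one side of the hyperplane through them. Given that hyperplane, at
  signed distance \<open>h\<close> from the origin, the other points are independent and each lies above it with
  probability \<open>normal_tail h\<close>. The distance \<open>h\<close> is centred normal with variance \<open>1 / d\<close>: the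
  direction of the hyperplane depends on the differences of the \<open>d\<close> points only, \<open>h\<close> is the
  component of their mean in that direction, and the mean is independent of the differences.
  Linearity of expectation gives the exact formula \<open>expected_facets_integral\<close>, with binomial
  coefficient \<open>n choose d\<close> and integrand \<open>normal_tail h ^ (n - d) + (1 - normal_tail h) ^ (n - d)\<close>.

  Let \<open>s\<close> be the tail and \<open>\<phi>\<close> the density of the standard normal law, \<open>\<lambda> = \<phi> / s\<close> its hazard
  rate, \<open>G = \<lambda>\<^sup>2 / 2\<close>, \<open>L = ln (n / d)\<close> and \<open>m = (d - 1) / 2\<close>. The density of \<open>h\<close> is a constant
  times \<open>\<phi>\<^sup>d = \<phi> s\<^sup>d\<^sup>-\<^sup>1 \<lambda>\<^sup>d\<^sup>-\<^sup>1\<close>, and under the probability density proportional to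
  \<open>(1 - s)\<^sup>n\<^sup>-\<^sup>d s\<^sup>d\<^sup>-\<^sup>1 \<phi>\<close> the tail \<open>s\<close> is a Beta variable. Hence
  (\<open>expected_facets_eq_hazard_moment\<close>) the expectation equals \<open>2\<^sup>d \<pi>\<^sup>m d\<^sup>-\<^sup>1\<^sup>/\<^sup>2 L\<^sup>m\<close> times the
  Beta mean of \<open>(G / L)\<^sup>m\<close>, and what remains is to estimate that mean.

  The classical inequalities \<open>y < \<lambda>(y)\<close> and \<open>\<lambda>(y)\<^sup>2 < 1 + y \<lambda>(y)\<close> imply that for \<open>y \<ge> 0\<close> the sum
  \<open>G + ln G / 2\<close> agrees with \<open>ln (1 / s)\<close> up to a bounded error. For the typical value \<open>s = d / n\<close>
  this makes \<open>G\<close> equal to \<open>L - ln L / 2\<close> up to a bounded error, which is where the first two terms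
  of the exponent come from. For the upper bound, the tangent to \<open>G + ln G / 2\<close> at \<open>G = L\<close> bounds \<open>(G / L)\<^sup>m\<close>
  by a constant times a small negative power of \<open>s\<close>, whose Beta mean is controlled by an integer
  inverse moment. For the lower bound, only \<open>s \<le> 4 d / n\<close> is used; the complementary
  event has probability at most \<open>2\<^sup>-\<^sup>d\<close> by Markov's inequality, and this loss is the only
  source of the remainder \<open>R\<close>.

  The event of spanning a facet is expressed by a vector \<open>N\<close> of cofactors normal to the
  hyperplane. This gives measurability, and it makes the orthogonality relations and the
  genericity statements consequences of determinant identities.
\<close>

section \<open>The tail and the hazard rate of the standard normal law\<close>

definition normal_tail :: "real \<Rightarrow> real" where
  "normal_tail y = measure std_normal_distribution {y<..}"

lemma prob_space_std_normal: "prob_space std_normal_distribution"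
  by (simp add: prob_space_normal_density)

lemma std_normal_interval:
  assumes "a \<le> b"
  shows "measure std_normal_distribution {a<..b} = integral {a..b} std_normal_density"
proof -
  have "measure std_normal_distribution {a<..b} = (LINT x|lborel. indicator {a<..b} x * std_normal_density x)"
    using integral_density[of "indicator {a<..b} :: real \<Rightarrow> real" lborel std_normal_density]
    by (simp add: mult.commute)
  also have "\<dots> = (LINT x:{a<..b}|lborel. std_normal_density x)"
    by (simp add: set_lebesgue_integral_def)
  also have "\<dots> = (LINT x:{a..b}|lborel. std_normal_density x)"
    unfolding set_lebesgue_integral_def
  proof (rule integral_cong_AE)
    show "AE x in lborel. indicator {a<..b} x *\<^sub>R std_normal_density x = indicator {a..b} x *\<^sub>R std_normal_density x"
      using AE_lborel_singleton[of a] by eventually_elim (auto simp: indicator_def)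
  qed measurable
  also have "\<dots> = integral {a..b} std_normal_density"
  proof (rule set_borel_integral_eq_integral)
    have "set_integrable lborel UNIV std_normal_density" by (simp add: set_integrable_def)
    then show "set_integrable lborel {a..b} std_normal_density"
      by (rule set_integrable_subset) auto
  qed
  finally show ?thesis .
qed

lemma normal_tail_diff:
  assumes "a \<le> b"
  shows "normal_tail b = normal_tail a - integral {a..b} std_normal_density"
proof -
  interpret prob_space std_normal_distribution by (rule prob_space_std_normal)
  have "measure std_normal_distribution {a<..} =
      measure std_normal_distribution {a<..b} + measure std_normal_distribution {b<..}"
    using assms by (subst finite_measure_Union[symmetric]) (auto intro!: arg_cong[where f="prob"])
  then show ?thesis using std_normal_interval[OF assms] by (simp add: normal_tail_def)
qed

lemma continuous_on_std_normal_density [continuous_intros]: "continuous_on A std_normal_density"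
  unfolding std_normal_density_def[abs_def] by (intro continuous_intros) auto

lemma has_real_derivative_normal_tail:
  "(normal_tail has_real_derivative - std_normal_density y) (at y)"
proof -
  have "((\<lambda>x. integral {y - 1..x} std_normal_density) has_real_derivative std_normal_density y) (at y within {y-1..y+1})"
    by (rule integral_has_real_derivative) (auto intro: continuous_intros)
  then have "((\<lambda>x. normal_tail (y-1) - integral {y - 1..x} std_normal_density) has_real_derivative (- std_normal_density y))
      (at y within {y-1..y+1})"
    by (auto intro!: derivative_eq_intros)
  then have "(normal_tail has_real_derivative - std_normal_density y) (at y within {y-1..y+1})"
    by (rule has_field_derivative_transform_within[where d = 1]) (auto simp: normal_tail_diff)
  moreover have "at y within {y-1..y+1} = at y"
    by (rule at_within_Icc_at) auto
  ultimately show ?thesis by simp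
qed

lemma DERIV_normal_tail [derivative_intros]:
  "(f has_real_derivative f') (at x within S) \<Longrightarrow>
   ((\<lambda>x. normal_tail (f x)) has_real_derivative - std_normal_density (f x) * f') (at x within S)"
  by (rule DERIV_chain2[OF has_real_derivative_normal_tail])

lemma DERIV_std_normal_density [derivative_intros]:
  "(f has_real_derivative f') (at x within S) \<Longrightarrow>
   ((\<lambda>x. std_normal_density (f x)) has_real_derivative - f x * std_normal_density (f x) * f') (at x within S)"
  unfolding std_normal_density_def
  by (auto intro!: derivative_eq_intros simp: field_simps power2_eq_square)

lemma continuous_on_normal_tail [continuous_intros]: "continuous_on A normal_tail"
  by (meson has_real_derivative_normal_tail DERIV_isCont continuous_at_imp_continuous_on)

lemma borel_measurable_normal_tail [measurable]: "normal_tail \<in> borel_measurable borel"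
  by (intro borel_measurable_continuous_onI continuous_intros)

lemma normal_tail_less_1: "normal_tail y < 1" and normal_tail_pos: "0 < normal_tail y"
  and normal_tail_strict_antimono: "a < b \<Longrightarrow> normal_tail b < normal_tail a"
proof -
  have st: "normal_tail b < normal_tail a" if "a < b" for a b
    by (rule DERIV_neg_imp_decreasing[OF that])
       (use has_real_derivative_normal_tail normal_density_pos[of 1] in fastforce)
  then show "a < b \<Longrightarrow> normal_tail b < normal_tail a" .
  interpret prob_space std_normal_distribution by (rule prob_space_std_normal)
  have "0 \<le> normal_tail y" "normal_tail y \<le> 1" for y by (auto simp: normal_tail_def)
  from this(2)[of "y - 1"] this(1)[of "y + 1"] st[of "y - 1" y] st[of y "y + 1"]
  show "normal_tail y < 1" "0 < normal_tail y" by linarith+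
qed

lemma distr_uminus_std_normal:
  "distr std_normal_distribution borel uminus = std_normal_distribution"
proof -
  interpret prob_space std_normal_distribution by (rule prob_space_std_normal)
  have "distributed std_normal_distribution lborel (\<lambda>x. x) std_normal_density"
    unfolding distributed_def by (auto simp: distr_id2)
  from normal_density_affine[OF this, of "-1" 0]
  have "distributed std_normal_distribution lborel uminus std_normal_density" by simp
  then have "distr std_normal_distribution lborel uminus = std_normal_distribution"
    unfolding distributed_def by simp
  moreover have "distr std_normal_distribution lborel uminus = distr std_normal_distribution borel uminus"
    by (intro distr_cong) auto
  ultimately show ?thesis by simp
qed

lemma normal_tail_uminus: "measure std_normal_distribution {..<y} = normal_tail (- y)"
proof -
  have "measure std_normal_distribution {..<y} = measure (distr std_normal_distribution borel uminus) {..<y}"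
    by (simp add: distr_uminus_std_normal)
  also have "\<dots> = measure std_normal_distribution (uminus -` {..<y})"
    by (subst measure_distr) auto
  also have "uminus -` {..<y} = {-y<..}" by auto
  finally show ?thesis by (simp add: normal_tail_def)
qed

lemma normal_tail_symmetric: "normal_tail (- y) = 1 - normal_tail y"
proof -
  interpret prob_space std_normal_distribution by (rule prob_space_std_normal)
  have "AE x in std_normal_distribution. x \<noteq> y"
    using AE_lborel_singleton[of y] by (subst AE_density) auto
  then have "measure std_normal_distribution {y<..} = measure std_normal_distribution {y..}"
    by (intro finite_measure_eq_AE) auto
  moreover have "{..<y} = space std_normal_distribution - {y..}" by auto
  ultimately show ?thesis
    unfolding normal_tail_uminus[symmetric] by (subst \<open>{..<y} = _\<close>, subst prob_compl) (auto simp: normal_tail_def)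
qed

lemma normal_tail_0: "normal_tail 0 = 1 / 2"
  using normal_tail_symmetric[of 0] by simp

lemma tendsto_std_normal_density: "(std_normal_density \<longlongrightarrow> 0) at_top"
  unfolding std_normal_density_def[abs_def] by real_asymp

text \<open>
  On the half line beyond \<open>y\<close> the variable is at least \<open>y\<close>, and \<open>x \<mapsto> x * \<phi> x\<close> has the primitive \<open>- \<phi>\<close>.
  This is the one tail estimate that is integrated by hand: all boundary terms in the sharper
  inequalities below vanish because of it.
\<close>
lemma mult_normal_tail_le: "y * normal_tail y \<le> std_normal_density y"
proof (cases "0 \<le> y")
  case True
  have "(\<integral>\<^sup>+x\<in>{y..}. ennreal (x * std_normal_density x) \<partial>lborel) = ennreal (0 - (- std_normal_density y))"
    using True by (intro nn_integral_FTC_atLeast)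
      (auto intro!: derivative_eq_intros tendsto_eq_intros tendsto_std_normal_density)
  moreover have "ennreal (y * normal_tail y) = (\<integral>\<^sup>+x\<in>{y<..}. ennreal (y * std_normal_density x) \<partial>lborel)"
  proof -
    interpret prob_space std_normal_distribution by (rule prob_space_std_normal)
    have "ennreal (normal_tail y) = (\<integral>\<^sup>+x. ennreal (std_normal_density x) * indicator {y<..} x \<partial>lborel)"
      unfolding normal_tail_def emeasure_eq_measure[symmetric]
      by (subst emeasure_density) auto
    then show ?thesis using True
      by (simp add: ennreal_mult mult.assoc normal_tail_def nn_integral_cmult)
  qed
  moreover have "(\<integral>\<^sup>+x\<in>{y<..}. ennreal (y * std_normal_density x) \<partial>lborel) \<le>
    (\<integral>\<^sup>+x\<in>{y..}. ennreal (x * std_normal_density x) \<partial>lborel)"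
    by (intro nn_integral_mono) (auto simp: indicator_def intro!: ennreal_leI mult_right_mono)
  ultimately have "ennreal (y * normal_tail y) \<le> ennreal (std_normal_density y)" by simp
  then show ?thesis by (subst (asm) ennreal_le_iff) auto
next
  case False
  then show ?thesis using normal_tail_pos[of y] normal_density_pos[of 1 0 y]
    by (smt (verit) mult_neg_pos)
qed

lemma tendsto_mult_std_normal_density: "((\<lambda>y. y * std_normal_density y) \<longlongrightarrow> 0) at_top"
  unfolding std_normal_density_def[abs_def] by real_asymp

lemma tendsto_square_normal_tail: "((\<lambda>y. y\<^sup>2 * normal_tail y) \<longlongrightarrow> 0) at_top"
proof (rule tendsto_sandwich[OF _ _ tendsto_const tendsto_mult_std_normal_density])
  show "\<forall>\<^sub>F y in at_top. 0 \<le> y\<^sup>2 * normal_tail y"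
    using normal_tail_pos by (intro always_eventually) (simp add: less_imp_le)
  show "\<forall>\<^sub>F y in at_top. y\<^sup>2 * normal_tail y \<le> y * std_normal_density y"
    using eventually_ge_at_top[of 0]
    by eventually_elim (use mult_normal_tail_le in \<open>auto simp: power2_eq_square mult.assoc intro: mult_left_mono\<close>)
qed

lemma tendsto_normal_tail: "(normal_tail \<longlongrightarrow> 0) at_top"
proof (rule tendsto_sandwich[OF _ _ tendsto_const tendsto_square_normal_tail])
  show "\<forall>\<^sub>F y in at_top. 0 \<le> normal_tail y"
    using normal_tail_pos by (intro always_eventually) (simp add: less_imp_le)
  show "\<forall>\<^sub>F y in at_top. normal_tail y \<le> y\<^sup>2 * normal_tail y"
    using eventually_ge_at_top[of 1]
  proof eventually_elim
    case (elim y)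
    then have "1 * normal_tail y \<le> y\<^sup>2 * normal_tail y"
      using normal_tail_pos[of y] by (intro mult_right_mono) auto
    then show ?case by simp
  qed
qed

lemma tendsto_mult_normal_tail: "((\<lambda>y. y * normal_tail y) \<longlongrightarrow> 0) at_top"
proof (rule tendsto_sandwich[OF _ _ tendsto_const tendsto_std_normal_density])
  show "\<forall>\<^sub>F y in at_top. 0 \<le> y * normal_tail y"
    using eventually_ge_at_top[of 0]
    by eventually_elim (simp add: normal_tail_pos less_imp_le)
qed (simp add: mult_normal_tail_le)

text \<open>
  The difference of the two sides decreases with derivative \<open>- normal_tail\<close> and vanishes at
  infinity, hence is positive. The next two inequalities are obtained in the same way, the
  derivative of each difference having its sign determined by the inequality before it.
\<close>
lemma std_normal_density_gt: "y * normal_tail y < std_normal_density y"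
proof -
  have "0 < std_normal_density y - y * normal_tail y"
  proof (rule DERIV_neg_imp_decreasing_at_top[where f = "\<lambda>y. std_normal_density y - y * normal_tail y"])
    fix x
    have "((\<lambda>y. std_normal_density y - y * normal_tail y) has_real_derivative - normal_tail x) (at x)"
      by (auto intro!: derivative_eq_intros)
    then show "\<exists>z. ((\<lambda>y. std_normal_density y - y * normal_tail y) has_real_derivative z) (at x) \<and> z < 0"
      using normal_tail_pos[of x] by fastforce
    show "((\<lambda>y. std_normal_density y - y * normal_tail y) \<longlongrightarrow> 0) at_top"
      using tendsto_diff[OF tendsto_std_normal_density tendsto_mult_normal_tail] by simp
  qed
  then show ?thesis by simp
qed

lemma normal_tail_gt: "y * std_normal_density y < (1 + y\<^sup>2) * normal_tail y"
proof -
  let ?f = "\<lambda>y. (1 + y\<^sup>2) * normal_tail y - y * std_normal_density y"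
  have "0 < ?f y"
  proof (rule DERIV_neg_imp_decreasing_at_top[where f = ?f])
    fix x
    have "(?f has_real_derivative 2 * (x * normal_tail x - std_normal_density x)) (at x)"
      by (auto intro!: derivative_eq_intros simp: algebra_simps power2_eq_square)
    then show "\<exists>z. (?f has_real_derivative z) (at x) \<and> z < 0"
      using std_normal_density_gt[of x] by fastforce
    have "((\<lambda>y. normal_tail y + y\<^sup>2 * normal_tail y - y * std_normal_density y) \<longlongrightarrow> 0 + 0 - 0) at_top"
      by (intro tendsto_intros tendsto_normal_tail tendsto_square_normal_tail tendsto_mult_std_normal_density)
    then show "(?f \<longlongrightarrow> 0) at_top" by (simp add: algebra_simps)
  qed
  then show ?thesis by simp
qed

text \<open>
  This is the lower bound of Birnbaum and Sampford for the Mills ratio \<open>normal_tail y / \<phi> y\<close>, in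
  a form free of square roots and valid for negative \<open>y\<close> as well.
\<close>
lemma std_normal_density_square_less:
  "(std_normal_density y)\<^sup>2 < (normal_tail y)\<^sup>2 + y * std_normal_density y * normal_tail y"
proof -
  let ?f = "\<lambda>y. (normal_tail y)\<^sup>2 + y * std_normal_density y * normal_tail y - (std_normal_density y)\<^sup>2"
  have "0 < ?f y"
  proof (rule DERIV_neg_imp_decreasing_at_top[where f = ?f])
    fix x
    have "(?f has_real_derivative std_normal_density x * (x * std_normal_density x - (1 + x\<^sup>2) * normal_tail x)) (at x)"
      by (auto intro!: derivative_eq_intros simp: algebra_simps power2_eq_square)
    then show "\<exists>z. (?f has_real_derivative z) (at x) \<and> z < 0"
      using normal_tail_gt[of x] normal_density_pos[of 1 0 x]
      by (intro exI conjI) (auto simp: mult_pos_neg)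
    have "(?f \<longlongrightarrow> 0\<^sup>2 + 0 * 0 - 0\<^sup>2) at_top"
      by (intro tendsto_intros tendsto_normal_tail tendsto_mult_std_normal_density tendsto_std_normal_density)
    then show "(?f \<longlongrightarrow> 0) at_top" by simp
  qed
  then show ?thesis by simp
qed

text \<open>
  The reciprocal of the Mills ratio.
\<close>
definition normal_hazard :: "real \<Rightarrow> real" where
  "normal_hazard y = std_normal_density y / normal_tail y"

lemma normal_hazard_pos: "0 < normal_hazard y"
  by (simp add: normal_hazard_def normal_density_pos normal_tail_pos)

lemma borel_measurable_normal_hazard [measurable]: "normal_hazard \<in> borel_measurable borel"
  unfolding normal_hazard_def[abs_def] by measurable

lemma normal_hazard_gt: "y < normal_hazard y"
  using std_normal_density_gt[of y] normal_tail_pos[of y] by (simp add: normal_hazard_def pos_less_divide_eq)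

lemma normal_hazard_square_less: "(normal_hazard y)\<^sup>2 < 1 + y * normal_hazard y"
proof -
  let ?s = "normal_tail y" and ?f = "std_normal_density y"
  have "?f\<^sup>2 / ?s\<^sup>2 < (?s\<^sup>2 + y * ?f * ?s) / ?s\<^sup>2"
    using std_normal_density_square_less[of y] normal_tail_pos[of y] by (intro divide_strict_right_mono) auto
  also have "\<dots> = 1 + y * (?f / ?s)"
    using normal_tail_pos[of y] by (simp add: add_divide_distrib power2_eq_square)
  finally show ?thesis by (simp add: normal_hazard_def power_divide)
qed

text \<open>
  The logarithm of the definition of the hazard rate. It trades \<open>y\<^sup>2 / 2\<close> for \<open>ln (1 / normal_tail y)\<close>,
  so that a comparison of \<open>y\<^sup>2\<close> with the square of the hazard rate becomes an implicit equation
  for the hazard rate as a function of the tail.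
\<close>
lemma ln_normal_hazard: "ln ((normal_hazard y)\<^sup>2 / 2) / 2 = ln (1 / normal_tail y) - y\<^sup>2 / 2 - ln (4 * pi) / 2"
proof -
  have p: "0 < normal_tail y" "0 < normal_hazard y" by (simp_all add: normal_tail_pos normal_hazard_pos)
  have "normal_hazard y = (1 / normal_tail y) * (exp (- y\<^sup>2 / 2) / sqrt (2 * pi))"
    by (simp add: normal_hazard_def std_normal_density_def)
  then have "ln (normal_hazard y) = ln (1 / normal_tail y) + (- y\<^sup>2 / 2 - ln (2 * pi) / 2)"
    using p by (simp add: ln_mult ln_div ln_sqrt)
  moreover have "ln (4 * pi) = ln 2 + ln (2 * pi)"
    using ln_mult[of 2 "2 * pi"] by simp
  moreover have "ln ((normal_hazard y)\<^sup>2 / 2) = 2 * ln (normal_hazard y) - ln 2"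
    using p by (simp add: ln_div ln_realpow)
  ultimately show ?thesis by (simp add: field_simps)
qed

text \<open>
  The inequality \<open>\<lambda>\<^sup>2 < 1 + y * \<lambda>\<close> implies \<open>\<lambda>\<^sup>2 - 2 \<le> y\<^sup>2\<close>, also for negative \<open>y\<close>, where the
  left-hand side is negative.
\<close>
lemma normal_hazard_upper:
  "(normal_hazard y)\<^sup>2 / 2 + ln ((normal_hazard y)\<^sup>2 / 2) / 2 \<le> ln (1 / normal_tail y) + 1"
proof -
  let ?l = "normal_hazard y"
  have "?l\<^sup>2 - 2 \<le> y\<^sup>2"
  proof (cases "?l\<^sup>2 \<le> 2")
    case True
    then show ?thesis by (smt (verit) zero_le_power2)
  next
    case False
    have "?l\<^sup>2 * (?l\<^sup>2 - 2) \<le> (?l\<^sup>2 - 1)\<^sup>2" by (simp add: power2_eq_square algebra_simps)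
    also have "\<dots> \<le> (y * ?l)\<^sup>2"
      using False normal_hazard_square_less[of y] by (intro power_mono) auto
    also have "\<dots> = ?l\<^sup>2 * y\<^sup>2" by (simp add: power_mult_distrib)
    finally show ?thesis using normal_hazard_pos[of y] by simp
  qed
  moreover have "0 \<le> ln (4 * pi)" using pi_gt3 by (intro ln_ge_zero) auto
  ultimately show ?thesis unfolding ln_normal_hazard by linarith
qed

lemma normal_hazard_lower:
  assumes "0 \<le> y"
  shows "ln (1 / normal_tail y) - ln (4 * pi) / 2 \<le> (normal_hazard y)\<^sup>2 / 2 + ln ((normal_hazard y)\<^sup>2 / 2) / 2"
proof -
  have "y\<^sup>2 \<le> (normal_hazard y)\<^sup>2"
    using assms normal_hazard_gt[of y] by (intro power_mono) auto
  then show ?thesis by (simp add: ln_normal_hazard)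
qed

section \<open>Moments of the Beta law\<close>

text \<open>
  Under the standard normal law the tail of the sample point is uniform on the unit interval, so
  this is the unnormalised density of a Beta variable with parameters \<open>b + 1\<close> and \<open>a + 1\<close>.
\<close>
abbreviation (input) cdf_weight :: "nat \<Rightarrow> nat \<Rightarrow> real \<Rightarrow> real" where
  "cdf_weight a b y \<equiv> (1 - normal_tail y) ^ a * normal_tail y ^ b"

lemma cdf_weight_bounds: "0 \<le> cdf_weight a b y" "cdf_weight a b y \<le> 1"
  using normal_tail_pos[of y] normal_tail_less_1[of y]
  by (auto intro!: mult_nonneg_nonneg mult_le_one power_le_one zero_le_power)

lemma integrable_cdf_weight: "integrable std_normal_distribution (cdf_weight a b)"
proof -
  interpret prob_space std_normal_distribution by (rule prob_space_std_normal)
  show ?thesis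
    by (rule integrable_const_bound[where B = 1]) (use cdf_weight_bounds in auto)
qed

lemma cdf_weight_integral_base: "(\<integral>y. (1 - normal_tail y) ^ a \<partial>std_normal_distribution) = 1 / (real a + 1)"
proof -
  let ?F = "\<lambda>y. (1 - normal_tail y) ^ Suc a / (real a + 1)"
  have lim_top: "((\<lambda>y. 1 - normal_tail y) \<longlongrightarrow> 1) at_top"
    using tendsto_diff[OF tendsto_const[of 1] tendsto_normal_tail] by simp
  have lim_bot: "((\<lambda>y. 1 - normal_tail y) \<longlongrightarrow> 0) at_bot"
    using tendsto_normal_tail unfolding at_bot_mirror filterlim_filtermap
    by (simp add: normal_tail_symmetric)
  have "(LBINT y=-\<infinity>..\<infinity>. (1 - normal_tail y) ^ a * std_normal_density y) = 1 / (real a + 1) - 0"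
  proof (rule interval_integral_FTC_nonneg(2)[where F = ?F])
    fix y :: real
    show "(?F has_real_derivative (1 - normal_tail y) ^ a * std_normal_density y) (at y)"
      by (rule derivative_eq_intros refl | simp)+ (simp add: field_simps)
    show "isCont (\<lambda>y. (1 - normal_tail y) ^ a * std_normal_density y) y"
      by (intro continuous_intros continuous_on_interior[of UNIV]) (auto intro!: continuous_intros)
  next
    show "((?F \<circ> real_of_ereal) \<longlongrightarrow> 0) (at_right (- \<infinity>))"
      unfolding ereal_tendsto_simps
      using tendsto_divide[OF tendsto_power[OF lim_bot, of "Suc a"] tendsto_const[of "real a + 1"]] by simp
    show "((?F \<circ> real_of_ereal) \<longlongrightarrow> 1 / (real a + 1)) (at_left \<infinity>)"
      unfolding ereal_tendsto_simps
      using tendsto_divide[OF tendsto_power[OF lim_top, of "Suc a"] tendsto_const[of "real a + 1"]] by simp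
    show "AE y in lborel. - \<infinity> < ereal y \<longrightarrow> ereal y < \<infinity> \<longrightarrow> 0 \<le> (1 - normal_tail y) ^ a * std_normal_density y"
      using normal_tail_less_1 by (auto intro!: mult_nonneg_nonneg zero_le_power simp: less_imp_le)
  qed auto
  then show ?thesis
    by (subst integral_density) (auto simp: interval_lebesgue_integral_def set_lebesgue_integral_def mult.commute)
qed

text \<open>
  The Beta integral, without a change of variables: \<open>s * w = w - (1 - s) * w\<close> lowers \<open>b\<close> at the cost
  of raising \<open>a\<close>, and for \<open>b = 0\<close> the integrand is a derivative.
\<close>
lemma cdf_weight_integral:
  "(\<integral>y. cdf_weight a b y \<partial>std_normal_distribution) = fact a * fact b / fact (a + b + 1)"
proof (induction b arbitrary: a)
  case 0
  have "fact (a + 0 + 1) = (real a + 1) * fact a" by simp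
  then show ?case
    using fact_nonzero[of a, where ?'a = real] by (simp add: cdf_weight_integral_base del: fact_Suc)
next
  case (Suc b)
  have "cdf_weight a (Suc b) y = cdf_weight a b y - cdf_weight (Suc a) b y" for y
    by (simp add: algebra_simps)
  then have "(\<integral>y. cdf_weight a (Suc b) y \<partial>std_normal_distribution) =
      fact a * fact b / fact (a + b + 1) - fact (Suc a) * fact b / fact (Suc a + b + 1)"
    by (simp only: Bochner_Integration.integral_diff[OF integrable_cdf_weight integrable_cdf_weight] Suc.IH)
  also have "\<dots> = fact a * fact (Suc b) / fact (a + Suc b + 1)"
  proof -
    have "x * y / z - (real a + 1) * x * y / ((real a + real b + 2) * z) =
        x * ((real b + 1) * y) / ((real a + real b + 2) * z)" if "z \<noteq> 0" for x y z :: real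
      using that by (simp add: divide_simps) (simp add: algebra_simps)
    moreover have "fact (Suc a) = (real a + 1) * fact a" "fact (Suc b) = (real b + 1) * fact b"
      "fact (Suc a + b + 1) = (real a + real b + 2) * fact (a + b + 1)"
      "fact (a + Suc b + 1) = (real a + real b + 2) * fact (a + b + 1)" by simp_all
    ultimately show ?thesis using fact_nonzero[of "a + b + 1"] by metis
  qed
  finally show ?case .
qed

text \<open>
  Each of the first \<open>d div 2\<close> factors of \<open>fact (d - 1)\<close> is at least \<open>d / 2\<close>.
\<close>
lemma fact_ratio_lower:
  assumes "k \<le> d div 2" "k < d"
  shows "(real d / 2) ^ k * fact (d - 1 - k) \<le> fact (d - 1)"
  using assms
proof (induction k)
  case (Suc k)
  then have eq: "d - 1 - k = Suc (d - 1 - Suc k)" by linarith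
  have "(real d / 2) ^ Suc k * fact (d - 1 - Suc k) =
      (real d / 2) ^ k * ((real d / 2) * fact (d - 1 - Suc k))" by simp
  also have "\<dots> \<le> (real d / 2) ^ k * fact (d - 1 - k)"
    unfolding eq fact_Suc of_nat_mult of_nat_fact
    using Suc.prems by (intro mult_left_mono mult_right_mono) auto
  also have "\<dots> \<le> fact (d - 1)" using Suc by simp
  finally show ?case .
qed simp

lemma fact_ratio_upper: "fact (n + k) \<le> real (n + k) ^ k * fact n"
proof (induction k)
  case (Suc k)
  have "fact (n + Suc k) = real (n + Suc k) * fact (n + k)" by simp
  also have "\<dots> \<le> real (n + Suc k) * (real (n + k) ^ k * fact n)"
    using Suc by (intro mult_left_mono) auto
  also have "\<dots> \<le> real (n + Suc k) * (real (n + Suc k) ^ k * fact n)"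
    by (intro mult_left_mono mult_right_mono power_mono) auto
  finally show ?case by (simp add: mult.assoc)
qed simp

lemma power_mult_fact_le: "real n ^ k * fact n \<le> fact (n + k)"
proof (induction k)
  case (Suc k)
  have "real n ^ Suc k * fact n = real n * (real n ^ k * fact n)" by simp
  also have "\<dots> \<le> real (n + Suc k) * fact (n + k)"
    using Suc by (intro mult_mono) auto
  finally show ?case by simp
qed simp

lemma cdf_weight_inverse_moment:
  assumes "k \<le> d div 2" "k < d" "d \<le> n"
  shows "(\<integral>y. cdf_weight (n - d) (d - 1 - k) y \<partial>std_normal_distribution) \<le>
         (2 * real n / real d) ^ k * (\<integral>y. cdf_weight (n - d) (d - 1) y \<partial>std_normal_distribution)"
proof -
  have e: "n - d + (d - 1 - k) + 1 = n - k" "n - d + (d - 1) + 1 = n" using assms by linarith+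
  have 1: "fact (n - k + k) \<le> real n ^ k * fact (n - k)" using fact_ratio_upper[of "n - k" k] assms by simp
  have nk: "n - k + k = n" using assms by simp
  have "fact (d - 1 - k) / fact (n - k) \<le> (2 * real n / real d) ^ k * (fact (d - 1) / fact n)"
  proof -
    have "fact (d - 1 - k) * fact n * (real d / 2) ^ k \<le> fact (d - 1) * (real n ^ k * fact (n - k))"
      using mult_mono[OF fact_ratio_lower[OF assms(1,2)] 1[unfolded nk]] by (simp add: mult_ac)
    then show ?thesis using assms by (simp add: field_simps power_divide power_mult_distrib)
  qed
  then have "fact (n - d) * (fact (d - 1 - k) / fact (n - k)) \<le>
      fact (n - d) * ((2 * real n / real d) ^ k * (fact (d - 1) / fact n))"
    by (intro mult_left_mono) auto
  then show ?thesis unfolding cdf_weight_integral e by (simp add: mult_ac)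
qed

lemma cdf_weight_moment:
  assumes "1 \<le> d" "d \<le> n"
  shows "(\<integral>y. cdf_weight (n - d) (d - 1 + d) y \<partial>std_normal_distribution) \<le>
         (2 * real d / real n) ^ d * (\<integral>y. cdf_weight (n - d) (d - 1) y \<partial>std_normal_distribution)"
proof -
  have e: "n - d + (d - 1 + d) + 1 = n + d" "n - d + (d - 1) + 1 = n" using assms by linarith+
  have "fact (d - 1 + d) \<le> real (d - 1 + d) ^ d * fact (d - 1)" by (rule fact_ratio_upper)
  also have "\<dots> \<le> (2 * real d) ^ d * fact (d - 1)"
    by (intro mult_right_mono power_mono) auto
  finally have 1: "fact (d - 1 + d) \<le> (2 * real d) ^ d * (fact (d - 1) :: real)" .
  have "fact (d - 1 + d) / fact (n + d) \<le> (2 * real d / real n) ^ d * (fact (d - 1) / fact n)"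
    using mult_mono[OF 1 power_mult_fact_le[of n d]] assms
    by (simp add: field_simps power_divide power_mult_distrib)
  then have "fact (n - d) * (fact (d - 1 + d) / fact (n + d)) \<le>
      fact (n - d) * ((2 * real d / real n) ^ d * (fact (d - 1) / fact n))"
    by (intro mult_left_mono) auto
  then show ?thesis unfolding cdf_weight_integral e by (simp add: mult_ac)
qed

section \<open>A moment of the hazard rate\<close>

text \<open>
  In terms of \<open>r = ln (x / c)\<close> the right-hand side is the convex function \<open>c * (exp r - 1) + r / 2\<close>, and
  the left-hand side is its tangent at \<open>r = 0\<close>.
\<close>
lemma add_half_ln_tangent:
  fixes x c :: real
  assumes "0 < x" "0 < c"
  shows "(c + 1/2) * ln (x / c) \<le> (x + ln x / 2) - (c + ln c / 2)"
proof -
  have "c * (1 + ln (x / c)) \<le> c * exp (ln (x / c))"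
    using assms by (intro mult_left_mono exp_ge_add_one_self) auto
  moreover have "exp (ln (x / c)) = x / c" using assms by simp
  ultimately show ?thesis using assms by (simp add: ln_div algebra_simps diff_divide_distrib)
qed

text \<open>
  A fractional power lies below its tangent at 1, so that its mean is bounded by that of the
  variable itself.
\<close>
lemma Bernoulli_inequality_powr:
  fixes p v :: real
  assumes "0 \<le> p" "p \<le> 1" "0 < v"
  shows "v powr p \<le> 1 + p * (v - 1)"
proof -
  have "v powr p * 1 powr (1 - p) \<le> p * v + (1 - p) * 1"
    using assms by (intro Youngs_inequality_0) auto
  then show ?thesis by (simp add: algebra_simps)
qed

lemma exp_1_gt: "2718 / 1000 < exp (1::real)"
  using e_approx_32 by (simp add: abs_if split: if_splits)

text \<open>
  For \<open>c = L * exp (- x)\<close> with \<open>x = (ln L / 2 + 68) / L\<close>, the value at which \<open>G\<close> is to be bounded from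
  below: as \<open>L * exp (- x)\<close> is about \<open>L - ln L / 2 - 68\<close>, the sum is about \<open>L - 68\<close> when \<open>L\<close> is
  large. The number \<open>68 = 2 * 34\<close> comes from the lower end of the range of \<open>\<theta>\<close>.
\<close>
lemma add_half_ln_level_le:
  assumes L: "exp 1 \<le> (L::real)"
  shows "L * exp (- (ln L / 2 + 68) / L) + ln (L * exp (- (ln L / 2 + 68) / L)) / 2 \<le> L - 4 * ln 2"
proof -
  note e = exp_1_gt
  with L have L2: "2718 / 1000 < L" by simp
  define a where "a = ln L / 2 + 68"
  define x where "x = a / L"
  have lnL: "ln L \<ge> 1" using L by (subst ln_ge_iff) (auto intro: less_le_trans[OF exp_gt_zero])
  have x0: "0 < x" unfolding x_def a_def using lnL L2 by simp
  have main: "L * exp (- x) + ln L / 2 - x / 2 \<le> L - 4 * ln 2"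
  \<comment> \<open>For \<open>L \<le> 34\<close> the exponent \<open>x\<close> is at least 2 and \<open>L * exp (- x)\<close> is a small fraction of \<open>L\<close>;
    for larger \<open>L\<close> the bound \<open>exp (- x) \<le> 1 / (1 + x)\<close> is sharp enough.\<close>
  proof (cases "L \<le> 34")
    case True
    have x2: "2 \<le> x" unfolding x_def a_def using True lnL L2 by (simp add: field_simps)
    have "(7::real) \<le> (2718 / 1000)\<^sup>2" by (simp add: power2_eq_square)
    also have "\<dots> \<le> exp 1 ^ 2" using e by (intro power_mono) auto
    also have "\<dots> = exp 2" by (simp flip: exp_of_nat_mult)
    also have "\<dots> \<le> exp x" using x2 by simp
    finally have "exp (- x) \<le> 1 / 7" by (simp add: exp_minus field_simps)
    then have 1: "L * exp (- x) \<le> L / 7" using L2 mult_left_mono[of "exp (-x)" "1/7" L] by simp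
    have "1 + (ln L - 1) \<le> exp (ln L - 1)" by (rule exp_ge_add_one_self)
    also have "\<dots> = L / exp 1" using L2 by (simp add: exp_diff)
    also have "\<dots> \<le> L / (2718 / 1000)" using e L2 by (intro divide_left_mono) auto
    finally have 2: "ln L \<le> L / (2718 / 1000)" by simp
    then have "ln L \<le> 1000 / 2718 * L" by simp
    then show ?thesis using 1 x2 ln2_le_25_over_36 L2 by linarith
  next
    case False
    define r where "r = sqrt L"
    have r: "L = r\<^sup>2" using L2 by (simp add: r_def)
    have r5: "58 / 10 \<le> r" unfolding r_def using False by (intro real_le_rsqrt) (simp add: power2_eq_square)
    have lnr: "ln L / 2 \<le> r - 1" using ln_le_minus_one[of r] r5 by (simp add: r ln_realpow)
    have "exp (- x) \<le> 1 / (1 + x)"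
      using exp_ge_add_one_self[of x] x0 by (simp add: exp_minus field_simps)
    then have "L * exp (- x) \<le> L * (1 / (1 + x))" using L2 by (intro mult_left_mono) auto
    also have "\<dots> = L * L / (L + a)" unfolding x_def using L2 by (simp add: field_simps)
    also have "\<dots> \<le> L - (ln L / 2 + 28 / 10)"
    proof -
      have "a * (ln L / 2 + 28 / 10) \<le> (r + 67) * (r + 18 / 10)"
        unfolding a_def using lnr lnL by (intro mult_mono) auto
      also have "\<dots> \<le> 652 / 10 * r\<^sup>2"
      proof -
        have "58 / 10 * r \<le> r * r" "58 / 10 * (58 / 10) \<le> r * r"
          using r5 by (intro mult_mono; simp)+
        moreover have "(r + 67) * (r + 18 / 10) = r * r + 688 / 10 * r + 1206 / 10"
          by (simp add: field_simps)
        ultimately show ?thesis unfolding power2_eq_square by linarith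
      qed
      finally have "a * (ln L / 2 + 28 / 10) \<le> L * (652 / 10)" by (simp add: r)
      then have "L * L \<le> (L - (ln L / 2 + 28 / 10)) * (L + a)" by (simp add: a_def algebra_simps)
      moreover have "0 < L + a" using L2 lnL by (simp add: a_def)
      ultimately show ?thesis by (simp add: pos_divide_le_eq)
    qed
    finally show ?thesis using ln2_le_25_over_36 x0 by simp
  qed
  moreover have "ln (L * exp (- x)) = ln L - x" using L2 by (simp add: ln_mult)
  moreover have eq: "- (ln L / 2 + 68) / L = - x"
    unfolding x_def a_def by (rule minus_divide_left[symmetric])
  ultimately show ?thesis unfolding eq by (simp add: diff_divide_distrib)
qed

text \<open>
  \<open>Z / B\<close> is the mean of \<open>(G / L)\<^sup>m\<close>, \<open>G = \<lambda>\<^sup>2 / 2\<close>, when the tail \<open>s\<close> is a Beta variable of mean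
  about \<open>d / n\<close>. Everything is expressed through the normalised variable \<open>t = n * s / d\<close>, for which
  \<open>ln (1 / s) = L - ln t\<close>. Both bounds are pointwise estimates of \<open>(G / L)\<^sup>m\<close> by functions of \<open>t\<close>
  that are linear in an integer power of \<open>t\<close>, so that only moments of the Beta law are needed.
\<close>
lemma hazard_power_integral_bounds:
  fixes d n :: nat
  assumes d: "2 \<le> d" and n: "exp (exp 1) * real d \<le> real n"
  defines "L \<equiv> ln (real n / real d)" and "m \<equiv> (real d - 1) / 2"
  defines "B \<equiv> \<integral>y. cdf_weight (n - d) (d - 1) y \<partial>std_normal_distribution"
  defines "Z \<equiv> \<integral>y. cdf_weight (n - d) (d - 1) y * ((normal_hazard y)\<^sup>2 / 2 / L) powr m \<partial>std_normal_distribution"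
  shows "Z \<le> B * exp (m * ((4 - ln L / 2) / L))"
    and "B * ((1 - (1 / 2) ^ d) * exp (- m * ((ln L / 2 + 68) / L))) \<le> Z"
proof -
  let ?w = "cdf_weight (n - d) (d - 1)"
  define G where "G y = (normal_hazard y)\<^sup>2 / 2" for y
  define t where "t y = real n * normal_tail y / real d" for y
  have nd: "exp (exp 1) \<le> real n / real d" using n d by (simp add: field_simps)
  note e = exp_1_gt
  have npos: "0 < n" using nd by (intro gr0I) (auto simp: not_le)
  have L: "exp 1 \<le> L" unfolding L_def using nd npos d by (subst ln_ge_iff) auto
  have L2: "2 < L" using L e by linarith
  have lnL: "1 \<le> ln L" using L L2 by (subst ln_ge_iff) auto
  have ee: "8 \<le> exp (exp (1::real))"
  proof -
    have "(8::real) \<le> (2718 / 1000 * (2718 / 1000)) * (3 / 2)" by simp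
    also have "\<dots> \<le> (exp 1 * exp 1) * exp (1 / 2)"
      using e exp_ge_add_one_self[of "1/2"] by (intro mult_mono) auto
    also have "\<dots> = exp (5 / 2)" by (simp flip: exp_add)
    also have "\<dots> \<le> exp (exp 1)" using e by simp
    finally show ?thesis .
  qed
  have "1 * real d \<le> exp (exp 1) * real d" using ee by (intro mult_right_mono) auto
  then have dn: "d \<le> n" using n by linarith
  have m0: "0 \<le> m" using d by (simp add: m_def)
  have G0: "0 < G y" for y using normal_hazard_pos[of y] by (simp add: G_def)
  have t0: "0 < t y" for y using normal_tail_pos[of y] npos d by (simp add: t_def)
  have ln_t: "ln (1 / normal_tail y) = L - ln (t y)" for y
    using normal_tail_pos[of y] npos d by (simp add: L_def t_def ln_div ln_mult)
  have B0: "0 < B" unfolding B_def cdf_weight_integral by simp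
  have w0: "0 \<le> ?w y" for y by (rule cdf_weight_bounds)
  note int = integrable_cdf_weight

  \<comment> \<open>The tangent at \<open>G = L\<close> gives \<open>(G / L)\<^sup>m \<le> exp (q * (1 - ln L / 2)) * t\<^sup>-\<^sup>q\<close>. The real exponent \<open>q\<close>
    is below \<open>k = d div 2\<close>, and \<open>v = (2 * t)\<^sup>-\<^sup>k\<close> has mean at most 1, so that Bernoulli's inequality
    for \<open>v\<^sup>q\<^sup>/\<^sup>k\<close> costs nothing but the factor \<open>2\<^sup>q\<close>.\<close>
  define q where "q = m / (L + 1 / 2)"
  define k where "k = d div 2"
  define v where "v y = (1 / (2 * t y)) ^ k" for y
  have k: "1 \<le> k" "k \<le> d div 2" "k < d" using d by (auto simp: k_def)
  have q0: "0 \<le> q" using m0 L2 by (simp add: q_def)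
  have "q \<le> m" unfolding q_def using divide_left_mono[of 1 "L + 1/2" m] m0 L2 by simp
  also have "m \<le> real k"
  proof -
    have "d \<le> 2 * (d div 2) + 1" by linarith
    then have "real d \<le> real (2 * (d div 2) + 1)" by (rule of_nat_mono)
    then show ?thesis by (simp add: m_def k_def)
  qed
  finally have qk: "0 \<le> q / real k" "q / real k \<le> 1" using k q0 by auto
  define c where "c = exp (q * (1 - ln L / 2)) * 2 powr q"
  have c0: "0 < c" by (simp add: c_def)
  have upper: "(G y / L) powr m \<le> c * (1 + q / real k * (v y - 1))" for y
  proof -
    have "(L + 1/2) * ln (G y / L) \<le> (G y + ln (G y) / 2) - (L + ln L / 2)"
      using add_half_ln_tangent[of "G y" L] G0 L2 by simp
    also have "\<dots> \<le> 1 - ln L / 2 - ln (t y)"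
      using normal_hazard_upper[of y] ln_t[of y] by (simp add: G_def)
    finally have "ln (G y / L) \<le> (1 - ln L / 2 - ln (t y)) / (L + 1/2)"
      using L2 by (simp add: pos_le_divide_eq mult.commute)
    then have "m * ln (G y / L) \<le> m * ((1 - ln L / 2 - ln (t y)) / (L + 1/2))"
      using m0 by (rule mult_left_mono)
    also have "\<dots> = q * (1 - ln L / 2) + q * ln (1 / t y)"
      using t0[of y] by (simp add: q_def ln_div algebra_simps diff_divide_distrib add_divide_distrib)
    finally have "(G y / L) powr m \<le> exp (q * (1 - ln L / 2) + q * ln (1 / t y))"
      using G0[of y] L2 by (simp add: powr_def)
    also have "\<dots> = exp (q * (1 - ln L / 2)) * (1 / t y) powr q"
      using t0[of y] by (simp add: powr_def exp_add)
    also have "(1 / t y) powr q = 2 powr q * (1 / (2 * t y)) powr q"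
      using t0[of y] by (subst powr_mult[symmetric]) auto
    also have "(1 / (2 * t y)) powr q = v y powr (q / real k)"
      unfolding v_def using t0[of y] k by (subst powr_realpow[symmetric]) (auto simp: powr_powr)
    finally have "(G y / L) powr m \<le> c * v y powr (q / real k)" by (simp add: c_def mult_ac)
    also have "\<dots> \<le> c * (1 + q / real k * (v y - 1))"
      using c0 qk t0[of y] by (intro mult_left_mono Bernoulli_inequality_powr) (auto simp: v_def)
    finally show ?thesis .
  qed
  have wv: "?w y * v y = (real d / (2 * real n)) ^ k * cdf_weight (n - d) (d - 1 - k) y" for y
  proof -
    have "normal_tail y ^ (d - 1) = normal_tail y ^ (d - 1 - k) * normal_tail y ^ k"
      using k by (simp flip: power_add)
    then show ?thesis
      using normal_tail_pos[of y] npos d by (simp add: v_def t_def power_divide power_mult_distrib)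
  qed
  have int_v: "integrable std_normal_distribution (\<lambda>y. ?w y * v y)"
    unfolding wv using int by (intro integrable_mult_right)
  have Ev: "(\<integral>y. ?w y * v y \<partial>std_normal_distribution) \<le> B"
  proof -
    have "(\<integral>y. ?w y * v y \<partial>std_normal_distribution) =
        (real d / (2 * real n)) ^ k * (\<integral>y. cdf_weight (n - d) (d - 1 - k) y \<partial>std_normal_distribution)"
      unfolding wv by simp
    also have "\<dots> \<le> (real d / (2 * real n)) ^ k * ((2 * real n / real d) ^ k * B)"
      unfolding B_def using k dn by (intro mult_left_mono cdf_weight_inverse_moment) auto
    also have "\<dots> = B" using npos d by (simp add: power_divide power_mult_distrib)
    finally show ?thesis .
  qed
  have int_up: "integrable std_normal_distribution (\<lambda>y. c * (?w y + q / real k * (?w y * v y - ?w y)))"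
    using int int_v by (intro integrable_mult_right Bochner_Integration.integrable_add Bochner_Integration.integrable_diff)
  have le_up: "?w y * (G y / L) powr m \<le> c * (?w y + q / real k * (?w y * v y - ?w y))" for y
  proof -
    have "w * (c * (1 + p * (u - 1))) = c * (w + p * (w * u - w))" for w p u :: real
      by (simp add: algebra_simps)
    then show ?thesis using mult_left_mono[OF upper[of y] w0[of y]] by metis
  qed
  have int_Z: "integrable std_normal_distribution (\<lambda>y. ?w y * (G y / L) powr m)"
  proof (rule Bochner_Integration.integrable_bound[OF int_up])
    show "AE y in std_normal_distribution. norm (?w y * (G y / L) powr m)
        \<le> norm (c * (?w y + q / real k * (?w y * v y - ?w y)))"
    proof (rule AE_I2)
      fix y
      have "0 \<le> ?w y * (G y / L) powr m" by (rule mult_nonneg_nonneg[OF w0 powr_ge_zero])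
      then show "norm (?w y * (G y / L) powr m) \<le> norm (c * (?w y + q / real k * (?w y * v y - ?w y)))"
        using le_up[of y] unfolding real_norm_def by linarith
    qed
  qed (simp add: G_def)
  have "Z \<le> (\<integral>y. c * (?w y + q / real k * (?w y * v y - ?w y)) \<partial>std_normal_distribution)"
    unfolding Z_def G_def[symmetric] using le_up by (intro integral_mono int_up int_Z)
  also have "\<dots> = c * (B + q / real k * ((\<integral>y. ?w y * v y \<partial>std_normal_distribution) - B))"
    unfolding B_def using int int_v by simp
  also have "\<dots> \<le> c * (B + q / real k * 0)"
    using Ev qk c0 by (intro mult_left_mono add_left_mono) auto
  also have "\<dots> = B * exp (q * (1 + ln 2 - ln L / 2))"
    by (simp add: c_def powr_def algebra_simps flip: exp_add)
  also have "q * (1 + ln 2 - ln L / 2) \<le> m * ((4 - ln L / 2) / L)"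
  proof -
    have "ln L \<le> L" using ln_le_minus_one[of L] L2 by simp
    moreover have "L * ln 2 \<le> L * (25 / 36)" using ln2_le_25_over_36 L2 by (intro mult_left_mono) auto
    moreover have "(4 - ln L / 2) * (L + 1 / 2) - (1 + ln 2 - ln L / 2) * L = 3 * L + 2 - ln L / 4 - L * ln 2"
      by (simp add: field_simps)
    ultimately have "(1 + ln 2 - ln L / 2) * L \<le> (4 - ln L / 2) * (L + 1 / 2)" using L2 by linarith
    then have "(1 + ln 2 - ln L / 2) / (L + 1 / 2) \<le> (4 - ln L / 2) / L"
      using L2 by (simp only: pos_divide_le_eq pos_le_divide_eq times_divide_eq_left)
    from mult_left_mono[OF this m0] show ?thesis by (simp add: q_def)
  qed
  finally show "Z \<le> B * exp (m * ((4 - ln L / 2) / L))"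
    using B0 by simp

  \<comment> \<open>On \<open>t \<le> 4\<close> the implicit inequality for the hazard rate gives \<open>L * exp (- x) \<le> G\<close>; for \<open>t > 4\<close> the
    left-hand side of the next inequality is not positive. As the mean of \<open>t\<^sup>d\<close> is at most \<open>2\<^sup>d\<close>, the
    mean of \<open>(t / 4)\<^sup>d\<close> is at most \<open>2\<^sup>-\<^sup>d\<close>.\<close>
  define x where "x = (ln L / 2 + 68) / L"
  have lower: "exp (- m * x) * (1 - (t y / 4) ^ d) \<le> (G y / L) powr m" for y
  proof (cases "t y \<le> 4")
    case False
    then have "1 \<le> (t y / 4) ^ d" by (intro one_le_power) auto
    then have "exp (- m * x) * (1 - (t y / 4) ^ d) \<le> 0" by (intro mult_nonneg_nonpos) auto
    then show ?thesis by (rule order_trans) simp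
  next
    case True
    \<comment> \<open>As \<open>n / d \<ge> 8\<close>, the condition \<open>t \<le> 4\<close> means \<open>s \<le> 1 / 2\<close>, hence \<open>y \<ge> 0\<close>.\<close>
    have y0: "0 \<le> y"
    proof (rule ccontr)
      assume "\<not> 0 \<le> y"
      then have "1 / 2 < normal_tail y" using normal_tail_strict_antimono[of y 0] normal_tail_0 by simp
      then have "real n / real d * (1 / 2) < real n / real d * normal_tail y"
        using npos d by (intro mult_strict_left_mono) auto
      then show False using True nd ee by (simp add: t_def)
    qed
    have "exp (- x) \<le> G y / L"
    proof (rule ccontr)
      assume "\<not> ?thesis"
      then have less: "G y < L * exp (- x)" using L2 by (simp add: pos_le_divide_eq not_le mult.commute)
      then have "G y + ln (G y) / 2 < L * exp (- x) + ln (L * exp (- x)) / 2"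
        using G0[of y] L2 by (intro add_strict_mono divide_strict_right_mono) auto
      also have "\<dots> \<le> L - 4 * ln 2"
        using add_half_ln_level_le[OF L] unfolding x_def minus_divide_left .
      also have "\<dots> \<le> L - ln (t y) - ln (4 * pi) / 2"
      proof -
        have "ln (t y) \<le> ln 4" using True t0[of y] by simp
        moreover have "ln (4 * pi) \<le> ln 16" using pi_less_4 by (subst ln_le_cancel_iff) auto
        moreover have "ln (4::real) = 2 * ln 2" "ln (16::real) = 4 * ln 2"
          using ln_realpow[of 2 2] ln_realpow[of 2 4] by simp_all
        ultimately show ?thesis by linarith
      qed
      finally show False using normal_hazard_lower[OF y0] ln_t[of y] by (simp add: G_def)
    qed
    then have "exp (- x) powr m \<le> (G y / L) powr m" using m0 by (intro powr_mono2) auto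
    moreover have "exp (- m * x) * (1 - (t y / 4) ^ d) \<le> exp (- m * x) * 1"
      using t0[of y] by (intro mult_left_mono) auto
    moreover have "exp (- x) powr m = exp (- m * x)" by (simp add: powr_def)
    ultimately show ?thesis by linarith
  qed
  have wt: "?w y * (t y / 4) ^ d = (real n / (4 * real d)) ^ d * cdf_weight (n - d) (d - 1 + d) y" for y
    by (simp add: t_def power_divide power_mult_distrib power_add mult_ac)
  have Et: "(\<integral>y. ?w y * (t y / 4) ^ d \<partial>std_normal_distribution) \<le> (1 / 2) ^ d * B"
  proof -
    have "(\<integral>y. ?w y * (t y / 4) ^ d \<partial>std_normal_distribution) =
        (real n / (4 * real d)) ^ d * (\<integral>y. cdf_weight (n - d) (d - 1 + d) y \<partial>std_normal_distribution)"
      unfolding wt by simp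
    also have "\<dots> \<le> (real n / (4 * real d)) ^ d * ((2 * real d / real n) ^ d * B)"
      unfolding B_def using d dn by (intro mult_left_mono cdf_weight_moment) auto
    also have "\<dots> = ((real n / (4 * real d)) * (2 * real d / real n)) ^ d * B"
      by (simp only: power_mult_distrib mult.assoc)
    also have "(real n / (4 * real d)) * (2 * real d / real n) = 1 / 2"
      using npos d by simp
    finally show ?thesis .
  qed
  have int_t: "integrable std_normal_distribution (\<lambda>y. ?w y * (t y / 4) ^ d)"
    unfolding wt using int by (intro integrable_mult_right)
  have int_lo: "integrable std_normal_distribution (\<lambda>y. exp (- m * x) * (?w y - ?w y * (t y / 4) ^ d))"
    using int int_t by (intro integrable_mult_right Bochner_Integration.integrable_diff)
  have "B * ((1 - (1 / 2) ^ d) * exp (- m * x)) = exp (- m * x) * (B - (1 / 2) ^ d * B)"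
    by (simp add: algebra_simps)
  also have "\<dots> \<le> exp (- m * x) * (B - (\<integral>y. ?w y * (t y / 4) ^ d \<partial>std_normal_distribution))"
    using Et by (intro mult_left_mono) auto
  also have "\<dots> = (\<integral>y. exp (- m * x) * (?w y - ?w y * (t y / 4) ^ d) \<partial>std_normal_distribution)"
    unfolding B_def using int int_t by simp
  also have "\<dots> \<le> Z"
    unfolding Z_def G_def[symmetric]
  proof (intro integral_mono int_lo int_Z)
    fix y
    show "exp (- m * x) * (?w y - ?w y * (t y / 4) ^ d) \<le> ?w y * (G y / L) powr m"
    proof -
      have "w * (a * (1 - u)) = a * (w - w * u)" for w a u :: real
        by (simp add: algebra_simps)
      then show ?thesis using mult_left_mono[OF lower[of y] w0[of y]] by metis
    qed
  qed
  finally show "B * ((1 - (1 / 2) ^ d) * exp (- m * ((ln L / 2 + 68) / L))) \<le> Z"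
    by (simp add: x_def)
qed

section \<open>Normal vectors by cofactors\<close>

lemma sum_fun_apply: "(\<Sum>i\<in>A. f i) x = (\<Sum>i\<in>A. f i x :: real)"
  by (induction A rule: infinite_finite_induct) auto

text \<open>
  The dimension has to be a term here, as it is quantified in the theorem, so the matrix is one with
  explicit dimensions. Only the entries \<open>W i k\<close> with \<open>i, k < d\<close> matter.
\<close>
definition det_rows :: "nat \<Rightarrow> (nat \<Rightarrow> nat \<Rightarrow> real) \<Rightarrow> real" where
  "det_rows d W = Determinant.det (mat d d (\<lambda>(i, k). W i k))"

definition row_cofactor :: "nat \<Rightarrow> nat \<Rightarrow> (nat \<Rightarrow> nat \<Rightarrow> real) \<Rightarrow> nat \<Rightarrow> real" where
  "row_cofactor d r W j = cofactor (mat d d (\<lambda>(i, k). W i k)) r j"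

lemma row_cofactor_cong:
  assumes "\<And>i k. i < d \<Longrightarrow> i \<noteq> r \<Longrightarrow> k < d \<Longrightarrow> W i k = W' i k"
  shows "row_cofactor d r W j = row_cofactor d r W' j"
proof -
  have "mat_delete (mat d d (\<lambda>(i, k). W i k)) r j = mat_delete (mat d d (\<lambda>(i, k). W' i k)) r j"
    unfolding mat_delete_def using assms by (intro cong_mat) auto
  then show ?thesis by (simp add: row_cofactor_def cofactor_def)
qed

lemma det_rows_cong:
  assumes "\<And>i k. i < d \<Longrightarrow> k < d \<Longrightarrow> W i k = W' i k"
  shows "det_rows d W = det_rows d W'"
  unfolding det_rows_def by (intro arg_cong[where f = Determinant.det] cong_mat) (use assms in auto)

lemma det_rows_expand:
  assumes "r < d"
  shows "det_rows d (W(r := v)) = (\<Sum>j<d. v j * row_cofactor d r W j)"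
proof -
  have "det_rows d (W(r := v)) = (\<Sum>j<d. v j * row_cofactor d r (W(r := v)) j)"
    unfolding det_rows_def row_cofactor_def using assms
    by (subst laplace_expansion_row[of _ d r]) auto
  also have "\<dots> = (\<Sum>j<d. v j * row_cofactor d r W j)"
    by (intro sum.cong arg_cong2[where f = "(*)"] row_cofactor_cong) auto
  finally show ?thesis .
qed

lemma det_rows_identical:
  assumes "r < d" "s < d" "r \<noteq> s" "\<And>k. k < d \<Longrightarrow> W r k = W s k"
  shows "det_rows d W = 0"
  unfolding det_rows_def using assms
  by (intro det_identical_rows[of _ d r s]) (auto intro!: eq_vecI)

text \<open>
  Singularity as a linear dependence between the rows: the kernel of the transpose.
\<close>
lemma det_rows_eq_0_iff:
  "det_rows d W = 0 \<longleftrightarrow> (\<exists>c. (\<exists>i<d. c i \<noteq> 0) \<and> (\<forall>k<d. (\<Sum>i<d. c i * W i k) = 0))"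
proof -
  let ?A = "mat d d (\<lambda>(i, k). W i k)"
  have A: "?A \<in> carrier_mat d d" "transpose_mat ?A \<in> carrier_mat d d" by simp_all
  have "det_rows d W = Determinant.det (transpose_mat ?A)"
    by (simp add: det_rows_def det_transpose[OF A(1)])
  also have "\<dots> = 0 \<longleftrightarrow> (\<exists>v. v \<in> carrier_vec d \<and> v \<noteq> 0\<^sub>v d \<and> transpose_mat ?A *\<^sub>v v = 0\<^sub>v d)"
    by (rule det_0_iff_vec_prod_zero[OF A(2)])
  also have "\<dots> \<longleftrightarrow> (\<exists>c. (\<exists>i<d. c i \<noteq> 0) \<and> (\<forall>k<d. (\<Sum>i<d. c i * W i k) = 0))"
  proof safe
    fix v :: "real vec" assume v: "v \<in> carrier_vec d" "v \<noteq> 0\<^sub>v d" "transpose_mat ?A *\<^sub>v v = 0\<^sub>v d"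
    have "\<exists>i<d. vec_index v i \<noteq> 0" using v(1,2) by (metis carrier_vecD eq_vecI index_zero_vec)
    moreover have "(\<Sum>i<d. vec_index v i * W i k) = 0" if "k < d" for k
    proof -
      have "0 = vec_index (transpose_mat ?A *\<^sub>v v) k" using v(3) that by simp
      also have "\<dots> = (\<Sum>i<d. vec_index v i * W i k)"
        using that v(1) by (simp add: scalar_prod_def lessThan_atLeast0 mult.commute)
      finally show ?thesis by simp
    qed
    ultimately show "\<exists>c. (\<exists>i<d. c i \<noteq> 0) \<and> (\<forall>k<d. (\<Sum>i<d. c i * W i k) = 0)" by blast
  next
    fix c i assume c: "\<forall>k<d. (\<Sum>i<d. c i * W i k) = 0" and i: "i < d" "c i \<noteq> 0"
    have "vec d c \<noteq> 0\<^sub>v d" using i by (metis index_vec index_zero_vec(1))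
    moreover have "transpose_mat ?A *\<^sub>v vec d c = 0\<^sub>v d"
      using c by (intro eq_vecI) (auto simp: scalar_prod_def lessThan_atLeast0 mult.commute)
    ultimately show "\<exists>v. v \<in> carrier_vec d \<and> v \<noteq> 0\<^sub>v d \<and> transpose_mat ?A *\<^sub>v v = 0\<^sub>v d"
      by (intro exI[of _ "vec d c"]) auto
  qed
  finally show ?thesis .
qed

definition coord_dot :: "nat \<Rightarrow> (nat \<Rightarrow> real) \<Rightarrow> (nat \<Rightarrow> real) \<Rightarrow> real" where
  "coord_dot d u v = (\<Sum>k<d. u k * v k)"

text \<open>
  The generalised cross product of the \<open>d - 1\<close> vectors \<open>w 0, \<dots>, w (d - 2)\<close> in dimension \<open>d\<close>; row
  \<open>d - 1\<close> of \<open>w\<close> has no influence on it.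
\<close>
abbreviation cross_normal :: "nat \<Rightarrow> (nat \<Rightarrow> nat \<Rightarrow> real) \<Rightarrow> nat \<Rightarrow> real" where
  "cross_normal d w \<equiv> row_cofactor d (d - 1) w"

lemma coord_dot_cross_normal:
  assumes "1 \<le> d"
  shows "coord_dot d (cross_normal d w) v = det_rows d (w(d - 1 := v))"
  using assms by (simp add: det_rows_expand coord_dot_def mult.commute)

text \<open>
  A determinant with two equal rows vanishes.
\<close>
lemma coord_dot_cross_normal_row:
  assumes "i < d - 1"
  shows "coord_dot d (cross_normal d w) (w i) = 0"
  using assms by (subst coord_dot_cross_normal) (auto intro!: det_rows_identical[of i d "d - 1"])

lemma sum_replace_last_row:
  fixes c :: "nat \<Rightarrow> real"
  assumes "1 \<le> d"
  shows "(\<Sum>i<d. c i * (w(d - 1 := v)) i k) = (\<Sum>i<d - 1. c i * w i k) + c (d - 1) * v k"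
proof -
  have "{..<d} = insert (d - 1) {..<d - 1}" using assms by auto
  then show ?thesis by simp
qed

text \<open>
  A dependence between the rows must involve the last one and can be solved for it.
\<close>
lemma combination_of_independent_rows:
  assumes d: "1 \<le> d" and det: "det_rows d (w(d - 1 := v)) = 0"
    and ind: "\<And>c. (\<And>k. k < d \<Longrightarrow> (\<Sum>i<d - 1. c i * w i k) = 0) \<Longrightarrow> (\<forall>i<d - 1. c i = 0)"
  shows "\<exists>a. \<forall>k<d. v k = (\<Sum>i<d - 1. a i * w i k)"
proof -
  obtain c where c: "\<exists>i<d. c i \<noteq> 0" and s: "\<And>k. k < d \<Longrightarrow> (\<Sum>i<d - 1. c i * w i k) + c (d - 1) * v k = 0"
    using det unfolding det_rows_eq_0_iff sum_replace_last_row[OF d] by blast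
  have c0: "c (d - 1) \<noteq> 0"
  proof
    assume 0: "c (d - 1) = 0"
    then have "\<forall>i<d - 1. c i = 0" using s by (intro ind) simp
    with c 0 show False by (metis Suc_diff_1 d less_Suc_eq less_numeral_extra(1) order_less_le_trans zero_less_one)
  qed
  have "v k = (\<Sum>i<d - 1. - c i / c (d - 1) * w i k)" if "k < d" for k
  proof -
    have "c (d - 1) * v k = - (\<Sum>i<d - 1. c i * w i k)" using s[OF that] by simp
    then have "v k = - (\<Sum>i<d - 1. c i * w i k) / c (d - 1)" using c0 by (simp add: field_simps)
    then show ?thesis by (simp add: sum_divide_distrib sum_negf)
  qed
  then show ?thesis by (intro exI[of _ "\<lambda>i. - c i / c (d - 1)"]) auto
qed

lemma cross_normal_nonzero_imp_independent:
  assumes d: "1 \<le> d" and N: "\<exists>k<d. cross_normal d w k \<noteq> 0"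
    and c: "\<And>k. k < d \<Longrightarrow> (\<Sum>i<d - 1. c i * w i k) = 0"
  shows "\<forall>i<d - 1. c i = 0"
proof (rule ccontr)
  assume "\<not> ?thesis"
  then obtain i where i: "i < d - 1" "c i \<noteq> 0" by blast
  obtain k where k: "k < d" "cross_normal d w k \<noteq> 0" using N by blast
  let ?u = "\<lambda>j. if j = k then 1 else 0 :: real"
  let ?c = "c(d - 1 := 0)"
  have "det_rows d (w(d - 1 := ?u)) = 0"
    unfolding det_rows_eq_0_iff sum_replace_last_row[OF d]
  proof (intro exI[of _ ?c] conjI allI impI)
    show "\<exists>i<d. ?c i \<noteq> 0" using i by (intro exI[of _ i]) auto
    fix k assume "k < d"
    have "(\<Sum>i<d - 1. ?c i * w i k) = (\<Sum>i<d - 1. c i * w i k)" by (intro sum.cong) auto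
    then show "(\<Sum>i<d - 1. ?c i * w i k) + ?c (d - 1) * ?u k = 0" for u
      using c[OF \<open>k < d\<close>] by simp
  qed
  then have "coord_dot d (cross_normal d w) ?u = 0" using coord_dot_cross_normal[OF d] by simp
  then show False using k by (simp add: coord_dot_def if_distrib cong: if_cong)
qed

lemma cross_normal_orthogonal_imp_combination:
  assumes d: "1 \<le> d" and N: "\<exists>k<d. cross_normal d w k \<noteq> 0" and v: "coord_dot d (cross_normal d w) v = 0"
  shows "\<exists>a. \<forall>k<d. v k = (\<Sum>i<d - 1. a i * w i k)"
proof (rule combination_of_independent_rows[OF d])
  show "det_rows d (w(d - 1 := v)) = 0" using v coord_dot_cross_normal[OF d] by metis
qed (rule cross_normal_nonzero_imp_independent[OF d N])

text \<open>
  Were all cofactors zero, every unit vector would be a combination of the \<open>d - 1\<close> given vectors,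
  against the invariance of dimension.
\<close>
lemma cross_normal_nonzero_if_independent:
  assumes d: "1 \<le> d"
    and ind: "\<And>c. (\<And>k. k < d \<Longrightarrow> (\<Sum>i<d - 1. c i * w i k) = 0) \<Longrightarrow> (\<forall>i<d - 1. c i = 0)"
  shows "\<exists>k<d. cross_normal d w k \<noteq> 0"
proof (rule ccontr)
  assume "\<not> ?thesis"
  then have N: "cross_normal d w k = 0" if "k < d" for k using that by blast
  define e :: "nat \<Rightarrow> nat \<Rightarrow> real" where "e k = (\<lambda>j. if j = k then 1 else 0)" for k
  define u where "u i = (\<lambda>k. if k < d then w i k else 0)" for i
  have mem: "e k \<in> span (u ` {..<d - 1})" if k: "k < d" for k
  proof -
    have "coord_dot d (cross_normal d w) (e k) = 0" using N by (simp add: coord_dot_def)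
    then have "det_rows d (w(d - 1 := e k)) = 0" unfolding coord_dot_cross_normal[OF d] .
    then obtain a where a: "\<And>j. j < d \<Longrightarrow> e k j = (\<Sum>i<d - 1. a i * w i j)"
      using combination_of_independent_rows[OF d _ ind] by blast
    have "e k = (\<Sum>i<d - 1. a i *\<^sub>R u i)"
    proof
      fix j
      show "e k j = (\<Sum>i<d - 1. a i *\<^sub>R u i) j"
        using a[of j] k by (cases "j < d") (auto simp: sum_fun_apply u_def e_def)
    qed
    also have "\<dots> \<in> span (u ` {..<d - 1})"
      by (intro span_sum span_scale span_base) auto
    finally show ?thesis .
  qed
  have inj: "inj_on e {..<d}" by (rule inj_onI) (metis e_def zero_neq_one)
  have "independent (e ` {..<d})"
  proof (rule independent_if_scalars_zero)
    fix f x assume f: "(\<Sum>x\<in>e ` {..<d}. f x *\<^sub>R x) = 0" and x: "x \<in> e ` {..<d}"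
    then obtain k where k: "k < d" "x = e k" by auto
    have "0 = (\<Sum>x\<in>e ` {..<d}. f x *\<^sub>R x) k" using f by simp
    also have "\<dots> = (\<Sum>i<d. f (e i) * e i k)" by (simp add: sum.reindex[OF inj] sum_fun_apply)
    also have "\<dots> = f (e k)" using k by (simp add: e_def if_distrib cong: if_cong)
    finally show "f x = 0" using k by simp
  qed simp
  then have "card (e ` {..<d}) \<le> card (u ` {..<d - 1})"
    using independent_span_bound[of "u ` {..<d - 1}" "e ` {..<d}"] mem by auto
  also have "\<dots> \<le> d - 1" using card_image_le[of "{..<d - 1}" u] by simp
  finally show False using d by (simp add: card_image[OF inj])
qed

section \<open>Faces of convex hulls of finite sets\<close>

text \<open>
  Two affinely independent sets with the same hull have the same size: translated to the origin
  they become bases of one linear span. So the choice operator in the definition of the affine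
  dimension has exactly one candidate.
\<close>
lemma affine_dim_eqI:
  fixes V :: "'a::real_vector set"
  assumes "finite B" "\<not> affine_dependent B" "affine hull B = affine hull V"
  shows "affine_dim V = int (card B) - 1"
proof -
  have card_le: "card B \<le> card C" if BC: "affine hull B = affine hull C" "finite B" "finite C"
    "\<not> affine_dependent B" "\<not> affine_dependent C" for B C :: "'a set"
  proof (cases "B = {}")
    case False
    then obtain b where b: "b \<in> B" by blast
    then have "C \<noteq> {}" using BC(1) by (metis affine_hull_eq_empty empty_iff)
    then obtain c where c: "c \<in> C" by blast
    let ?B = "(\<lambda>x. - b + x) ` (B - {b})" and ?C = "(\<lambda>x. - c + x) ` (C - {c})"
    have "x \<in> span ?C" if "x \<in> ?B" for x
    proof -
      obtain y where y: "y \<in> B" "x = - b + y" using \<open>x \<in> ?B\<close> by auto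
      have "y \<in> affine hull C" "b \<in> affine hull C"
        using y(1) b BC(1) by (metis hull_inc)+
      then obtain s t where "s \<in> span ?C" "y = c + s" "t \<in> span ?C" "b = c + t"
        unfolding affine_hull_span2[OF c] by blast
      then have "x = s - t" using y by simp
      then show ?thesis using \<open>s \<in> span ?C\<close> \<open>t \<in> span ?C\<close> by (simp add: span_diff)
    qed
    moreover have "independent ?B" using BC(4) affine_dependent_iff_dependent2[OF b] by simp
    ultimately have "card ?B \<le> card ?C"
      using independent_span_bound[of ?C ?B] BC(3) by auto
    moreover have "card ?B = card B - 1" "card ?C = card C - 1"
      using b c BC(2,3) by (auto simp: card_image)
    ultimately show ?thesis using b c BC(2,3) by (metis card_gt_0_iff diff_le_mono2 empty_iff le_diff_iff Suc_leI One_nat_def)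
  qed simp
  show ?thesis
    unfolding affine_dim_def
  proof (rule some_equality)
    show "\<exists>B'. affine hull B' = affine hull V \<and> \<not> affine_dependent B' \<and> finite B' \<and>
        int (card B') = int (card B) - 1 + 1"
      using assms by auto
    fix k assume "\<exists>B'. affine hull B' = affine hull V \<and> \<not> affine_dependent B' \<and> finite B' \<and> int (card B') = k + 1"
    then obtain B' where "affine hull B' = affine hull V" "\<not> affine_dependent B'" "finite B'" "int (card B') = k + 1"
      by blast
    moreover from this card_le[of B B'] card_le[of B' B] assms have "card B = card B'" by auto
    ultimately show "k = int (card B) - 1" by simp
  qed
qed

lemma affine_dim_basis:
  fixes P :: "'a::real_vector set"
  assumes "finite P"
  obtains B where "B \<subseteq> P" "\<not> affine_dependent B" "affine hull B = affine hull P" "affine_dim (convex hull P) = int (card B) - 1"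
proof -
  obtain B where "B \<subseteq> P" "\<not> affine_dependent B" "affine hull P = affine hull B"
    using affine_basis_exists by blast
  moreover have "affine_dim (convex hull P) = int (card B) - 1"
    using calculation finite_subset[OF _ assms] by (intro affine_dim_eqI) auto
  ultimately show thesis using that by metis
qed

text \<open>
  A point of positive weight in a convex combination \<open>p\<close> from the face lies in the face, because \<open>p\<close>
  is on the open segment between that point and the normalised sum of the others.
\<close>
lemma face_of_finite_convex_hull:
  fixes P :: "'a::real_vector set"
  assumes P: "finite P" and F: "F face_of convex hull P"
  shows "F = convex hull (F \<inter> P)"
proof
  show "convex hull (F \<inter> P) \<subseteq> F"
    using face_of_imp_convex[OF F] by (intro hull_minimal) auto
  show "F \<subseteq> convex hull (F \<inter> P)"
  proof
    fix p assume p: "p \<in> F"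
    then have "p \<in> convex hull P" using face_of_imp_subset[OF F] by blast
    then obtain u where u: "\<forall>x\<in>P. 0 \<le> u x" "sum u P = 1" "(\<Sum>x\<in>P. u x *\<^sub>R x) = p"
      unfolding convex_hull_finite[OF P] by blast
    have inF: "v \<in> F" if v: "v \<in> P" "0 < u v" for v
    proof (cases "u v = 1")
      case True
      have "sum u (P - {v}) = 0" using u(2) True sum.remove[OF P v(1), of u] by simp
      then have "\<forall>x\<in>P - {v}. u x = 0" using u(1) P by (subst (asm) sum_nonneg_eq_0_iff) auto
      then have "p = v" using u(3) True sum.remove[OF P v(1), of "\<lambda>x. u x *\<^sub>R x"] by simp
      then show ?thesis using p by simp
    next
      case False
      have rest: "sum u (P - {v}) = 1 - u v" using u(2) sum.remove[OF P v(1), of u] by simp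
      moreover have "0 \<le> sum u (P - {v})" using u(1) by (intro sum_nonneg) auto
      ultimately have lt: "u v < 1" using False by simp
      define q where "q = (\<Sum>x\<in>P - {v}. (u x / (1 - u v)) *\<^sub>R x)"
      have "q \<in> convex hull P"
        unfolding q_def using P u(1) lt rest
        by (intro convex_sum convex_convex_hull) (auto simp: hull_inc simp flip: sum_divide_distrib)
      moreover have pq: "p = (1 - u v) *\<^sub>R q + u v *\<^sub>R v"
        using u(3) sum.remove[OF P v(1), of "\<lambda>x. u x *\<^sub>R x"] lt
        by (simp add: q_def scaleR_sum_right add.commute)
      ultimately show ?thesis
      proof (cases "q = v")
        case True
        then have "p = v" using pq by (simp flip: scaleR_left.add)
        then show ?thesis using p by simp
      next
        case False
        then have "p \<in> open_segment q v"
          using pq v lt by (auto simp: in_segment)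
        then show ?thesis
          using face_ofD[OF F _ \<open>q \<in> convex hull P\<close> hull_inc[OF v(1)] p] by blast
      qed
    qed
    have "x \<in> F \<or> u x = 0" if "x \<in> P" for x using inF[of x] u(1) that by (auto simp: order_less_le)
    then have "(\<Sum>x\<in>F \<inter> P. u x *\<^sub>R x) = p" "sum u (F \<inter> P) = 1"
      unfolding u(3)[symmetric] u(2)[symmetric] using P by (intro sum.mono_neutral_left; force)+
    then show "p \<in> convex hull (F \<inter> P)"
      using u(1) P convex_sum[OF _ convex_convex_hull, of "F \<inter> P" u "\<lambda>x. x" "F \<inter> P"] by (auto simp: hull_inc)
  qed
qed

lemma supporting_face_of_convex_hull:
  fixes P :: "'a::real_vector set"
  assumes P: "finite P" and l: "linear l" and le: "\<And>x. x \<in> P \<Longrightarrow> l x \<le> (c::real)"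
  shows "convex hull {x \<in> P. l x = c} face_of convex hull P"
proof -
  have half: "convex hull P \<subseteq> {x. l x \<le> c}"
  proof (rule hull_minimal)
    have "{x. l x \<le> c} = l -` {..c}" by auto
    then show "convex {x. l x \<le> c}" using convex_linear_vimage[OF l, of "{..c}"] by simp
  qed (use le in auto)
  have "convex hull P \<inter> {x. l x = c} face_of convex hull P"
    unfolding face_of_def
  proof (intro conjI ballI impI)
    have "{x. l x = c} = l -` {c}" by auto
    then show "convex (convex hull P \<inter> {x. l x = c})"
      using convex_linear_vimage[OF l, of "{c}"] by (simp add: convex_Int)
    fix a b x assume ab: "a \<in> convex hull P" "b \<in> convex hull P" and x: "x \<in> convex hull P \<inter> {x. l x = c}"
      and "x \<in> open_segment a b"
    then obtain t where t: "0 < t" "t < 1" "x = (1 - t) *\<^sub>R a + t *\<^sub>R b" by (auto simp: in_segment)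
    have "(1 - t) * l a + t * l b = c" using x t(3) by (simp add: linear_add[OF l] linear_scale[OF l])
    have "l a \<le> c" "l b \<le> c" using ab half by auto
    then have "0 \<le> (1 - t) * (c - l a)" "0 \<le> t * (c - l b)"
      using t by auto
    moreover have "(1 - t) * (c - l a) + t * (c - l b) = c - ((1 - t) * l a + t * l b)"
      by (simp add: algebra_simps)
    ultimately have "(1 - t) * (c - l a) = 0" "t * (c - l b) = 0"
      using \<open>(1 - t) * l a + t * l b = c\<close> by linarith+
    then show "a \<in> convex hull P \<inter> {x. l x = c}" "b \<in> convex hull P \<inter> {x. l x = c}"
      using ab t by auto
  qed auto
  moreover from face_of_finite_convex_hull[OF P this]
  have "convex hull P \<inter> {x. l x = c} = convex hull {x \<in> P. l x = c}"
    by (simp add: Int_def conj_commute hull_inc cong: conj_cong)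
  ultimately show ?thesis by simp
qed

section \<open>Facets and index sets\<close>

text \<open>
  The increasing enumeration of \<open>T\<close> by \<open>{..<card T}\<close>; \<open>vertex T 0\<close> serves as base point of the
  affine hull of the points indexed by \<open>T\<close>.
\<close>
definition vertex :: "nat set \<Rightarrow> nat \<Rightarrow> nat" where
  "vertex T i = sorted_list_of_set T ! i"

definition edge_vectors :: "nat set \<Rightarrow> (nat \<Rightarrow> nat \<Rightarrow> real) \<Rightarrow> nat \<Rightarrow> nat \<Rightarrow> real" where
  "edge_vectors T X i = (\<lambda>k. X (vertex T (Suc i)) k - X (vertex T 0) k)"

definition facet_normal :: "nat \<Rightarrow> nat set \<Rightarrow> (nat \<Rightarrow> nat \<Rightarrow> real) \<Rightarrow> nat \<Rightarrow> real" where
  "facet_normal d T X = cross_normal d (edge_vectors T X)"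

text \<open>
  The signed distance of \<open>y\<close> from the hyperplane through the points indexed by \<open>T\<close>, up to the length
  of the normal vector.
\<close>
definition facet_height :: "nat \<Rightarrow> nat set \<Rightarrow> (nat \<Rightarrow> nat \<Rightarrow> real) \<Rightarrow> (nat \<Rightarrow> real) \<Rightarrow> real" where
  "facet_height d T X y = coord_dot d (facet_normal d T X) (\<lambda>k. y k - X (vertex T 0) k)"

text \<open>
  Affine independence of the \<open>d\<close> points indexed by \<open>T\<close>, as a condition on finitely many polynomials
  in their coordinates.
\<close>
definition nondegenerate :: "nat \<Rightarrow> nat set \<Rightarrow> (nat \<Rightarrow> nat \<Rightarrow> real) \<Rightarrow> bool" where
  "nondegenerate d T X \<longleftrightarrow> (\<exists>k<d. facet_normal d T X k \<noteq> 0)"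

lemma facet_height_eq:
  "facet_height d T X y = coord_dot d (facet_normal d T X) y - coord_dot d (facet_normal d T X) (X (vertex T 0))"
  by (simp add: facet_height_def coord_dot_def algebra_simps sum_subtractf)

lemma bij_betw_vertex:
  assumes "finite T" "card T = d"
  shows "bij_betw (vertex T) {..<d} T"
  unfolding vertex_def using assms
  by (intro bij_betw_nth) auto

lemma sum_vertex:
  assumes "finite T" "card T = d" "1 \<le> d"
  shows "(\<Sum>t\<in>T. f t) = f (vertex T 0) + (\<Sum>i<d - 1. f (vertex T (Suc i)) :: real)"
proof -
  have "(\<Sum>t\<in>T. f t) = (\<Sum>i<Suc (d - 1). f (vertex T i))"
    using sum.reindex_bij_betw[OF bij_betw_vertex[OF assms(1,2)], of f] assms(3) by simp
  then show ?thesis by (simp only: sum.lessThan_Suc_shift)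
qed

text \<open>
  Families indexed by \<open>T\<close> are given by their value at the base point and at the other vertices.
\<close>
lemma vertex_coefficients:
  assumes "finite T" "card T = d" "1 \<le> d"
  obtains c where "c (vertex T 0) = (a :: real)" "\<And>i. i < d - 1 \<Longrightarrow> c (vertex T (Suc i)) = b i"
proof
  note inj = bij_betw_imp_inj_on[OF bij_betw_vertex[OF assms(1,2)]]
  let ?c = "\<lambda>t. case inv_into {..<d} (vertex T) t of 0 \<Rightarrow> a | Suc i \<Rightarrow> b i"
  show "?c (vertex T 0) = a" using inv_into_f_f[OF inj, of 0] assms(3) by simp
  show "?c (vertex T (Suc i)) = b i" if "i < d - 1" for i using inv_into_f_f[OF inj, of "Suc i"] that by simp
qed

context
  fixes d :: nat and T :: "nat set" and X :: "nat \<Rightarrow> nat \<Rightarrow> real"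
  assumes d: "1 \<le> d" and T: "finite T" "card T = d"
begin

lemma vertex_in: "i < d \<Longrightarrow> vertex T i \<in> T"
  using bij_betw_vertex[OF T] by (auto simp: bij_betw_def)

lemma facet_height_vertex:
  assumes "t \<in> T"
  shows "facet_height d T X (X t) = 0"
proof -
  obtain i where i: "i < d" "t = vertex T i" using bij_betw_vertex[OF T] assms by (auto simp: bij_betw_def)
  show ?thesis
  proof (cases i)
    case 0
    then show ?thesis using i by (simp add: facet_height_def coord_dot_def)
  next
    case (Suc j)
    then show ?thesis using i coord_dot_cross_normal_row[of j d "edge_vectors T X"]
      by (simp add: facet_height_def facet_normal_def edge_vectors_def)
  qed
qed

lemma nondegenerate_independent:
  assumes "nondegenerate d T X" "sum c T = 0" "\<And>k. k < d \<Longrightarrow> (\<Sum>t\<in>T. c t * X t k) = 0" "t \<in> T"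
  shows "c t = 0"
proof -
  note sv = sum_vertex[OF T d]
  have "(\<Sum>i<d - 1. c (vertex T (Suc i)) * edge_vectors T X i k) = 0" if "k < d" for k
  proof -
    have "(\<Sum>i<d - 1. c (vertex T (Suc i)) * edge_vectors T X i k) =
       (\<Sum>i<d - 1. c (vertex T (Suc i)) * X (vertex T (Suc i)) k) - (\<Sum>i<d - 1. c (vertex T (Suc i))) * X (vertex T 0) k"
      by (simp add: edge_vectors_def algebra_simps sum_subtractf sum_distrib_left)
    moreover have "(\<Sum>i<d - 1. c (vertex T (Suc i)) * X (vertex T (Suc i)) k) = - (c (vertex T 0) * X (vertex T 0) k)"
      using assms(3)[OF that] unfolding sv by simp
    moreover have "(\<Sum>i<d - 1. c (vertex T (Suc i))) = - c (vertex T 0)"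
      using assms(2) unfolding sv by simp
    ultimately show ?thesis by simp
  qed
  then have z: "c (vertex T (Suc i)) = 0" if "i < d - 1" for i
    using cross_normal_nonzero_imp_independent[OF d, of "edge_vectors T X" "\<lambda>i. c (vertex T (Suc i))"] assms(1) that
    unfolding nondegenerate_def facet_normal_def by blast
  have z0: "c (vertex T 0) = 0" using assms(2) z unfolding sv by simp
  obtain i where i: "i < d" "t = vertex T i" using bij_betw_vertex[OF T] assms(4) by (auto simp: bij_betw_def)
  then show ?thesis using z z0 by (cases i) auto
qed

lemma nondegenerate_if_independent:
  assumes "\<And>c. sum c T = 0 \<Longrightarrow> (\<And>k. k < d \<Longrightarrow> (\<Sum>t\<in>T. c t * X t k) = 0) \<Longrightarrow> (\<forall>t\<in>T. c t = 0)"
  shows "nondegenerate d T X"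
  unfolding nondegenerate_def facet_normal_def
proof (rule cross_normal_nonzero_if_independent[OF d], intro allI impI)
  fix a i assume a: "\<And>k. k < d \<Longrightarrow> (\<Sum>i<d - 1. a i * edge_vectors T X i k) = 0" and i: "i < d - 1"
  obtain c where c: "c (vertex T 0) = - (\<Sum>i<d - 1. a i)" "\<And>i. i < d - 1 \<Longrightarrow> c (vertex T (Suc i)) = a i"
    using vertex_coefficients[OF T d] by blast
  have "\<forall>t\<in>T. c t = 0"
  proof (rule assms)
    show "sum c T = 0" unfolding sum_vertex[OF T d] using c by simp
    fix k assume "k < d"
    have "(\<Sum>t\<in>T. c t * X t k) = (\<Sum>i<d - 1. a i * edge_vectors T X i k)"
      unfolding sum_vertex[OF T d] using c
      by (simp add: edge_vectors_def algebra_simps sum_subtractf sum_distrib_left)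
    then show "(\<Sum>t\<in>T. c t * X t k) = 0" using a[OF \<open>k < d\<close>] by simp
  qed
  then show "a i = 0" using c(2)[OF i] vertex_in[of "Suc i"] i by auto
qed

lemma facet_height_zero_imp_affine_combination:
  assumes "nondegenerate d T X" "facet_height d T X y = 0"
  obtains a where "sum a T = 1" "\<And>k. k < d \<Longrightarrow> y k = (\<Sum>t\<in>T. a t * X t k)"
proof -
  obtain b where b: "\<And>k. k < d \<Longrightarrow> y k - X (vertex T 0) k = (\<Sum>i<d - 1. b i * edge_vectors T X i k)"
    using cross_normal_orthogonal_imp_combination[OF d] assms
    unfolding nondegenerate_def facet_height_def facet_normal_def by blast
  obtain c where c: "c (vertex T 0) = 1 - (\<Sum>i<d - 1. b i)" "\<And>i. i < d - 1 \<Longrightarrow> c (vertex T (Suc i)) = b i"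
    using vertex_coefficients[OF T d] by blast
  have "y k = (\<Sum>t\<in>T. c t * X t k)" if "k < d" for k
  proof -
    have "c (vertex T 0) * x + (\<Sum>i<d - 1. b i * x) = x" for x
      unfolding c(1) sum_distrib_right[symmetric] by (simp add: algebra_simps)
    from this[of "X (vertex T 0) k"]
    have "(\<Sum>t\<in>T. c t * X t k) = X (vertex T 0) k + (\<Sum>i<d - 1. b i * edge_vectors T X i k)"
      unfolding sum_vertex[OF T d] using c(2)
      by (simp add: edge_vectors_def algebra_simps sum_subtractf)
    then show ?thesis using b[OF that] by simp
  qed
  moreover have "sum c T = 1" unfolding sum_vertex[OF T d] using c by simp
  ultimately show thesis using that by blast
qed

end

text \<open>
  \<open>S\<close> lists all the points on a facet. The set \<open>T\<close> picks \<open>d\<close> affinely independent ones among them,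
  whose hyperplane supports the polytope. This describes the facets of every configuration, also of
  those where more than \<open>d\<close> points lie on a facet or points coincide, and only measurable
  conditions occur in it. Both are needed: the expectation is an integral of a function that must be
  measurable everywhere, not just almost surely equal to a measurable one.
\<close>
definition facet_index_set :: "nat \<Rightarrow> nat \<Rightarrow> (nat \<Rightarrow> nat \<Rightarrow> real) \<Rightarrow> nat set \<Rightarrow> bool" where
  "facet_index_set d n X S \<longleftrightarrow> (\<exists>T\<subseteq>S. card T = d \<and> nondegenerate d T X \<and>
     ((\<forall>j<n. 0 \<le> facet_height d T X (X j)) \<or> (\<forall>j<n. facet_height d T X (X j) \<le> 0)) \<and>
     S = {j. j < n \<and> facet_height d T X (X j) = 0})"

lemma facet_height_affine:
  obtains l c where "linear l" "\<And>y. facet_height d T X y = l y - c"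
proof
  show "linear (coord_dot d (facet_normal d T X))"
    by (rule linearI) (simp_all add: coord_dot_def algebra_simps sum.distrib sum_distrib_left)
  show "facet_height d T X y = coord_dot d (facet_normal d T X) y - coord_dot d (facet_normal d T X) (X (vertex T 0))" for y
    by (rule facet_height_eq)
qed

context
  fixes d n :: nat and X :: "nat \<Rightarrow> nat \<Rightarrow> real"
  assumes d: "1 \<le> d" and supp: "\<And>i k. d \<le> k \<Longrightarrow> X i k = 0"
begin

lemma affine_combination_coord:
  assumes "finite T" "\<And>k. d \<le> k \<Longrightarrow> y k = 0" "\<And>k. k < d \<Longrightarrow> y k = (\<Sum>t\<in>T. a t * X t k)"
  shows "y = (\<Sum>t\<in>T. a t *\<^sub>R X t)"
proof
  fix k show "y k = (\<Sum>t\<in>T. a t *\<^sub>R X t) k"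
    using assms(2,3)[of k] supp by (cases "k < d") (auto simp: sum_fun_apply)
qed

lemma nondegenerate_affine_independent:
  assumes T: "finite T" "card T = d" and nd: "nondegenerate d T X"
  shows "inj_on X T" "\<not> affine_dependent (X ` T)"
proof -
  note ind = nondegenerate_independent[OF d T nd]
  show inj: "inj_on X T"
  proof (rule inj_onI, rule ccontr)
    fix s t assume st: "s \<in> T" "t \<in> T" "X s = X t" "s \<noteq> t"
    let ?c = "\<lambda>r. (if r = s then 1 else 0) - (if r = t then 1 else 0) :: real"
    have delta: "(\<Sum>r\<in>T. ?c r * f r) = f s - f t" for f :: "nat \<Rightarrow> real"
    proof -
      have "(\<Sum>r\<in>T. ?c r * f r) = (\<Sum>r\<in>T. (if r = s then f r else 0) - (if r = t then f r else 0))"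
        by (intro sum.cong) auto
      then show ?thesis using st T by (simp only: sum_subtractf sum.delta if_True)
    qed
    have "?c s = 0"
      by (rule ind) (use st(1,3) delta[of "\<lambda>_. 1"] delta[of "\<lambda>r. X r k" for k] in simp_all)
    then show False using st by simp
  qed
  show "\<not> affine_dependent (X ` T)"
  proof
    assume "affine_dependent (X ` T)"
    then obtain U where U: "sum U (X ` T) = 0" "\<exists>v\<in>X ` T. U v \<noteq> 0" "(\<Sum>v\<in>X ` T. U v *\<^sub>R v) = 0"
      using T by (subst (asm) affine_dependent_explicit_finite) auto
    then obtain t where t: "t \<in> T" "U (X t) \<noteq> 0" by blast
    have "U (X t) = 0"
    proof (rule ind[where c = "\<lambda>t. U (X t)"])
      show "(\<Sum>t\<in>T. U (X t)) = 0" using U(1) by (simp add: sum.reindex[OF inj])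
      have "(\<Sum>t\<in>T. U (X t) *\<^sub>R X t) = 0" using U(3) by (simp add: sum.reindex[OF inj])
      from fun_cong[OF this] show "(\<Sum>t\<in>T. U (X t) * X t k) = 0" for k by (simp add: sum_fun_apply)
    qed fact
    with t show False by simp
  qed
qed

lemma affine_independent_nondegenerate:
  assumes T: "finite T" "card T = d" and inj: "inj_on X T" and "\<not> affine_dependent (X ` T)"
  shows "nondegenerate d T X"
proof (rule nondegenerate_if_independent[OF d T])
  fix c assume c: "sum c T = 0" "\<And>k. k < d \<Longrightarrow> (\<Sum>t\<in>T. c t * X t k) = 0"
  let ?U = "\<lambda>v. c (inv_into T X v)"
  have U: "?U (X t) = c t" if "t \<in> T" for t using inj that by simp
  have "sum ?U (X ` T) = 0" using c(1) by (simp add: sum.reindex[OF inj] U)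
  moreover have "(\<Sum>v\<in>X ` T. ?U v *\<^sub>R v) = 0"
    using affine_combination_coord[OF T(1), of 0 c] c(2)
    by (simp add: sum.reindex[OF inj] U)
  ultimately show "\<forall>t\<in>T. c t = 0"
    using assms(4) T(1) U by (subst (asm) affine_dependent_explicit_finite) auto
qed

lemma facet_height_zero_affine_hull:
  assumes T: "finite T" "card T = d" and "nondegenerate d T X"
    and "facet_height d T X y = 0" and "\<And>k. d \<le> k \<Longrightarrow> y k = 0"
  obtains a where "sum a T = 1" "y = (\<Sum>t\<in>T. a t *\<^sub>R X t)" "y \<in> affine hull (X ` T)"
proof -
  obtain a where a: "sum a T = 1" "\<And>k. k < d \<Longrightarrow> y k = (\<Sum>t\<in>T. a t * X t k)"
    using facet_height_zero_imp_affine_combination[OF d T assms(3,4)] by blast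
  have y: "y = (\<Sum>t\<in>T. a t *\<^sub>R X t)" using affine_combination_coord[OF T(1) assms(5) a(2)] by simp
  have "y \<in> affine hull (X ` T)"
  proof -
    have inj: "inj_on X T" using nondegenerate_affine_independent(1)[OF T assms(3)] .
    show ?thesis unfolding affine_hull_finite[OF finite_imageI[OF T(1)]] y using a(1) inj
      by (intro CollectI exI[of _ "\<lambda>v. a (inv_into T X v)"]) (simp add: sum.reindex[OF inj])
  qed
  then show thesis using that a y by blast
qed

text \<open>
  The hyperplane of \<open>T\<close> supports the polytope, so it cuts out the face spanned by the points on it,
  and these lie in the affine hull of the \<open>d\<close> affinely independent points indexed by \<open>T\<close>.
\<close>
lemma facet_index_set_imp_facet:
  assumes S: "facet_index_set d n X S"
  defines "F \<equiv> convex hull (X ` S)"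
  shows "F face_of convex hull (X ` {..<n})" "affine_dim F = int (d - 1)" "S = {i. i < n \<and> X i \<in> F}"
proof -
  obtain T where T: "T \<subseteq> S" "card T = d" "nondegenerate d T X"
    and side: "(\<forall>j<n. 0 \<le> facet_height d T X (X j)) \<or> (\<forall>j<n. facet_height d T X (X j) \<le> 0)"
    and S_eq: "S = {j. j < n \<and> facet_height d T X (X j) = 0}"
    using S unfolding facet_index_set_def by blast
  have fin: "finite S" "finite T" using S_eq T(1) by (auto intro: finite_subset)
  obtain l c where l: "linear l" and lc: "\<And>y. facet_height d T X y = l y - c"
    using facet_height_affine by blast
  have F_eq: "F = convex hull {x \<in> X ` {..<n}. l x = c}"
    unfolding F_def S_eq lc by (rule arg_cong[where f = "(hull) convex"]) auto
  show "F face_of convex hull (X ` {..<n})"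
    using side
  proof
    assume "\<forall>j<n. facet_height d T X (X j) \<le> 0"
    then show ?thesis unfolding F_eq by (intro supporting_face_of_convex_hull l) (auto simp: lc)
  next
    assume "\<forall>j<n. 0 \<le> facet_height d T X (X j)"
    then have "convex hull {x \<in> X ` {..<n}. - l x = - c} face_of convex hull (X ` {..<n})"
      by (intro supporting_face_of_convex_hull linear_compose_neg l) (auto simp: lc)
    then show ?thesis by (simp add: F_eq)
  qed
  have "X ` S \<subseteq> affine hull (X ` T)"
  proof clarify
    fix j assume "j \<in> S"
    then show "X j \<in> affine hull (X ` T)"
      using facet_height_zero_affine_hull[OF fin(2) T(2,3), of "X j"] supp unfolding S_eq by blast
  qed
  then have "affine hull (X ` S) \<subseteq> affine hull (X ` T)" by (rule hull_minimal) (rule affine_affine_hull)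
  moreover have "affine hull (X ` T) \<subseteq> affine hull (X ` S)" using T(1) by (intro hull_mono) auto
  ultimately have "affine hull (X ` T) = affine hull F" unfolding F_def by auto
  then have "affine_dim F = int (card (X ` T)) - 1"
    using nondegenerate_affine_independent[OF fin(2) T(2,3)] fin(2) by (intro affine_dim_eqI) auto
  then show "affine_dim F = int (d - 1)"
    using nondegenerate_affine_independent(1)[OF fin(2) T(2,3)] d T(2) by (simp add: card_image of_nat_diff)
  have "F \<subseteq> {x. l x = c}"
  proof (unfold F_eq, rule hull_minimal)
    have "{x. l x = c} = l -` {c}" by auto
    then show "convex {x. l x = c}" using convex_linear_vimage[OF l, of "{c}"] by simp
  qed auto
  then show "S = {i. i < n \<and> X i \<in> F}"
    unfolding S_eq lc F_def by (auto simp: lc hull_inc)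
qed

text \<open>
  An affine basis of the face chosen among the points gives \<open>T\<close>. That its hyperplane supports the
  polytope follows once it is known to meet the polytope in points of the face only: a segment
  between points on opposite sides would cross it in such a point, and then its ends would
  belong to the face.
\<close>
lemma facet_imp_facet_index_set:
  assumes F: "F face_of convex hull (X ` {..<n})" and dim: "affine_dim F = int (d - 1)"
  defines "S \<equiv> {i. i < n \<and> X i \<in> F}"
  shows "facet_index_set d n X S" "F = convex hull (X ` S)"
proof -
  let ?P = "convex hull (X ` {..<n})"
  have FP: "F \<inter> X ` {..<n} = X ` S" by (auto simp: S_def)
  show F_eq: "F = convex hull (X ` S)" using face_of_finite_convex_hull[OF _ F] unfolding FP by simp
  have finS: "finite S" by (simp add: S_def)
  obtain B where B: "B \<subseteq> X ` S" "\<not> affine_dependent B" "affine hull B = affine hull (X ` S)" "affine_dim F = int (card B) - 1"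
    using affine_dim_basis[of "X ` S"] finS unfolding F_eq by blast
  have card: "card B = d" using B(4) dim d by linarith
  obtain T where T: "T \<subseteq> S" "inj_on X T" "B = X ` T" using B(1) by (meson subset_image_inj)
  have T': "finite T" "card T = d" using T finS card by (auto intro: finite_subset simp: card_image)
  have nd: "nondegenerate d T X"
    using affine_independent_nondegenerate[OF T' T(2)] B(2) T(3) by simp
  obtain l c where l: "linear l" and lc: "\<And>y. facet_height d T X y = l y - c"
    using facet_height_affine by blast
  have aff: "affine {x. l x = c}"
    by (auto simp: affine_def linear_add[OF l] linear_scale[OF l] simp flip: distrib_right)
  have hB: "affine hull B \<subseteq> {x. l x = c}"
    using facet_height_vertex[OF d T', of _ X] by (intro hull_minimal aff) (auto simp: T(3) lc)
  have hS: "facet_height d T X (X j) = 0" if "j \<in> S" for j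
  proof -
    have "X j \<in> affine hull (X ` S)" using that by (simp add: hull_inc)
    then show ?thesis using hB B(3) by (auto simp: lc)
  qed
  have coords: "y k = 0" if "y \<in> ?P" "d \<le> k" for y k
  proof -
    have "convex {y. y k = (0::real)}" by (rule convexI) auto
    then have "?P \<subseteq> {y. y k = 0}" using supp[OF that(2)] by (intro hull_minimal) auto
    then show ?thesis using that by auto
  qed
  have onF: "y \<in> F" if y: "y \<in> ?P" and h: "facet_height d T X y = 0" for y
  proof -
    obtain a where a: "sum a T = 1" "y = (\<Sum>t\<in>T. a t *\<^sub>R X t)"
      using facet_height_zero_affine_hull[OF T' nd h coords[OF y]] by blast
    have comb: "(\<Sum>t\<in>T. u t *\<^sub>R X t) \<in> F" if "\<And>t. t \<in> T \<Longrightarrow> 0 \<le> u t" "sum u T = 1" for u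
      unfolding F_eq using that T(1) T'(1) by (intro convex_sum convex_convex_hull) (auto intro: hull_inc)
    \<comment> \<open>The centroid \<open>p\<close> is in the relative interior of the simplex: the segment from \<open>y\<close> to \<open>p\<close> can be
      prolonged to a point \<open>p'\<close> of the simplex, and \<open>p\<close> in the face forces \<open>y\<close> into it. The length \<open>e\<close>
      of the prolongation is such that the weights of \<open>p'\<close> are not negative.\<close>
    define p where "p = (\<Sum>t\<in>T. (1 / real d) *\<^sub>R X t)"
    have p: "p \<in> F" unfolding p_def using T'(2) d by (intro comb) auto
    define M where "M = 1 + (\<Sum>t\<in>T. \<bar>a t\<bar>)"
    have M: "1 \<le> M" "\<bar>a t\<bar> \<le> M" if "t \<in> T" for t
      using member_le_sum[OF that, of "\<lambda>t. \<bar>a t\<bar>"] T'(1) by (auto simp: M_def sum_nonneg)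
    have M1: "1 \<le> M" by (simp add: M_def sum_nonneg)
    define e where "e = 1 / (real d * M)"
    have e: "0 < e" using M1 d by (simp add: e_def)
    define p' where "p' = (\<Sum>t\<in>T. ((1 + e) / real d - e * a t) *\<^sub>R X t)"
    have p'F: "p' \<in> F"
      unfolding p'_def
    proof (rule comb)
      fix t assume t: "t \<in> T"
      have "e * a t \<le> e * M" using M(2)[OF t] e by (intro mult_left_mono) auto
      also have "\<dots> = 1 / real d" using M1 by (simp add: e_def)
      also have "\<dots> \<le> (1 + e) / real d" using e d by (intro divide_right_mono) auto
      finally show "0 \<le> (1 + e) / real d - e * a t" by simp
    next
      have "(\<Sum>t\<in>T. (1 + e) / real d - e * a t) = (1 + e) - e"
        using a(1) T'(2) d by (simp add: sum_subtractf flip: sum_distrib_left)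
      then show "(\<Sum>t\<in>T. (1 + e) / real d - e * a t) = 1" by simp
    qed
    have p'_eq: "p' = (1 + e) *\<^sub>R p - e *\<^sub>R y"
      by (simp add: p'_def p_def a(2) scaleR_sum_right scaleR_left_diff_distrib sum_subtractf)
    show "y \<in> F"
    proof (cases "p' = y")
      case False
      define s where "s = e / (1 + e)"
      have s: "0 < s" "s < 1" "1 - s = 1 / (1 + e)" using e by (auto simp: s_def field_simps)
      have "(1 - s) *\<^sub>R p' + s *\<^sub>R y = p"
        unfolding s(3) p'_eq using e by (simp add: s_def scaleR_diff_right)
      then have "p \<in> open_segment p' y" using s(1,2) False by (auto simp: in_segment)
      then show ?thesis using face_ofD[OF F _ _ y p] face_of_imp_subset[OF F] p'F by blast
    qed (use p'F in simp)
  qed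
  have inS: "j \<in> S" if "j < n" "facet_height d T X (X j) = 0" for j
    using onF[OF hull_inc that(2)] that(1) by (simp add: S_def)
  have S_eq: "S = {j. j < n \<and> facet_height d T X (X j) = 0}"
    using inS hS by (auto simp: S_def)
  have "\<not> (i < n \<and> j < n \<and> 0 < facet_height d T X (X i) \<and> facet_height d T X (X j) < 0)" for i j
  proof
    assume ij: "i < n \<and> j < n \<and> 0 < facet_height d T X (X i) \<and> facet_height d T X (X j) < 0"
    define u where "u = facet_height d T X (X i)"
    define v where "v = - facet_height d T X (X j)"
    have uv: "0 < u" "0 < v" using ij by (auto simp: u_def v_def)
    define s where "s = u / (u + v)"
    have s: "0 < s" "s < 1" "1 - s = v / (u + v)" using uv by (auto simp: s_def field_simps)
    define y where "y = (1 - s) *\<^sub>R X i + s *\<^sub>R X j"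
    have "facet_height d T X y = (1 - s) * u - s * v"
    proof -
      have "l y = (1 - s) * l (X i) + s * l (X j)"
        by (simp only: y_def linear_add[OF l] linear_scale[OF l] real_scaleR_def)
      then show ?thesis unfolding u_def v_def lc by (simp add: algebra_simps)
    qed
    also have "\<dots> = 0" by (simp only: s(3)) (simp add: s_def)
    finally have hy: "facet_height d T X y = 0" .
    have "X i \<noteq> X j" using uv by (auto simp: u_def v_def)
    then have seg: "y \<in> open_segment (X i) (X j)" using s by (auto simp: in_segment y_def)
    have P: "X i \<in> ?P" "X j \<in> ?P" using ij by (auto intro: hull_inc)
    have "y \<in> ?P" unfolding y_def using P s by (intro convexD[OF convex_convex_hull]) auto
    then have "X i \<in> F" using face_ofD[OF F seg P] onF hy by blast
    then show False using hS[of i] ij by (auto simp: S_def)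
  qed
  then have side: "(\<forall>j<n. 0 \<le> facet_height d T X (X j)) \<or> (\<forall>j<n. facet_height d T X (X j) \<le> 0)"
    by (meson not_le)
  show "facet_index_set d n X S"
    unfolding facet_index_set_def using T(1) T'(2) nd side S_eq by blast
qed

text \<open>
  The inverse of \<open>S \<mapsto> convex hull (X ` S)\<close> sends a facet to the set of all indices of points on it.
\<close>
lemma num_facets_eq_card_index_sets:
  "num_faces (d - 1) (convex hull (X ` {..<n})) = card {S. facet_index_set d n X S}"
proof -
  have "bij_betw (\<lambda>S. convex hull (X ` S)) {S. facet_index_set d n X S}
     {F. F face_of convex hull (X ` {..<n}) \<and> affine_dim F = int (d - 1)}"
    by (rule bij_betwI[where g = "\<lambda>F. {i. i < n \<and> X i \<in> F}"])
       (use facet_index_set_imp_facet facet_imp_facet_index_set in auto)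
  then show ?thesis unfolding num_faces_def by (simp add: bij_betw_same_card)
qed

end

lemma facet_index_set_general_position:
  assumes nd: "\<And>T. T \<subseteq> {..<n} \<Longrightarrow> card T = d \<Longrightarrow> nondegenerate d T X"
    and gp: "\<And>T j. T \<subseteq> {..<n} \<Longrightarrow> card T = d \<Longrightarrow> j < n \<Longrightarrow> j \<notin> T \<Longrightarrow> facet_height d T X (X j) \<noteq> 0"
    and d: "1 \<le> d"
  shows "{S. facet_index_set d n X S} = {T. T \<subseteq> {..<n} \<and> card T = d \<and>
     ((\<forall>j\<in>{..<n} - T. 0 < facet_height d T X (X j)) \<or> (\<forall>j\<in>{..<n} - T. facet_height d T X (X j) < 0))}"
  (is "_ = ?R")
proof (intro subset_antisym subsetI)
  fix S assume "S \<in> {S. facet_index_set d n X S}"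
  then obtain T where T: "T \<subseteq> S" "card T = d"
    and side: "(\<forall>j<n. 0 \<le> facet_height d T X (X j)) \<or> (\<forall>j<n. facet_height d T X (X j) \<le> 0)"
    and S_eq: "S = {j. j < n \<and> facet_height d T X (X j) = 0}"
    unfolding facet_index_set_def by blast
  have Tn: "T \<subseteq> {..<n}" using T(1) S_eq by auto
  have "S = T" using T(1) gp[OF Tn T(2)] unfolding S_eq by auto
  moreover have "(\<forall>j\<in>{..<n} - T. 0 < facet_height d T X (X j)) \<or> (\<forall>j\<in>{..<n} - T. facet_height d T X (X j) < 0)"
    using side gp[OF Tn T(2)] by (metis DiffE lessThan_iff order_less_le)
  ultimately show "S \<in> ?R" using Tn T(2) by simp
next
  fix T assume "T \<in> ?R"
  then have T: "T \<subseteq> {..<n}" "card T = d"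
    and side: "(\<forall>j\<in>{..<n} - T. 0 < facet_height d T X (X j)) \<or> (\<forall>j\<in>{..<n} - T. facet_height d T X (X j) < 0)"
    by auto
  have fin: "finite T" using T(1) by (rule finite_subset) simp
  have z: "facet_height d T X (X t) = 0" if "t \<in> T" for t
    using facet_height_vertex[OF d fin T(2) that] .
  have "(\<forall>j<n. 0 \<le> facet_height d T X (X j)) \<or> (\<forall>j<n. facet_height d T X (X j) \<le> 0)"
    using side z by (metis DiffI lessThan_iff order_less_imp_le order_refl)
  moreover have "T = {j. j < n \<and> facet_height d T X (X j) = 0}"
    using z gp[OF T] T(1) by auto
  ultimately show "T \<in> {S. facet_index_set d n X S}"
    unfolding facet_index_set_def using T(2) nd[OF T] by blast
qed

section \<open>Tools for finite product measures\<close>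

text \<open>
  By the Leibniz formula a cofactor is a polynomial in the entries outside row \<open>r\<close>.
\<close>
lemma row_cofactor_measurable:
  assumes W: "\<And>i k. i < d \<Longrightarrow> i \<noteq> r \<Longrightarrow> k < d \<Longrightarrow> (\<lambda>x. W x i k) \<in> borel_measurable M"
    and r: "r < d"
  shows "(\<lambda>x. row_cofactor d r (W x) j) \<in> borel_measurable M"
proof -
  have "row_cofactor d r (W x) j = (-1) ^ (r + j) * (\<Sum>p | p permutes {0..<d - 1}. signof p * (\<Prod>i = 0..<d - 1.
     W x (if i < r then i else Suc i) (if p i < j then p i else Suc (p i))))" for x
  proof -
    have "mat_delete (mat d d (\<lambda>(i, k). W x i k)) r j \<in> carrier_mat (d - 1) (d - 1)"
      by (rule mat_delete_carrier) simp
    then have "row_cofactor d r (W x) j = (-1) ^ (r + j) * (\<Sum>p | p permutes {0..<d - 1}. signof p * (\<Prod>i = 0..<d - 1.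
        mat_delete (mat d d (\<lambda>(i, k). W x i k)) r j $$ (i, p i)))"
      unfolding row_cofactor_def cofactor_def by (subst det_def') simp_all
    moreover have "mat_delete (mat d d (\<lambda>(i, k). W x i k)) r j $$ (i, p i) =
        W x (if i < r then i else Suc i) (if p i < j then p i else Suc (p i))"
      if "p permutes {0..<d - 1}" "i < d - 1" for p i
      using permutes_in_image[OF that(1), of i] that(2) by (simp add: mat_delete_def)
    ultimately show ?thesis by simp
  qed
  moreover have "(\<lambda>x. W x (if i < r then i else Suc i) (if p i < j then p i else Suc (p i))) \<in> borel_measurable M"
    if "p permutes {0..<d - 1}" "i < d - 1" for p i
    using permutes_in_image[OF that(1), of i] that(2) by (intro W) auto
  ultimately show ?thesis
    by (simp only:) (intro borel_measurable_times borel_measurable_const borel_measurable_sum borel_measurable_prod, auto)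
qed

text \<open>
  Replacing one coordinate by an independent copy does not change a product law. So it suffices that
  a property holds almost surely after resampling one coordinate, all others being fixed.
\<close>
lemma AE_PiM_resample:
  assumes I: "finite I" "i \<in> I" and M: "\<And>i. prob_space (M i)"
    and meas: "{x \<in> space (PiM I M). P x} \<in> sets (PiM I M)"
    and ae: "AE x in PiM I M. AE y in M i. P (x(i := y))"
  shows "AE x in PiM I M. P x"
proof -
  interpret product_prob_space M I by (rule product_prob_spaceI) fact
  have I': "insert i (I - {i}) = I" using I(2) by auto
  let ?A = "{x \<in> space (PiM I M). \<not> P x}"
  have A: "?A \<in> sets (PiM I M)"
  proof -
    have "?A = space (PiM I M) - {x \<in> space (PiM I M). P x}" by auto
    then show ?thesis using sets.compl_sets[OF meas] by (simp only:)
  qed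
  let ?f = "indicator ?A :: _ \<Rightarrow> ennreal"
  have f: "?f \<in> borel_measurable (PiM I M)" using A by simp
  have f': "?f \<in> borel_measurable (PiM (insert i (I - {i})) M)" unfolding I' by (rule f)
  define g where "g x = (\<integral>\<^sup>+y. ?f (x(i := y)) \<partial>M i)" for x
  have "AE x in PiM I M. g x = 0"
    using ae
  proof (eventually_elim)
    case (elim x)
    then have "AE y in M i. ?f (x(i := y)) = 0" by eventually_elim simp
    then show ?case unfolding g_def by (subst nn_integral_cong_AE[of _ "\<lambda>_. 0"]) auto
  qed
  then have g0: "integral\<^sup>N (PiM I M) g = 0"
    by (subst nn_integral_cong_AE[of _ "\<lambda>_. 0"]) auto
  \<comment> \<open>The function \<open>g\<close> does not depend on coordinate \<open>i\<close>, so integrating over that coordinate once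
    more changes nothing.\<close>
  have "integral\<^sup>N (PiM I M) ?f = (\<integral>\<^sup>+x. g x \<partial>PiM (I - {i}) M)"
    using product_nn_integral_insert[OF _ _ f'] I unfolding I' g_def by simp
  also have "\<dots> = (\<integral>\<^sup>+x. (\<integral>\<^sup>+y. g (x(i := y)) \<partial>M i) \<partial>PiM (I - {i}) M)"
    by (simp add: g_def M.emeasure_space_1)
  also have "\<dots> = integral\<^sup>N (PiM I M) g"
  proof -
    have "g \<in> borel_measurable (PiM (insert i (I - {i})) M)"
    proof -
      have "(\<lambda>(x, y). ?f (x(i := y))) \<in> borel_measurable (PiM I M \<Otimes>\<^sub>M M i)"
      proof -
        have "(\<lambda>(x, y). x(i := y)) \<in> measurable (PiM I M \<Otimes>\<^sub>M M i) (PiM I M)"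
          using measurable_add_dim[of i I M] I(2) by (simp add: insert_absorb)
        from measurable_compose[OF this f] show ?thesis by (simp add: case_prod_beta')
      qed
      then show ?thesis unfolding I' g_def by measurable
    qed
    then show ?thesis
      using product_nn_integral_insert[of "I - {i}" i g] I unfolding I' by simp
  qed
  finally have "emeasure (PiM I M) ?A = 0" using g0 A by simp
  then show ?thesis using A by (subst AE_iff_measurable[OF A]) auto
qed

lemma distr_PiM_components:
  assumes I: "finite I" and M: "\<And>i. prob_space (M i)" and M': "\<And>i. prob_space (M' i)"
    and f[measurable]: "\<And>i. i \<in> I \<Longrightarrow> f i \<in> measurable (M i) (M' i)"
  shows "distr (PiM I M) (PiM I M') (\<lambda>x. \<lambda>i\<in>I. f i (x i)) = PiM I (\<lambda>i. distr (M i) (M' i) (f i))"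
proof -
  interpret M: product_prob_space M I by (rule product_prob_spaceI) fact
  define N where "N i = (if i \<in> I then distr (M i) (M' i) (f i) else M' i)" for i
  have "prob_space (N i)" for i
    using M' prob_space.prob_space_distr[OF M f] by (auto simp: N_def)
  then interpret N: product_prob_space N I by (rule product_prob_spaceI)
  have sN: "sets (N i) = sets (M' i)" for i by (simp add: N_def)
  have "distr (PiM I M) (PiM I M') (\<lambda>x. \<lambda>i\<in>I. f i (x i)) = PiM I N"
  proof (rule N.PiM_eqI[OF I])
    show "sets (distr (PiM I M) (PiM I M') (\<lambda>x. \<lambda>i\<in>I. f i (x i))) = sets (PiM I N)"
      by (simp cong: sets_PiM_cong add: sN)
    fix B assume B: "\<And>i. i \<in> I \<Longrightarrow> B i \<in> sets (N i)"
    have eq: "(\<lambda>x. \<lambda>i\<in>I. f i (x i)) -` Pi\<^sub>E I B \<inter> space (PiM I M) = Pi\<^sub>E I (\<lambda>i. f i -` B i \<inter> space (M i))"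
      by (auto simp: space_PiM PiE_iff extensional_def split: if_splits)
    have "emeasure (distr (PiM I M) (PiM I M') (\<lambda>x. \<lambda>i\<in>I. f i (x i))) (Pi\<^sub>E I B) =
        emeasure (PiM I M) (Pi\<^sub>E I (\<lambda>i. f i -` B i \<inter> space (M i)))"
      unfolding eq[symmetric] using B by (intro emeasure_distr sets_PiM_I_finite I) (auto simp: sN)
    also have "\<dots> = (\<Prod>i\<in>I. emeasure (M i) (f i -` B i \<inter> space (M i)))"
      using B by (intro M.emeasure_PiM I measurable_sets[OF f]) (auto simp: sN)
    also have "\<dots> = (\<Prod>i\<in>I. emeasure (N i) (B i))"
      using B by (intro prod.cong) (auto simp: N_def emeasure_distr)
    finally show "emeasure (distr (PiM I M) (PiM I M') (\<lambda>x. \<lambda>i\<in>I. f i (x i))) (Pi\<^sub>E I B) = (\<Prod>i\<in>I. emeasure (N i) (B i))" .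
  qed
  also have "\<dots> = PiM I (\<lambda>i. distr (M i) (M' i) (f i))"
    by (intro PiM_cong) (auto simp: N_def)
  finally show ?thesis .
qed

lemma PiM_density:
  assumes I: "finite I" and M: "\<And>i. prob_space (M i)"
    and f[measurable]: "\<And>i. i \<in> I \<Longrightarrow> f i \<in> borel_measurable (M i)"
    and p: "\<And>i. i \<in> I \<Longrightarrow> prob_space (density (M i) (f i))"
  shows "PiM I (\<lambda>i. density (M i) (f i)) = density (PiM I M) (\<lambda>x. \<Prod>i\<in>I. f i (x i))"
proof -
  interpret M: product_prob_space M I by (rule product_prob_spaceI) fact
  define N where "N i = (if i \<in> I then density (M i) (f i) else M i)" for i
  have "prob_space (N i)" for i
    using M p by (auto simp: N_def)
  then interpret N: product_prob_space N I by (rule product_prob_spaceI)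
  have sN: "sets (N i) = sets (M i)" for i by (simp add: N_def)
  have "density (PiM I M) (\<lambda>x. \<Prod>i\<in>I. f i (x i)) = PiM I N"
  proof (rule N.PiM_eqI[OF I])
    show "sets (density (PiM I M) (\<lambda>x. \<Prod>i\<in>I. f i (x i))) = sets (PiM I N)"
      by (simp cong: sets_PiM_cong add: sN)
    fix B assume B: "\<And>i. i \<in> I \<Longrightarrow> B i \<in> sets (N i)"
    have B'[measurable]: "i \<in> I \<Longrightarrow> B i \<in> sets (M i)" for i using B sN by auto
    have "emeasure (density (PiM I M) (\<lambda>x. \<Prod>i\<in>I. f i (x i))) (Pi\<^sub>E I B) =
        (\<integral>\<^sup>+x. (\<Prod>i\<in>I. f i (x i)) * indicator (Pi\<^sub>E I B) x \<partial>PiM I M)"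
      using B' by (intro emeasure_density) (auto intro!: sets_PiM_I_finite I)
    also have "\<dots> = (\<integral>\<^sup>+x. (\<Prod>i\<in>I. f i (x i) * indicator (B i) (x i)) \<partial>PiM I M)"
    proof (rule nn_integral_cong)
      fix x assume "x \<in> space (PiM I M)"
      then have "x \<in> Pi\<^sub>E I B \<longleftrightarrow> (\<forall>i\<in>I. x i \<in> B i)" by (auto simp: space_PiM PiE_iff)
      then show "(\<Prod>i\<in>I. f i (x i)) * indicator (Pi\<^sub>E I B) x = (\<Prod>i\<in>I. f i (x i) * indicator (B i) (x i))"
        using I by (cases "\<forall>i\<in>I. x i \<in> B i") (auto simp: indicator_def intro!: prod.cong prod_zero[symmetric])
    qed
    also have "\<dots> = (\<Prod>i\<in>I. \<integral>\<^sup>+x. f i x * indicator (B i) x \<partial>M i)"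
      by (intro M.product_nn_integral_prod I) measurable
    also have "\<dots> = (\<Prod>i\<in>I. emeasure (N i) (B i))"
      by (intro prod.cong) (auto simp: N_def emeasure_density)
    finally show "emeasure (density (PiM I M) (\<lambda>x. \<Prod>i\<in>I. f i (x i))) (Pi\<^sub>E I B) = (\<Prod>i\<in>I. emeasure (N i) (B i))" .
  qed
  also have "PiM I N = PiM I (\<lambda>i. density (M i) (f i))"
    by (intro PiM_cong) (auto simp: N_def)
  finally show ?thesis ..
qed

section \<open>General position of Gaussian points\<close>

text \<open>
  Sums of independent normal variables are normal. Coordinates with \<open>u k = 0\<close> are left out of the sum,
  since a normal variable needs a positive variance.
\<close>
lemma distr_coord_dot_normal:
  assumes u: "\<exists>k<d. u k \<noteq> 0" and \<sigma>: "0 < \<sigma>"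
  shows "distr (\<Pi>\<^sub>M k\<in>{..<d}. density lborel (normal_density (\<mu> k) \<sigma>)) borel (coord_dot d u) =
    density lborel (normal_density (coord_dot d u \<mu>) (\<sigma> * sqrt (coord_dot d u u)))"
proof -
  let ?N = "\<lambda>k. density lborel (\<lambda>x. ennreal (normal_density (\<mu> k) \<sigma> x))"
  define P where "P = (\<Pi>\<^sub>M k\<in>{..<d}. ?N k)"
  have N: "prob_space (?N k)" for k using prob_space_normal_density[OF \<sigma>] by simp
  interpret P: prob_space P unfolding P_def by (intro prob_space_PiM N)
  have coord_meas: "(\<lambda>x. x k) \<in> borel_measurable P" if "k < d" for k
    using measurable_component_singleton[of k "{..<d}" ?N] that unfolding P_def by (simp cong: measurable_cong_sets)
  have d0: "{..<d} \<noteq> {}" using u by auto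
  have "P.indep_vars (\<lambda>_. borel) (\<lambda>k x. x k) {..<d}"
  proof (subst P.indep_vars_iff_distr_eq_PiM'[OF d0])
    show "(\<lambda>x. x k) \<in> borel_measurable P" if "k \<in> {..<d}" for k using coord_meas that by simp
    have "distr P (PiM {..<d} (\<lambda>_. borel)) (\<lambda>x. \<lambda>k\<in>{..<d}. x k) = distr P P (\<lambda>x. x)"
      unfolding P_def by (intro distr_cong sets_PiM_cong) (auto simp: space_PiM PiE_iff extensional_restrict)
    also have "\<dots> = P" by (simp add: distr_id2)
    also have "P = PiM {..<d} (\<lambda>k. distr P borel (\<lambda>x. x k))"
    proof -
      have "distr P borel (\<lambda>x. x k) = ?N k" if "k \<in> {..<d}" for k
      proof -
        have "distr P borel (\<lambda>x. x k) = distr P (?N k) (\<lambda>x. x k)" by (intro distr_cong) auto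
        then show ?thesis using distr_PiM_component[of "{..<d}" ?N k] N that unfolding P_def by simp
      qed
      then show ?thesis unfolding P_def[symmetric] by (subst P_def, intro PiM_cong) auto
    qed
    finally show "distr P (PiM {..<d} (\<lambda>_. borel)) (\<lambda>x. \<lambda>k\<in>{..<d}. x k) = PiM {..<d} (\<lambda>k. distr P borel (\<lambda>x. x k))" .
  qed
  then have "P.indep_vars (\<lambda>_. borel) (\<lambda>k x. u k * x k) {..<d}"
    by (rule P.indep_vars_compose2) simp
  then have ind: "P.indep_vars (\<lambda>_. borel) (\<lambda>k x. u k * x k) {k. k < d \<and> u k \<noteq> 0}"
    by (rule P.indep_vars_subset) auto
  have coord: "distributed P lborel (\<lambda>x. x k) (normal_density (\<mu> k) \<sigma>)" if "k < d" for k
  proof -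
    have "distr P lborel (\<lambda>x. x k) = distr P (?N k) (\<lambda>x. x k)" by (intro distr_cong) auto
    also have "\<dots> = ?N k" using distr_PiM_component[of "{..<d}" ?N k] N that unfolding P_def by simp
    finally show ?thesis unfolding distributed_def using coord_meas[OF that] by simp
  qed
  have dist: "distributed P lborel (\<lambda>x. u k * x k) (normal_density (u k * \<mu> k) (\<bar>u k\<bar> * \<sigma>))"
    if "k \<in> {k. k < d \<and> u k \<noteq> 0}" for k
    using P.normal_density_affine[OF coord \<sigma>, of k "u k" 0] that by simp
  have "distributed P lborel (\<lambda>x. \<Sum>k | k < d \<and> u k \<noteq> 0. u k * x k)
      (normal_density (\<Sum>k | k < d \<and> u k \<noteq> 0. u k * \<mu> k) (sqrt (\<Sum>k | k < d \<and> u k \<noteq> 0. (\<bar>u k\<bar> * \<sigma>)\<^sup>2)))"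
    using u by (intro P.sum_indep_normal ind dist) (auto simp: \<sigma>)
  moreover have "(\<Sum>k | k < d \<and> u k \<noteq> 0. u k * x k) = coord_dot d u x" for x
    unfolding coord_dot_def by (rule sum.mono_neutral_left) auto
  moreover have "(\<Sum>k | k < d \<and> u k \<noteq> 0. (\<bar>u k\<bar> * \<sigma>)\<^sup>2) = \<sigma>\<^sup>2 * coord_dot d u u"
    unfolding coord_dot_def sum_distrib_left
    by (rule sum.mono_neutral_cong_left) (auto simp: power_mult_distrib power2_eq_square)
  ultimately have "distributed P lborel (coord_dot d u) (normal_density (coord_dot d u \<mu>) (\<sigma> * sqrt (coord_dot d u u)))"
    using \<sigma> by (simp add: real_sqrt_mult)
  moreover have "distr P lborel (coord_dot d u) = distr P borel (coord_dot d u)" by (intro distr_cong) auto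
  ultimately show ?thesis unfolding distributed_def P_def by simp
qed

lemma prob_space_std_gaussian: "prob_space (std_gaussian d)"
  unfolding std_gaussian_def by (intro prob_space_PiM prob_space_std_normal)

lemma coord_measurable [measurable]: "k < d \<Longrightarrow> (\<lambda>x. x k) \<in> borel_measurable (std_gaussian d)"
  using measurable_component_singleton[of k "{..<d}" "\<lambda>_. std_normal_distribution"]
  unfolding std_gaussian_def by (simp cong: measurable_cong_sets)

lemma coord_dot_measurable [measurable]: "coord_dot d u \<in> borel_measurable (std_gaussian d)"
  unfolding coord_dot_def by measurable

lemma sample_coord_measurable:
  "i \<in> I \<Longrightarrow> k < d \<Longrightarrow> (\<lambda>X. X i k) \<in> borel_measurable (PiM I (\<lambda>_. std_gaussian d))"
  using measurable_compose[OF measurable_component_singleton[of i I "\<lambda>_. std_gaussian d"] coord_measurable[of k d]] by simp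

lemma coord_dot_pos: "\<exists>k<d. u k \<noteq> 0 \<Longrightarrow> 0 < coord_dot d u u"
  unfolding coord_dot_def by (auto intro!: sum_pos2 simp: zero_less_mult_iff linorder_neq_iff)

lemma distr_coord_dot_std_gaussian:
  assumes "\<exists>k<d. u k \<noteq> 0"
  shows "distr (std_gaussian d) borel (coord_dot d u) = density lborel (normal_density 0 (sqrt (coord_dot d u u)))"
  using distr_coord_dot_normal[OF assms, of 1 "\<lambda>_. 0"]
  unfolding std_gaussian_def by (simp add: coord_dot_def[of d u "\<lambda>_. 0"])

lemma AE_coord_dot_neq:
  assumes "\<exists>k<d. u k \<noteq> 0"
  shows "AE y in std_gaussian d. coord_dot d u y \<noteq> c"
proof -
  have "AE z in density lborel (normal_density 0 (sqrt (coord_dot d u u))). z \<noteq> c"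
    using AE_lborel_singleton[of c] by (subst AE_density) auto
  then have "AE z in distr (std_gaussian d) borel (coord_dot d u). z \<noteq> c"
    unfolding distr_coord_dot_std_gaussian[OF assms] .
  then show ?thesis by (rule AE_distrD[rotated]) measurable
qed

lemma det_rows_measurable:
  assumes W: "\<And>i k. i < d \<Longrightarrow> k < d \<Longrightarrow> (\<lambda>x. W x i k) \<in> borel_measurable M" and d: "1 \<le> d"
  shows "(\<lambda>x. det_rows d (W x)) \<in> borel_measurable M"
proof -
  have "det_rows d (W x) = (\<Sum>j<d. W x 0 j * row_cofactor d 0 (W x) j)" for x
    using det_rows_expand[of 0 d "W x" "W x 0"] d by simp
  then show ?thesis
    using W d by (simp only:) (intro borel_measurable_sum borel_measurable_times row_cofactor_measurable, auto)
qed

text \<open>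
  Random rows are inserted one after the other into the identity matrix. As a function of the newly
  inserted row the determinant is an affine functional; its linear part is not zero because the
  determinant before the insertion, where that row is a unit vector, is one of its coefficients. So it
  vanishes with probability zero. The base \<open>b\<close> is the common point subtracted from all
  vertices, or the zero vector.
\<close>
lemma AE_cross_normal_nonzero:
  assumes d: "1 \<le> d" and I: "finite I" and r: "inj_on r {..<d - 1}" "r ` {..<d - 1} \<subseteq> I"
    and b: "\<And>X y i. i < d - 1 \<Longrightarrow> b (X(r i := y)) = b X"
    and bm: "\<And>k. k < d \<Longrightarrow> (\<lambda>X. b X k) \<in> borel_measurable (PiM I (\<lambda>_. std_gaussian d))"
  shows "AE X in PiM I (\<lambda>_. std_gaussian d). \<exists>k<d. cross_normal d (\<lambda>i k. X (r i) k - b X k) k \<noteq> 0"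
proof -
  let ?M = "PiM I (\<lambda>_. std_gaussian d)"
  define e :: "nat \<Rightarrow> nat \<Rightarrow> real" where "e i k = (if k = i then 1 else 0)" for i k
  define W where "W m X i k = (if i < m then X (r i) k - b X k else e i k)" for m X i k
  have W_meas: "(\<lambda>X. W m X i k) \<in> borel_measurable ?M" if "m \<le> d - 1" "k < d" for m i k
  proof (cases "i < m")
    case True
    then have "r i \<in> I" using r(2) that by auto
    then show ?thesis
      using True sample_coord_measurable[of "r i" I k d] bm[of k] that by (simp add: W_def)
  qed (simp add: W_def)
  have step: "AE X in ?M. det_rows d (W m X) \<noteq> 0" if "m \<le> d - 1" for m
    using that
  proof (induction m)
    case 0
    have "det_rows d (W 0 X) \<noteq> 0" for X
      unfolding det_rows_eq_0_iff
    proof clarify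
      fix c i assume c: "\<forall>k<d. (\<Sum>i<d. c i * W 0 X i k) = 0" and i: "i < d" "c i \<noteq> 0"
      have "c i * W 0 X i' i = (if i' = i then c i' else 0)" for i' by (simp add: W_def e_def)
      then have "(\<Sum>i'<d. c i' * W 0 X i' i) = c i"
        using i by (simp add: W_def e_def if_distrib cong: if_cong)
      then show False using c i by auto
    qed
    then show ?case by simp
  next
    case (Suc m)
    then have m: "m < d - 1" "m < d" "r m \<in> I" using r(2) by auto
    show ?case
    proof (rule AE_PiM_resample[OF I m(3) prob_space_std_gaussian])
      show "{X \<in> space ?M. det_rows d (W (Suc m) X) \<noteq> 0} \<in> sets ?M"
        using det_rows_measurable[OF _ d, of "\<lambda>X. W (Suc m) X" ?M] W_meas Suc.prems by measurable
      have "AE X in ?M. det_rows d (W m X) \<noteq> 0" using Suc by simp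
      then show "AE X in ?M. AE y in std_gaussian d. det_rows d (W (Suc m) (X(r m := y))) \<noteq> 0"
      proof eventually_elim
        case (elim X)
        let ?C = "row_cofactor d m (W m X)"
        have "det_rows d (W m X) = (\<Sum>j<d. e m j * ?C j)"
          using det_rows_expand[OF m(2), of "W m X" "e m"] by (simp add: W_def[abs_def] fun_upd_idem)
        moreover have "e m j * ?C j = (if j = m then ?C j else 0)" for j by (simp add: e_def)
        ultimately have "?C m \<noteq> 0" using elim m by simp
        then have C: "\<exists>k<d. ?C k \<noteq> 0" using m by blast
        have expand: "det_rows d (W (Suc m) (X(r m := y))) = coord_dot d ?C y - coord_dot d ?C (b X)" for y
        proof -
          have rne: "r i \<noteq> r m" if "i < m" for i using inj_onD[OF r(1), of i m] that m by auto
          have "det_rows d (W (Suc m) (X(r m := y))) = det_rows d ((W m X)(m := (\<lambda>k. y k - b X k)))"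
            using b[OF m(1)] rne by (intro det_rows_cong) (auto simp: W_def less_Suc_eq)
          also have "\<dots> = (\<Sum>j<d. (y j - b X j) * ?C j)" by (rule det_rows_expand[OF m(2)])
          finally show ?thesis by (simp add: coord_dot_def algebra_simps sum_subtractf)
        qed
        show ?case unfolding expand using AE_coord_dot_neq[OF C, of "coord_dot d ?C (b X)"] by simp
      qed
    qed
  qed
  show ?thesis
    using step[of "d - 1", OF order_refl]
  proof eventually_elim
    case (elim X)
    have "det_rows d (W (d - 1) X) = det_rows d ((\<lambda>i k. X (r i) k - b X k)(d - 1 := e (d - 1)))"
      by (intro det_rows_cong) (auto simp: W_def)
    also have "\<dots> = (\<Sum>j<d. e (d - 1) j * cross_normal d (\<lambda>i k. X (r i) k - b X k) j)"
      using d by (intro det_rows_expand) simp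
    finally have "\<exists>j<d. e (d - 1) j * cross_normal d (\<lambda>i k. X (r i) k - b X k) j \<noteq> 0"
      using elim by (metis (no_types, lifting) lessThan_iff sum.neutral)
    then show ?case by auto
  qed
qed

lemma facet_normal_cong:
  assumes "finite T" "card T = d" "1 \<le> d" "\<And>t k. t \<in> T \<Longrightarrow> k < d \<Longrightarrow> X t k = Y t k"
  shows "facet_normal d T X = facet_normal d T Y"
  unfolding facet_normal_def edge_vectors_def
  using assms vertex_in[OF assms(3,1,2)] by (intro ext row_cofactor_cong) auto

lemma facet_height_cong:
  assumes "finite T" "card T = d" "1 \<le> d" "\<And>t k. t \<in> T \<Longrightarrow> k < d \<Longrightarrow> X t k = Y t k"
    "\<And>k. k < d \<Longrightarrow> x k = y k"
  shows "facet_height d T X x = facet_height d T Y y"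
  unfolding facet_height_def coord_dot_def
  using assms vertex_in[OF assms(3,1,2), of 0] facet_normal_cong[OF assms(1-4)] by (intro sum.cong) auto

lemma facet_normal_measurable:
  assumes "finite T" "card T = d" "1 \<le> d" "T \<subseteq> I"
  shows "(\<lambda>X. facet_normal d T X k) \<in> borel_measurable (PiM I (\<lambda>_. std_gaussian d))"
  unfolding facet_normal_def edge_vectors_def
  using assms vertex_in[OF assms(3,1,2)]
  by (intro row_cofactor_measurable borel_measurable_diff sample_coord_measurable) auto

lemma facet_height_measurable:
  assumes "finite T" "card T = d" "1 \<le> d" "T \<subseteq> I" "j \<in> I"
  shows "(\<lambda>X. facet_height d T X (X j)) \<in> borel_measurable (PiM I (\<lambda>_. std_gaussian d))"
  unfolding facet_height_def coord_dot_def
  using assms vertex_in[OF assms(3,1,2), of 0]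
  by (intro borel_measurable_sum borel_measurable_times facet_normal_measurable borel_measurable_diff sample_coord_measurable) auto

lemma AE_nondegenerate:
  assumes T: "finite T" "card T = d" "1 \<le> d" "T \<subseteq> I" and I: "finite I"
  shows "AE X in PiM I (\<lambda>_. std_gaussian d). nondegenerate d T X"
proof -
  have bij: "bij_betw (vertex T) {..<d} T" by (rule bij_betw_vertex[OF T(1,2)])
  have "AE X in PiM I (\<lambda>_. std_gaussian d).
      \<exists>k<d. cross_normal d (\<lambda>i k. X (vertex T (Suc i)) k - X (vertex T 0) k) k \<noteq> 0"
  proof (rule AE_cross_normal_nonzero[OF T(3) I, where r = "\<lambda>i. vertex T (Suc i)" and b = "\<lambda>X. X (vertex T 0)"])
    show "inj_on (\<lambda>i. vertex T (Suc i)) {..<d - 1}"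
      using inj_onD[OF bij_betw_imp_inj_on[OF bij], of "Suc i" "Suc j" for i j] by (intro inj_onI) fastforce
    show "(\<lambda>i. vertex T (Suc i)) ` {..<d - 1} \<subseteq> I"
      using vertex_in[OF T(3,1,2)] T(4) by auto
    show "(X(vertex T (Suc i) := y)) (vertex T 0) = X (vertex T 0)" if "i < d - 1" for X :: "nat \<Rightarrow> nat \<Rightarrow> real" and y i
    proof -
      have "Suc i < d" using that by simp
      then show ?thesis using inj_onD[OF bij_betw_imp_inj_on[OF bij], of "Suc i" 0] by auto
    qed
    show "(\<lambda>X. X (vertex T 0) k) \<in> borel_measurable (PiM I (\<lambda>_. std_gaussian d))" if "k < d" for k
      using vertex_in[OF T(3,1,2), of 0] T(3,4) that by (intro sample_coord_measurable) auto
  qed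
  then show ?thesis by (simp add: nondegenerate_def facet_normal_def edge_vectors_def[abs_def])
qed

text \<open>
  Point \<open>j\<close> is independent of the hyperplane, which has probability zero under its law.
\<close>
lemma AE_facet_height_nonzero:
  assumes T: "finite T" "card T = d" "1 \<le> d" "T \<subseteq> I" and I: "finite I" and j: "j \<in> I" "j \<notin> T"
  shows "AE X in PiM I (\<lambda>_. std_gaussian d). facet_height d T X (X j) \<noteq> 0"
proof (rule AE_PiM_resample[OF I j(1) prob_space_std_gaussian])
  show "{X \<in> space (PiM I (\<lambda>_. std_gaussian d)). facet_height d T X (X j) \<noteq> 0} \<in> sets (PiM I (\<lambda>_. std_gaussian d))"
    using facet_height_measurable[OF T j(1)] by measurable
  show "AE X in PiM I (\<lambda>_. std_gaussian d). AE y in std_gaussian d. facet_height d T (X(j := y)) ((X(j := y)) j) \<noteq> 0"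
    using AE_nondegenerate[OF T I]
  proof eventually_elim
    case (elim X)
    then have N: "\<exists>k<d. facet_normal d T X k \<noteq> 0" by (simp add: nondegenerate_def)
    have "facet_height d T (X(j := y)) ((X(j := y)) j) =
        coord_dot d (facet_normal d T X) y - coord_dot d (facet_normal d T X) (X (vertex T 0))" for y
      unfolding facet_height_eq[symmetric] using j(2) by (intro facet_height_cong T) auto
    then show ?case using AE_coord_dot_neq[OF N] by simp
  qed
qed

section \<open>The distance of a random hyperplane from the origin\<close>

text \<open>
  The density of the normal law with mean \<open>- a\<close> and variance 1 relative to the standard normal law.
\<close>
definition shift_weight :: "real \<Rightarrow> real \<Rightarrow> ennreal" where
  "shift_weight a x = ennreal (exp (- a * x - a\<^sup>2 / 2))"

lemma shift_weight_measurable [measurable]: "shift_weight a \<in> borel_measurable borel"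
  unfolding shift_weight_def[abs_def] by measurable

lemma distr_shift_std_normal:
  "distr std_normal_distribution std_normal_distribution (\<lambda>x. x - a) = density std_normal_distribution (shift_weight a)"
proof -
  interpret prob_space std_normal_distribution by (rule prob_space_std_normal)
  have "distributed std_normal_distribution lborel (\<lambda>x. x) std_normal_density"
    unfolding distributed_def by (auto simp: distr_id2)
  from normal_density_affine[OF this, of 1 "- a"]
  have "distr std_normal_distribution lborel (\<lambda>x. x - a) = density lborel (normal_density (- a) 1)"
    unfolding distributed_def by simp
  also have "\<dots> = density lborel (\<lambda>x. ennreal (std_normal_density x) * shift_weight a x)"
    by (intro density_cong) (auto simp: shift_weight_def normal_density_def power2_eq_square algebra_simps
      add_divide_distrib diff_divide_distrib simp flip: ennreal_mult exp_add)
  also have "\<dots> = density std_normal_distribution (shift_weight a)"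
    by (subst density_density_eq) auto
  finally show ?thesis by (subst distr_cong[OF refl _ refl, of _ lborel]) auto
qed

text \<open>
  Elements of a product space are \<open>undefined\<close> outside the index set, whence the restriction.
\<close>
definition shift_vector :: "nat \<Rightarrow> (nat \<Rightarrow> real) \<Rightarrow> (nat \<Rightarrow> real) \<Rightarrow> nat \<Rightarrow> real" where
  "shift_vector d a x = (\<lambda>k\<in>{..<d}. x k - a k)"

lemma distr_shift_std_gaussian:
  "distr (std_gaussian d) (std_gaussian d) (shift_vector d a) =
   density (std_gaussian d) (\<lambda>x. \<Prod>k<d. shift_weight (a k) (x k))"
proof -
  have "distr (std_gaussian d) (std_gaussian d) (shift_vector d a) =
      PiM {..<d} (\<lambda>k. density std_normal_distribution (shift_weight (a k)))"
    unfolding std_gaussian_def shift_vector_def[abs_def]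
    by (subst distr_PiM_components) (auto simp: distr_shift_std_normal prob_space_std_normal)
  also have "\<dots> = density (std_gaussian d) (\<lambda>x. \<Prod>k<d. shift_weight (a k) (x k))"
    unfolding std_gaussian_def
  proof (rule PiM_density)
    show "prob_space (density std_normal_distribution (shift_weight (a k)))" for k
      unfolding distr_shift_std_normal[symmetric]
      by (intro prob_space.prob_space_distr prob_space_std_normal) simp
  qed (auto simp: prob_space_std_normal)
  finally show ?thesis .
qed

lemma shift_vector_measurable: "shift_vector d a \<in> measurable (std_gaussian d) (std_gaussian d)"
proof -
  have "shift_vector d a \<in> measurable (std_gaussian d) (\<Pi>\<^sub>M k\<in>{..<d}. std_normal_distribution)"
    unfolding shift_vector_def[abs_def]
    by (rule measurable_restrict) (simp cong: measurable_cong_sets)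
  then show ?thesis by (simp add: std_gaussian_def)
qed

lemma distr_shift_sample:
  assumes I: "finite I"
  shows "distr (PiM I (\<lambda>_. std_gaussian d)) (PiM I (\<lambda>_. std_gaussian d)) (\<lambda>x. \<lambda>t\<in>I. shift_vector d a (x t)) =
   density (PiM I (\<lambda>_. std_gaussian d)) (\<lambda>x. \<Prod>t\<in>I. \<Prod>k<d. shift_weight (a k) (x t k))"
proof -
  have "distr (PiM I (\<lambda>_. std_gaussian d)) (PiM I (\<lambda>_. std_gaussian d)) (\<lambda>x. \<lambda>t\<in>I. shift_vector d a (x t)) =
    PiM I (\<lambda>_. density (std_gaussian d) (\<lambda>x. \<Prod>k<d. shift_weight (a k) (x k)))"
    using distr_PiM_components[OF I, of "\<lambda>_. std_gaussian d" "\<lambda>_. std_gaussian d" "\<lambda>_. shift_vector d a"]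
    by (simp add: distr_shift_std_gaussian prob_space_std_gaussian shift_vector_measurable)
  also have "\<dots> = density (PiM I (\<lambda>_. std_gaussian d)) (\<lambda>x. \<Prod>t\<in>I. \<Prod>k<d. shift_weight (a k) (x t k))"
  proof (rule PiM_density[OF I])
    show "prob_space (density (std_gaussian d) (\<lambda>x. \<Prod>k<d. shift_weight (a k) (x k)))"
      unfolding distr_shift_std_gaussian[symmetric]
      by (intro prob_space.prob_space_distr prob_space_std_gaussian shift_vector_measurable)
  qed (auto simp: prob_space_std_gaussian intro!: borel_measurable_prod_ennreal measurable_compose[OF coord_measurable])
  finally show ?thesis .
qed

text \<open>
  The density of the normal law with mean \<open>- W / d\<close> and variance \<open>1 / d\<close> relative to the standard
  normal law.
\<close>
definition tilt_weight :: "nat \<Rightarrow> real \<Rightarrow> real \<Rightarrow> ennreal" where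
  "tilt_weight d W x = ennreal (sqrt (real d) * exp (- (real d - 1) * x\<^sup>2 / 2 - x * W - W\<^sup>2 / (2 * real d)))"

lemma tilt_weight_measurable [measurable]: "tilt_weight d W \<in> borel_measurable borel"
  unfolding tilt_weight_def[abs_def] by measurable

lemma density_tilt_weight:
  assumes "1 \<le> d"
  shows "density std_normal_distribution (tilt_weight d W) = density lborel (normal_density (- W / real d) (1 / sqrt (real d)))"
proof -
  have "density std_normal_distribution (tilt_weight d W) =
      density lborel (\<lambda>x. ennreal (std_normal_density x) * tilt_weight d W x)"
    by (subst density_density_eq) auto
  also have "\<dots> = density lborel (normal_density (- W / real d) (1 / sqrt (real d)))"
  proof (intro density_cong AE_I2)
    fix x :: real
    have d: "0 < real d" using assms by simp
    have "- x\<^sup>2 / 2 + (- (real d - 1) * x\<^sup>2 / 2 - x * W - W\<^sup>2 / (2 * real d)) = - (x - - W / real d)\<^sup>2 / (2 * (1 / sqrt (real d))\<^sup>2)"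
      using d by (simp add: power2_eq_square field_simps)
    then have "std_normal_density x * (sqrt (real d) * exp (- (real d - 1) * x\<^sup>2 / 2 - x * W - W\<^sup>2 / (2 * real d))) =
        sqrt (real d) / sqrt (2 * pi) * exp (- (x - - W / real d)\<^sup>2 / (2 * (1 / sqrt (real d))\<^sup>2))"
      by (simp add: std_normal_density_def mult_ac flip: exp_add)
    also have "\<dots> = normal_density (- W / real d) (1 / sqrt (real d)) x"
      using d by (simp add: normal_density_def real_sqrt_divide power_divide real_sqrt_mult)
    finally show "ennreal (std_normal_density x) * tilt_weight d W x = ennreal (normal_density (- W / real d) (1 / sqrt (real d)) x)"
      unfolding tilt_weight_def by (simp flip: ennreal_mult)
  qed auto
  finally show ?thesis .
qed

lemma PiM_tilt_weight:
  assumes "1 \<le> d"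
  shows "density (std_gaussian d) (\<lambda>x. \<Prod>k<d. tilt_weight d (W k) (x k)) =
    (\<Pi>\<^sub>M k\<in>{..<d}. density lborel (normal_density (- W k / real d) (1 / sqrt (real d))))"
proof -
  have "(\<Pi>\<^sub>M k\<in>{..<d}. density std_normal_distribution (tilt_weight d (W k))) =
      density (std_gaussian d) (\<lambda>x. \<Prod>k<d. tilt_weight d (W k) (x k))"
    unfolding std_gaussian_def
  proof (rule PiM_density)
    show "prob_space (density std_normal_distribution (tilt_weight d (W k)))" for k
      unfolding density_tilt_weight[OF assms] using assms by (intro prob_space_normal_density) simp
  qed (auto simp: prob_space_std_normal)
  then show ?thesis by (simp add: density_tilt_weight[OF assms])
qed

text \<open>
  Completing the square. With \<open>a\<close> a coordinate of the base point and \<open>w\<close> those of the \<open>d - 1\<close>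
  differences, the joint density is split into the marginal density of the differences and the
  conditional density of the base point, whose mean is \<open>- (\<Sum>t\<in>I. w t) / d\<close>.
\<close>
lemma prod_shift_weight:
  assumes "finite I" "card I = d - 1" "1 \<le> d"
  shows "(\<Prod>t\<in>I. shift_weight a (w t)) =
    ennreal (exp ((\<Sum>t\<in>I. w t)\<^sup>2 / (2 * real d)) / sqrt (real d)) * tilt_weight d (\<Sum>t\<in>I. w t) a"
proof -
  let ?W = "\<Sum>t\<in>I. w t"
  have "(\<Prod>t\<in>I. shift_weight a (w t)) = ennreal (\<Prod>t\<in>I. exp (- a * w t - a\<^sup>2 / 2))"
    unfolding shift_weight_def by (rule prod_ennreal) simp
  also have "(\<Prod>t\<in>I. exp (- a * w t - a\<^sup>2 / 2)) = exp (\<Sum>t\<in>I. - a * w t - a\<^sup>2 / 2)"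
    using assms(1) by (simp add: exp_sum)
  also have "(\<Sum>t\<in>I. - a * w t - a\<^sup>2 / 2) = - a * ?W - (real d - 1) * a\<^sup>2 / 2"
    using assms by (simp add: sum_subtractf sum_distrib_left sum_negf of_nat_diff)
  also have "\<dots> = ?W\<^sup>2 / (2 * real d) + (- (real d - 1) * a\<^sup>2 / 2 - a * ?W - ?W\<^sup>2 / (2 * real d))"
    by (simp only: mult_minus_left minus_divide_left[symmetric])
  finally have "(\<Prod>t\<in>I. shift_weight a (w t)) =
      ennreal (exp (?W\<^sup>2 / (2 * real d)) * exp (- (real d - 1) * a\<^sup>2 / 2 - a * ?W - ?W\<^sup>2 / (2 * real d)))"
    unfolding exp_add .
  also have "\<dots> = ennreal (exp (?W\<^sup>2 / (2 * real d)) / sqrt (real d) *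
      (sqrt (real d) * exp (- (real d - 1) * a\<^sup>2 / 2 - a * ?W - ?W\<^sup>2 / (2 * real d))))"
    using assms(3) by simp
  finally show ?thesis
    unfolding tilt_weight_def by (subst ennreal_mult[symmetric]) auto
qed

text \<open>
  The signed distance of the hyperplane from the origin, positive on the side to which the normal
  vector points.
\<close>
definition facet_offset :: "nat \<Rightarrow> nat set \<Rightarrow> (nat \<Rightarrow> nat \<Rightarrow> real) \<Rightarrow> real" where
  "facet_offset d T X = coord_dot d (facet_normal d T X) (X (vertex T 0)) /
     sqrt (coord_dot d (facet_normal d T X) (facet_normal d T X))"

text \<open>
  Substituting \<open>x t = a + w t\<close> for the points other than the base point \<open>a\<close> turns the normal vector
  into a function of \<open>w\<close> alone. For fixed \<open>w\<close> the base point is normal with independent coordinates of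
  variance \<open>1 / d\<close>, and its component along the unit normal is centred because the conditional
  mean is a combination of the \<open>w t\<close>, which are orthogonal to the normal. The law of that component
  is thus the same for all \<open>w\<close>. The constant \<open>K\<close>, the total mass of the marginal law of \<open>w\<close>,
  is only named here; it is 1 since both sides are probability laws.
\<close>
lemma nn_integral_facet_offset_proportional:
  assumes T: "finite T" "card T = d" and d: "1 \<le> d"
  shows "\<exists>K. \<forall>\<psi>\<in>borel_measurable borel.
    (\<integral>\<^sup>+X. \<psi> (facet_offset d T X) \<partial>PiM T (\<lambda>_. std_gaussian d)) =
    K * (\<integral>\<^sup>+x. \<psi> x \<partial>density lborel (normal_density 0 (1 / sqrt (real d))))"
proof -
  let ?V = "\<lambda>_::nat. std_gaussian d"
  define v0 where "v0 = vertex T 0"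
  define r where "r i = vertex T (Suc i)" for i
  define T' where "T' = T - {v0}"
  have v0: "v0 \<in> T" using vertex_in[OF d T, of 0] d by (simp add: v0_def)
  have T_ins: "insert v0 T' = T" "v0 \<notin> T'" "finite T'" "card T' = d - 1"
    using v0 T by (auto simp: T'_def)
  have bij: "bij_betw (vertex T) {..<d} T" by (rule bij_betw_vertex[OF T])
  have r: "r i \<in> T'" if "i < d - 1" for i
  proof -
    have "Suc i < d" using that by simp
    then show ?thesis
      using vertex_in[OF d T, of "Suc i"] inj_onD[OF bij_betw_imp_inj_on[OF bij], of "Suc i" 0]
      by (auto simp: r_def T'_def v0_def)
  qed
  have r_onto: "\<exists>i<d - 1. t = r i" if "t \<in> T'" for t
  proof -
    have "t \<in> vertex T ` {..<d}" using that bij by (auto simp: T'_def bij_betw_def)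
    then obtain j where "j < d" "t = vertex T j" by auto
    then show ?thesis using that by (cases j) (auto simp: T'_def v0_def r_def intro!: exI[of _ "j - 1"])
  qed
  interpret product_prob_space ?V by (rule product_prob_spaceI) (rule prob_space_std_gaussian)
  interpret V: prob_space "std_gaussian d" by (rule prob_space_std_gaussian)
  interpret P': prob_space "PiM T' ?V" by (intro prob_space_PiM prob_space_std_gaussian)
  interpret pair_sigma_finite "std_gaussian d" "PiM T' ?V" ..
  define N where "N w = cross_normal d (\<lambda>i. w (r i))" for w :: "nat \<Rightarrow> nat \<Rightarrow> real"
  define h where "h a w = coord_dot d (N w) a / sqrt (coord_dot d (N w) (N w))" for a w
  define shift where "shift a x = (\<lambda>t\<in>T'. shift_vector d a (x t))" for a and x :: "nat \<Rightarrow> nat \<Rightarrow> real"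
  define \<kappa> where "\<kappa> w = (\<Prod>k<d. ennreal (exp ((\<Sum>t\<in>T'. w t k)\<^sup>2 / (2 * real d)) / sqrt (real d)))"
    for w :: "nat \<Rightarrow> nat \<Rightarrow> real"
  define \<rho> where "\<rho> a w = (\<Prod>t\<in>T'. \<Prod>k<d. shift_weight (a k) (w t k))"
    for a and w :: "nat \<Rightarrow> nat \<Rightarrow> real"
  have shift_meas: "shift a \<in> measurable (PiM T' ?V) (PiM T' ?V)" for a
    unfolding shift_def[abs_def]
    using measurable_compose[OF measurable_component_singleton[of _ T' ?V] shift_vector_measurable]
    by (intro measurable_restrict) simp
  have N_meas: "(\<lambda>w. N w k) \<in> borel_measurable (PiM T' ?V)" for k
    unfolding N_def using r d by (intro row_cofactor_measurable sample_coord_measurable) auto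
  have N2: "(\<lambda>p. N (snd p) k) \<in> borel_measurable (std_gaussian d \<Otimes>\<^sub>M PiM T' ?V)" for k
    by (rule measurable_compose[OF measurable_snd N_meas])
  have a2: "(\<lambda>p. fst p k) \<in> borel_measurable (std_gaussian d \<Otimes>\<^sub>M PiM T' ?V)" if "k < d" for k
    by (rule measurable_compose[OF measurable_fst coord_measurable[OF that]])
  have w2: "(\<lambda>p. snd p t k) \<in> borel_measurable (std_gaussian d \<Otimes>\<^sub>M PiM T' ?V)" if "t \<in> T'" "k < d" for t k
    by (rule measurable_compose[OF measurable_snd sample_coord_measurable[OF that]])
  have h_meas: "(\<lambda>p. h (fst p) (snd p)) \<in> borel_measurable (std_gaussian d \<Otimes>\<^sub>M PiM T' ?V)"
    unfolding h_def coord_dot_def using N2 a2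
    by (intro borel_measurable_divide borel_measurable_sqrt borel_measurable_sum borel_measurable_times) auto
  have \<rho>_meas: "(\<lambda>p. \<rho> (fst p) (snd p)) \<in> borel_measurable (std_gaussian d \<Otimes>\<^sub>M PiM T' ?V)"
    unfolding \<rho>_def shift_weight_def using a2 w2
    by (intro borel_measurable_prod_ennreal measurable_compose[OF _ measurable_ennreal] borel_measurable_exp
        measurable_compose[OF _ borel_measurable_exp]
        borel_measurable_diff borel_measurable_times borel_measurable_uminus borel_measurable_divide borel_measurable_power) auto
  have \<kappa>_meas: "\<kappa> \<in> borel_measurable (PiM T' ?V)"
    unfolding \<kappa>_def[abs_def] using sample_coord_measurable[of _ T' _ d]
    by (intro borel_measurable_prod_ennreal measurable_compose[OF _ measurable_ennreal] borel_measurable_divide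
        measurable_compose[OF _ borel_measurable_exp] borel_measurable_power borel_measurable_sum) auto

  have main: "(\<integral>\<^sup>+X. \<psi> (facet_offset d T X) \<partial>PiM T ?V) =
      (\<integral>\<^sup>+w. \<kappa> w \<partial>PiM T' ?V) * (\<integral>\<^sup>+x. \<psi> x \<partial>density lborel (normal_density 0 (1 / sqrt (real d))))"
    if \<psi>[measurable]: "\<psi> \<in> borel_measurable borel" for \<psi> :: "real \<Rightarrow> ennreal"
  proof -
    let ?J = "\<integral>\<^sup>+x. \<psi> x \<partial>density lborel (normal_density 0 (1 / sqrt (real d)))"
    have off_meas: "(\<lambda>X. \<psi> (facet_offset d T X)) \<in> borel_measurable (PiM (insert v0 T') ?V)"
      unfolding T_ins(1) facet_offset_def coord_dot_def
      using facet_normal_measurable[OF T d order_refl] sample_coord_measurable[OF v0, of _ d]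
      by (intro measurable_compose[OF _ \<psi>] borel_measurable_divide borel_measurable_sqrt
          measurable_compose[OF _ borel_measurable_sqrt] borel_measurable_sum borel_measurable_times) (auto simp: v0_def)
    have "(\<integral>\<^sup>+X. \<psi> (facet_offset d T X) \<partial>PiM T ?V) =
       (\<integral>\<^sup>+a. \<integral>\<^sup>+x. \<psi> (facet_offset d T (x(v0 := a))) \<partial>PiM T' ?V \<partial>std_gaussian d)"
      using product_nn_integral_insert_rev[OF T_ins(3,2) off_meas] unfolding T_ins(1) .
    also have "\<dots> = (\<integral>\<^sup>+a. \<integral>\<^sup>+x. \<psi> (h a (shift a x)) \<partial>PiM T' ?V \<partial>std_gaussian d)"
    proof (intro nn_integral_cong arg_cong[where f = \<psi>])
      fix a x
      have "facet_normal d T (x(v0 := a)) = N (shift a x)"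
        unfolding facet_normal_def N_def edge_vectors_def
      proof (intro ext row_cofactor_cong)
        fix i k assume "i < d" "i \<noteq> d - 1" "k < d"
        then have "r i \<in> T'" "k < d" using r[of i] by auto
        then show "(x(v0 := a)) (vertex T (Suc i)) k - (x(v0 := a)) (vertex T 0) k = shift a x (r i) k"
          using T_ins(2) by (auto simp: shift_def shift_vector_def r_def[symmetric] v0_def[symmetric])
      qed
      then show "facet_offset d T (x(v0 := a)) = h a (shift a x)"
        by (simp add: facet_offset_def h_def v0_def)
    qed
    \<comment> \<open>The substitution of the differences, by the Cameron-Martin formula for a shift by \<open>a\<close>.\<close>
    also have "\<dots> = (\<integral>\<^sup>+a. \<integral>\<^sup>+w. \<psi> (h a w) * \<rho> a w \<partial>PiM T' ?V \<partial>std_gaussian d)"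
    proof (rule nn_integral_cong)
      fix a assume a: "a \<in> space (std_gaussian d)"
      have [measurable]: "(\<lambda>w. h a w) \<in> borel_measurable (PiM T' ?V)" "(\<lambda>w. \<rho> a w) \<in> borel_measurable (PiM T' ?V)"
        using measurable_compose[OF measurable_Pair1'[OF a] h_meas] measurable_compose[OF measurable_Pair1'[OF a] \<rho>_meas]
        by simp_all
      have "(\<integral>\<^sup>+x. \<psi> (h a (shift a x)) \<partial>PiM T' ?V) = (\<integral>\<^sup>+w. \<psi> (h a w) \<partial>distr (PiM T' ?V) (PiM T' ?V) (shift a))"
        by (rule nn_integral_distr[OF shift_meas, symmetric]) measurable
      also have "\<dots> = (\<integral>\<^sup>+w. \<psi> (h a w) \<partial>density (PiM T' ?V) (\<rho> a))"
        unfolding shift_def[abs_def] \<rho>_def[abs_def] distr_shift_sample[OF T_ins(3)] ..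
      also have "\<dots> = (\<integral>\<^sup>+w. \<rho> a w * \<psi> (h a w) \<partial>PiM T' ?V)"
        by (rule nn_integral_density) measurable
      finally show "(\<integral>\<^sup>+x. \<psi> (h a (shift a x)) \<partial>PiM T' ?V) = (\<integral>\<^sup>+w. \<psi> (h a w) * \<rho> a w \<partial>PiM T' ?V)"
        by (simp add: mult.commute)
    qed
    also have "\<dots> = (\<integral>\<^sup>+w. \<integral>\<^sup>+a. \<psi> (h a w) * \<rho> a w \<partial>std_gaussian d \<partial>PiM T' ?V)"
    proof (rule Fubini'[symmetric])
      have "(\<lambda>p. \<psi> (h (fst p) (snd p)) * \<rho> (fst p) (snd p)) \<in> borel_measurable (std_gaussian d \<Otimes>\<^sub>M PiM T' ?V)"
        using measurable_compose[OF h_meas \<psi>] \<rho>_meas by (rule borel_measurable_times_ennreal)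
      then show "(\<lambda>(a, w). \<psi> (h a w) * \<rho> a w) \<in> borel_measurable (std_gaussian d \<Otimes>\<^sub>M PiM T' ?V)"
        by (simp add: case_prod_beta')
    qed
    \<comment> \<open>The inner integral over the base point, for fixed differences \<open>w\<close> that are in general position.\<close>
    also have "\<dots> = (\<integral>\<^sup>+w. \<kappa> w * ?J \<partial>PiM T' ?V)"
    proof (rule nn_integral_cong_AE)
      have "AE w in PiM T' ?V. \<exists>k<d. cross_normal d (\<lambda>i k. w (r i) k - (0::real)) k \<noteq> 0"
        using AE_cross_normal_nonzero[OF d T_ins(3), of r "\<lambda>_ _. 0"] inj_onD[OF bij_betw_imp_inj_on[OF bij], of "Suc i" "Suc j" for i j] r
        by (auto simp: r_def inj_on_def image_subset_iff)
      then show "AE w in PiM T' ?V. (\<integral>\<^sup>+a. \<psi> (h a w) * \<rho> a w \<partial>std_gaussian d) = \<kappa> w * ?J"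
      proof eventually_elim
        case (elim w)
        then have N0: "\<exists>k<d. N w k \<noteq> 0" by (simp add: N_def)
        define s where "s = sqrt (coord_dot d (N w) (N w))"
        have s: "0 < s" using coord_dot_pos[OF N0] by (simp add: s_def)
        define u where "u k = N w k / s" for k
        have u0: "\<exists>k<d. u k \<noteq> 0" using N0 s by (simp add: u_def)
        have hu: "h a w = coord_dot d u a" for a
        proof -
          have "h a w = coord_dot d (N w) a / s" by (simp add: h_def s_def)
          then show ?thesis by (simp add: u_def coord_dot_def sum_divide_distrib)
        qed
        have uu: "coord_dot d u u = 1"
        proof -
          have "coord_dot d u u = coord_dot d (N w) (N w) / s\<^sup>2"
            by (simp add: u_def coord_dot_def sum_divide_distrib power2_eq_square)
          also have "\<dots> = 1" using coord_dot_pos[OF N0] by (simp add: s_def)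
          finally show ?thesis .
        qed
        \<comment> \<open>The conditional mean of the base point is \<open>- W / d\<close>.\<close>
        define W where "W k = (\<Sum>t\<in>T'. w t k)" for k
        have orth: "coord_dot d u (\<lambda>k. - W k / real d) = 0"
        proof -
          have "coord_dot d (N w) (w t) = 0" if t: "t \<in> T'" for t
          proof -
            obtain i where "i < d - 1" "t = r i" using r_onto[OF t] by blast
            then show ?thesis unfolding N_def using coord_dot_cross_normal_row[of i d "\<lambda>i. w (r i)"] by simp
          qed
          then have "(\<Sum>t\<in>T'. coord_dot d (N w) (w t)) = 0" by simp
          then have "(\<Sum>k<d. N w k * W k) = 0"
            unfolding coord_dot_def W_def sum_distrib_left by (subst sum.swap) simp
          moreover have "coord_dot d u (\<lambda>k. - W k / real d) = - (\<Sum>k<d. N w k * W k) / (s * real d)"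
            by (simp add: coord_dot_def u_def sum_divide_distrib sum_negf)
          ultimately show ?thesis by simp
        qed
        have \<rho>_eq: "\<rho> a w = \<kappa> w * (\<Prod>k<d. tilt_weight d (W k) (a k))" for a
        proof -
          have "\<rho> a w = (\<Prod>k<d. \<Prod>t\<in>T'. shift_weight (a k) (w t k))" unfolding \<rho>_def by (rule prod.swap)
          then show ?thesis
            unfolding \<kappa>_def W_def by (simp only: prod_shift_weight[OF T_ins(3,4) d] prod.distrib)
        qed
        have tm: "(\<lambda>a. \<Prod>k<d. tilt_weight d (W k) (a k)) \<in> borel_measurable (std_gaussian d)"
          by (intro borel_measurable_prod_ennreal measurable_compose[OF coord_measurable tilt_weight_measurable]) simp
        have um: "coord_dot d u \<in> borel_measurable (\<Pi>\<^sub>M k\<in>{..<d}. density lborel (normal_density (- W k / real d) (1 / sqrt (real d))))"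
          unfolding PiM_tilt_weight[OF d, symmetric] by (simp add: coord_dot_measurable)
        have "(\<integral>\<^sup>+a. \<psi> (h a w) * \<rho> a w \<partial>std_gaussian d) =
           (\<integral>\<^sup>+a. \<kappa> w * ((\<Prod>k<d. tilt_weight d (W k) (a k)) * \<psi> (coord_dot d u a)) \<partial>std_gaussian d)"
          unfolding hu \<rho>_eq by (simp add: mult_ac)
        also have "\<dots> = \<kappa> w * (\<integral>\<^sup>+a. (\<Prod>k<d. tilt_weight d (W k) (a k)) * \<psi> (coord_dot d u a) \<partial>std_gaussian d)"
          using tm by (intro nn_integral_cmult) measurable
        also have "(\<integral>\<^sup>+a. (\<Prod>k<d. tilt_weight d (W k) (a k)) * \<psi> (coord_dot d u a) \<partial>std_gaussian d) =
            (\<integral>\<^sup>+a. \<psi> (coord_dot d u a) \<partial>density (std_gaussian d) (\<lambda>a. \<Prod>k<d. tilt_weight d (W k) (a k)))"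
          using tm by (intro nn_integral_density[symmetric]) measurable
        also have "\<dots> = (\<integral>\<^sup>+x. \<psi> x \<partial>distr (\<Pi>\<^sub>M k\<in>{..<d}. density lborel (normal_density (- W k / real d) (1 / sqrt (real d)))) borel (coord_dot d u))"
          unfolding PiM_tilt_weight[OF d] using \<psi> by (intro nn_integral_distr[symmetric] um) simp
        also have "distr (\<Pi>\<^sub>M k\<in>{..<d}. density lborel (normal_density (- W k / real d) (1 / sqrt (real d)))) borel (coord_dot d u) =
            density lborel (normal_density 0 (1 / sqrt (real d)))"
          using distr_coord_dot_normal[OF u0, of "1 / sqrt (real d)" "\<lambda>k. - W k / real d"] d unfolding orth uu by simp
        finally show ?case .
      qed
    qed
    also have "\<dots> = (\<integral>\<^sup>+w. \<kappa> w \<partial>PiM T' ?V) * ?J"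
      by (rule nn_integral_multc[OF \<kappa>_meas])
    finally show ?thesis .
  qed
  then show ?thesis by blast
qed

lemma nn_integral_facet_offset:
  assumes T: "finite T" "card T = d" and d: "1 \<le> d" and \<psi>: "\<psi> \<in> borel_measurable borel"
  shows "(\<integral>\<^sup>+X. \<psi> (facet_offset d T X) \<partial>PiM T (\<lambda>_. std_gaussian d)) =
    (\<integral>\<^sup>+x. \<psi> x \<partial>density lborel (normal_density 0 (1 / sqrt (real d))))"
proof -
  obtain K where K: "\<And>\<psi>. \<psi> \<in> borel_measurable borel \<Longrightarrow>
    (\<integral>\<^sup>+X. \<psi> (facet_offset d T X) \<partial>PiM T (\<lambda>_. std_gaussian d)) =
    K * (\<integral>\<^sup>+x. \<psi> x \<partial>density lborel (normal_density 0 (1 / sqrt (real d))))"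
    using nn_integral_facet_offset_proportional[OF T d] by blast
  interpret P: prob_space "PiM T (\<lambda>_. std_gaussian d)" by (intro prob_space_PiM prob_space_std_gaussian)
  interpret Q: prob_space "density lborel (normal_density 0 (1 / sqrt (real d)))"
    using d by (intro prob_space_normal_density) simp
  have "K = 1" using K[of "\<lambda>_. 1"] P.emeasure_space_1 Q.emeasure_space_1 by simp
  then show ?thesis using K[OF \<psi>] by simp
qed

section \<open>The expected number of facets\<close>

definition facet_event :: "nat \<Rightarrow> nat \<Rightarrow> nat set \<Rightarrow> (nat \<Rightarrow> nat \<Rightarrow> real) \<Rightarrow> bool" where
  "facet_event d n T X \<longleftrightarrow> (\<forall>j\<in>{..<n} - T. 0 < facet_height d T X (X j)) \<or>
     (\<forall>j\<in>{..<n} - T. facet_height d T X (X j) < 0)"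

lemma facet_event_measurable:
  assumes "T \<subseteq> {..<n}" "card T = d" "1 \<le> d"
  shows "{X \<in> space (gaussian_sample n d). facet_event d n T X} \<in> sets (gaussian_sample n d)"
proof -
  have "finite T" using assms(1) by (rule finite_subset) simp
  have "Measurable.pred (PiM {..<n} (\<lambda>_. std_gaussian d)) (\<lambda>X. 0 < facet_height d T X (X j))"
    "Measurable.pred (PiM {..<n} (\<lambda>_. std_gaussian d)) (\<lambda>X. facet_height d T X (X j) < 0)" if "j < n" for j
  proof -
    have [measurable]: "(\<lambda>X. facet_height d T X (X j)) \<in> borel_measurable (PiM {..<n} (\<lambda>_. std_gaussian d))"
      using facet_height_measurable[OF \<open>finite T\<close> assms(2,3,1)] that by simp
    show "Measurable.pred (PiM {..<n} (\<lambda>_. std_gaussian d)) (\<lambda>X. 0 < facet_height d T X (X j))"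
      "Measurable.pred (PiM {..<n} (\<lambda>_. std_gaussian d)) (\<lambda>X. facet_height d T X (X j) < 0)"
      by measurable
  qed
  then show ?thesis
    unfolding facet_event_def gaussian_sample_def
    by (intro sets.sets_Collect_disj sets.sets_Collect_finite_All) (auto simp: pred_def)
qed

lemma emeasure_half_space:
  assumes N: "\<exists>k<d. N k \<noteq> 0"
  defines "s \<equiv> sqrt (coord_dot d N N)"
  shows "emeasure (std_gaussian d) {y \<in> space (std_gaussian d). c < coord_dot d N y} = ennreal (normal_tail (c / s))"
    and "emeasure (std_gaussian d) {y \<in> space (std_gaussian d). coord_dot d N y < c} = ennreal (1 - normal_tail (c / s))"
proof -
  interpret S: prob_space std_normal_distribution by (rule prob_space_std_normal)
  have s: "0 < s" using coord_dot_pos[OF N] by (simp add: s_def)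
  define u where "u k = N k / s" for k
  have u0: "\<exists>k<d. u k \<noteq> 0" using N s by (simp add: u_def)
  have "coord_dot d u u = coord_dot d N N / s\<^sup>2"
    by (simp add: u_def coord_dot_def sum_divide_distrib power2_eq_square)
  also have "\<dots> = 1" using coord_dot_pos[OF N] by (simp add: s_def)
  finally have uu: "coord_dot d u u = 1" .
  have du: "coord_dot d u y = coord_dot d N y / s" for y
    by (simp add: u_def coord_dot_def sum_divide_distrib)
  have iff: "c / s < coord_dot d u y \<longleftrightarrow> c < coord_dot d N y" "coord_dot d u y < c / s \<longleftrightarrow> coord_dot d N y < c" for y
    using s by (auto simp: du divide_less_cancel)
  have law: "distr (std_gaussian d) borel (coord_dot d u) = std_normal_distribution"
    using distr_coord_dot_std_gaussian[OF u0] uu by simp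
  have "emeasure (std_gaussian d) {y \<in> space (std_gaussian d). c < coord_dot d N y} =
      emeasure (distr (std_gaussian d) borel (coord_dot d u)) {c / s<..}"
    by (subst emeasure_distr) (auto simp: iff intro!: arg_cong[where f = "emeasure _"])
  then show "emeasure (std_gaussian d) {y \<in> space (std_gaussian d). c < coord_dot d N y} = ennreal (normal_tail (c / s))"
    by (simp add: law S.emeasure_eq_measure normal_tail_def)
  have "emeasure (std_gaussian d) {y \<in> space (std_gaussian d). coord_dot d N y < c} =
      emeasure (distr (std_gaussian d) borel (coord_dot d u)) {..<c / s}"
    by (subst emeasure_distr) (auto simp: iff intro!: arg_cong[where f = "emeasure _"])
  then show "emeasure (std_gaussian d) {y \<in> space (std_gaussian d). coord_dot d N y < c} = ennreal (1 - normal_tail (c / s))"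
    by (simp add: law S.emeasure_eq_measure normal_tail_uminus normal_tail_symmetric)
qed

text \<open>
  Given the points indexed by \<open>T\<close>, the others are independent and fall above the hyperplane with
  probability \<open>normal_tail\<close> of its offset. The events of all being above and of all being below are
  disjoint because \<open>d < n\<close> leaves at least one other point.
\<close>
lemma emeasure_facet_event:
  assumes T: "T \<subseteq> {..<n}" "card T = d" and d: "1 \<le> d" "d < n"
  shows "emeasure (gaussian_sample n d) {X \<in> space (gaussian_sample n d). facet_event d n T X} =
    (\<integral>\<^sup>+x. ennreal (normal_tail x ^ (n - d) + (1 - normal_tail x) ^ (n - d)) \<partial>density lborel (normal_density 0 (1 / sqrt (real d))))"
proof -
  let ?V = "\<lambda>_::nat. std_gaussian d"
  let ?\<psi> = "\<lambda>x. ennreal (normal_tail x ^ (n - d) + (1 - normal_tail x) ^ (n - d))"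
  define J where "J = {..<n} - T"
  have fin: "finite T" "finite J" using T(1) by (auto simp: J_def intro: finite_subset)
  have TJ: "T \<inter> J = {}" "T \<union> J = {..<n}" using T(1) by (auto simp: J_def)
  have cardJ: "card J = n - d" using T fin by (simp add: J_def card_Diff_subset)
  then have "J \<noteq> {}" using d by auto
  then obtain j0 where j0: "j0 \<in> J" by blast
  interpret product_prob_space ?V by (rule product_prob_spaceI) (rule prob_space_std_gaussian)
  define E where "E = {X \<in> space (gaussian_sample n d). facet_event d n T X}"
  have E: "E \<in> sets (PiM (T \<union> J) ?V)"
    using facet_event_measurable[OF T d(1)] by (simp add: E_def TJ gaussian_sample_def)
  have "emeasure (gaussian_sample n d) E = (\<integral>\<^sup>+X. indicator E X \<partial>PiM (T \<union> J) ?V)"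
    using E by (simp add: gaussian_sample_def TJ)
  also have "\<dots> = (\<integral>\<^sup>+x. \<integral>\<^sup>+z. indicator E (merge T J (x, z)) \<partial>PiM J ?V \<partial>PiM T ?V)"
    using E by (intro product_nn_integral_fold TJ fin) simp
  also have "\<dots> = (\<integral>\<^sup>+x. ?\<psi> (facet_offset d T x) \<partial>PiM T ?V)"
  proof (rule nn_integral_cong_AE)
    show "AE x in PiM T ?V. (\<integral>\<^sup>+z. indicator E (merge T J (x, z)) \<partial>PiM J ?V) = ?\<psi> (facet_offset d T x)"
      using AE_nondegenerate[OF fin(1) T(2) d(1) order_refl fin(1)] AE_space
    proof eventually_elim
      case (elim x)
      define N where "N = facet_normal d T x"
      define c where "c = coord_dot d N (x (vertex T 0))"
      have N: "\<exists>k<d. N k \<noteq> 0" using elim(1) by (simp add: nondegenerate_def N_def)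
      define A where "A = {y \<in> space (std_gaussian d). c < coord_dot d N y}"
      define B where "B = {y \<in> space (std_gaussian d). coord_dot d N y < c}"
      have AB: "A \<in> sets (std_gaussian d)" "B \<in> sets (std_gaussian d)"
        unfolding A_def B_def by measurable
      have height: "facet_height d T (merge T J (x, z)) (merge T J (x, z) j) = coord_dot d N (z j) - c"
        if "j \<in> J" for z j
        unfolding c_def N_def facet_height_eq[symmetric] using that TJ
        by (intro facet_height_cong fin T d) (auto simp: merge_def)
      have ind: "indicator E (merge T J (x, z)) = (indicator (Pi\<^sub>E J (\<lambda>_. A)) z + indicator (Pi\<^sub>E J (\<lambda>_. B)) z :: ennreal)"
        if z: "z \<in> space (PiM J ?V)" for z
      proof -
        have "(x, z) \<in> space (PiM T ?V \<Otimes>\<^sub>M PiM J ?V)" using elim(2) z by (simp add: space_pair_measure)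
        then have "merge T J (x, z) \<in> space (PiM (T \<union> J) ?V)"
          using measurable_space[OF measurable_merge] by blast
        then have "merge T J (x, z) \<in> E \<longleftrightarrow> facet_event d n T (merge T J (x, z))"
          by (simp add: E_def gaussian_sample_def TJ)
        also have "\<dots> \<longleftrightarrow> (\<forall>j\<in>J. c < coord_dot d N (z j)) \<or> (\<forall>j\<in>J. coord_dot d N (z j) < c)"
          unfolding facet_event_def J_def[symmetric] using height by simp
        also have "\<dots> \<longleftrightarrow> z \<in> Pi\<^sub>E J (\<lambda>_. A) \<or> z \<in> Pi\<^sub>E J (\<lambda>_. B)"
          using z by (auto simp: A_def B_def space_PiM PiE_iff)
        finally have "merge T J (x, z) \<in> E \<longleftrightarrow> z \<in> Pi\<^sub>E J (\<lambda>_. A) \<or> z \<in> Pi\<^sub>E J (\<lambda>_. B)" .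
        moreover have "\<not> (z \<in> Pi\<^sub>E J (\<lambda>_. A) \<and> z \<in> Pi\<^sub>E J (\<lambda>_. B))"
          using j0 by (force simp: A_def B_def PiE_iff)
        ultimately show ?thesis by (auto simp: indicator_def)
      qed
      have off: "facet_offset d T x = c / sqrt (coord_dot d N N)"
        by (simp add: facet_offset_def c_def N_def)
      have "(\<integral>\<^sup>+z. indicator E (merge T J (x, z)) \<partial>PiM J ?V) =
          (\<integral>\<^sup>+z. (indicator (Pi\<^sub>E J (\<lambda>_. A)) z + indicator (Pi\<^sub>E J (\<lambda>_. B)) z) \<partial>PiM J ?V)"
        by (intro nn_integral_cong ind)
      also have "\<dots> = emeasure (PiM J ?V) (Pi\<^sub>E J (\<lambda>_. A)) + emeasure (PiM J ?V) (Pi\<^sub>E J (\<lambda>_. B))"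
        using AB fin(2) by (subst nn_integral_add) (auto intro!: sets_PiM_I_finite)
      also have "\<dots> = emeasure (std_gaussian d) A ^ (n - d) + emeasure (std_gaussian d) B ^ (n - d)"
        using AB fin(2) by (simp add: emeasure_PiM cardJ)
      also have "\<dots> = ?\<psi> (facet_offset d T x)"
        unfolding A_def B_def emeasure_half_space[OF N] off
        using normal_tail_pos[of "c / sqrt (coord_dot d N N)"] normal_tail_less_1[of "c / sqrt (coord_dot d N N)"]
        by (simp add: ennreal_power ennreal_plus less_imp_le)
      finally show ?case .
    qed
  qed
  also have "\<dots> = (\<integral>\<^sup>+x. ?\<psi> x \<partial>density lborel (normal_density 0 (1 / sqrt (real d))))"
    by (rule nn_integral_facet_offset[OF fin(1) T(2) d(1)]) measurable
  finally show ?thesis unfolding E_def .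
qed

lemma facet_index_set_to_euclidean:
  assumes "1 \<le> d"
  shows "facet_index_set d n (\<lambda>i. to_euclidean d (X i)) S \<longleftrightarrow> facet_index_set d n X S"
proof -
  have h: "facet_height d T (\<lambda>i. to_euclidean d (X i)) (to_euclidean d (X j)) = facet_height d T X (X j)"
    and N: "facet_normal d T (\<lambda>i. to_euclidean d (X i)) = facet_normal d T X"
    if T: "card T = d" for T j
  proof -
    have "finite T" using T assms by (intro card_ge_0_finite) simp
    then show "facet_height d T (\<lambda>i. to_euclidean d (X i)) (to_euclidean d (X j)) = facet_height d T X (X j)"
      "facet_normal d T (\<lambda>i. to_euclidean d (X i)) = facet_normal d T X"
      using assms T by (auto intro!: facet_height_cong facet_normal_cong simp: to_euclidean_def)
  qed
  show ?thesis
    unfolding facet_index_set_def nondegenerate_def by (auto simp: h N cong: conj_cong)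
qed

lemma num_facets_gaussian_polytope:
  assumes "1 \<le> d"
  shows "num_faces (d - 1) (gaussian_polytope n d X) = card {S. facet_index_set d n X S}"
proof -
  have "num_faces (d - 1) (gaussian_polytope n d X) = card {S. facet_index_set d n (\<lambda>i. to_euclidean d (X i)) S}"
    unfolding gaussian_polytope_def
    by (rule num_facets_eq_card_index_sets[OF assms]) (simp add: to_euclidean_def)
  then show ?thesis unfolding facet_index_set_to_euclidean[OF assms] .
qed

lemma facet_index_set_measurable:
  assumes d: "1 \<le> d" and S: "S \<subseteq> {..<n}"
  shows "{X \<in> space (gaussian_sample n d). facet_index_set d n X S} \<in> sets (gaussian_sample n d)"
proof -
  let ?M = "PiM {..<n} (\<lambda>_. std_gaussian d)"
  have S_eq: "S = {j. j < n \<and> P j} \<longleftrightarrow> (\<forall>j\<in>{..<n}. j \<in> S \<longleftrightarrow> P j)" for P using S by auto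
  have "facet_index_set d n X S \<longleftrightarrow> (\<exists>T\<in>{T. T \<subseteq> S \<and> card T = d}. (\<exists>k\<in>{..<d}. facet_normal d T X k \<noteq> 0) \<and>
     ((\<forall>j\<in>{..<n}. 0 \<le> facet_height d T X (X j)) \<or> (\<forall>j\<in>{..<n}. facet_height d T X (X j) \<le> 0)) \<and>
     (\<forall>j\<in>{..<n}. j \<in> S \<longleftrightarrow> facet_height d T X (X j) = 0))" for X
    unfolding facet_index_set_def nondegenerate_def S_eq by auto
  moreover have "Measurable.pred ?M (\<lambda>X. \<exists>T\<in>{T. T \<subseteq> S \<and> card T = d}. (\<exists>k\<in>{..<d}. facet_normal d T X k \<noteq> 0) \<and>
     ((\<forall>j\<in>{..<n}. 0 \<le> facet_height d T X (X j)) \<or> (\<forall>j\<in>{..<n}. facet_height d T X (X j) \<le> 0)) \<and>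
     (\<forall>j\<in>{..<n}. j \<in> S \<longleftrightarrow> facet_height d T X (X j) = 0))"
  proof (rule pred_intros_finite)
    show "finite {T. T \<subseteq> S \<and> card T = d}"
      using finite_subset[OF S] by simp
    fix T assume "T \<in> {T. T \<subseteq> S \<and> card T = d}"
    then have T: "T \<subseteq> {..<n}" "card T = d" using S by auto
    have fin: "finite T" using T(1) by (rule finite_subset) simp
    have [measurable]: "(\<lambda>X. facet_normal d T X k) \<in> borel_measurable ?M" for k
      by (rule facet_normal_measurable[OF fin T(2) d T(1)])
    have [measurable]: "(\<lambda>X. facet_height d T X (X j)) \<in> borel_measurable ?M" if "j \<in> {..<n}" for j
      by (rule facet_height_measurable[OF fin T(2) d T(1) that])
    show "Measurable.pred ?M (\<lambda>X. (\<exists>k\<in>{..<d}. facet_normal d T X k \<noteq> 0) \<and>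
     ((\<forall>j\<in>{..<n}. 0 \<le> facet_height d T X (X j)) \<or> (\<forall>j\<in>{..<n}. facet_height d T X (X j) \<le> 0)) \<and>
     (\<forall>j\<in>{..<n}. j \<in> S \<longleftrightarrow> facet_height d T X (X j) = 0))"
      by measurable
  qed
  ultimately show ?thesis by (simp add: gaussian_sample_def pred_def)
qed

text \<open>
  The index sets of facets are almost surely the \<open>d\<close>-element sets \<open>T\<close> with \<open>facet_event d n T\<close>, and all
  of these events have the same probability.
\<close>
theorem expected_facets_integral:
  assumes d: "1 \<le> d" "d < n"
  shows "expected_facets n d = real (n choose d) *
    (\<integral>x. normal_tail x ^ (n - d) + (1 - normal_tail x) ^ (n - d) \<partial>density lborel (normal_density 0 (1 / sqrt (real d))))"
proof -
  let ?M = "gaussian_sample n d"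
  let ?Q = "density lborel (\<lambda>x. ennreal (normal_density 0 (1 / sqrt (real d)) x))"
  let ?\<psi> = "\<lambda>x. normal_tail x ^ (n - d) + (1 - normal_tail x) ^ (n - d)"
  interpret M: prob_space ?M by (rule prob_space_gaussian_sample)
  interpret Q: prob_space ?Q using d by (intro prob_space_normal_density) simp
  define \<T> where "\<T> = {T. T \<subseteq> {..<n} \<and> card T = d}"
  have fin\<T>: "finite \<T>" "card \<T> = n choose d"
    unfolding \<T>_def using n_subsets[of "{..<n}" d] by auto
  define E where "E T = {X \<in> space ?M. facet_event d n T X}" for T
  have E: "E T \<in> sets ?M" if "T \<in> \<T>" for T
    unfolding E_def using facet_event_measurable[of T n d] that d by (auto simp: \<T>_def)
  define F where "F S = {X \<in> space ?M. facet_index_set d n X S}" for S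
  have F: "F S \<in> sets ?M" if "S \<in> Pow {..<n}" for S
    unfolding F_def using facet_index_set_measurable[OF d(1)] that by auto
  have sum_F: "real (num_faces (d - 1) (gaussian_polytope n d X)) = (\<Sum>S\<in>Pow {..<n}. indicator (F S) X)"
    if "X \<in> space ?M" for X
  proof -
    have "{S. facet_index_set d n X S} = {S \<in> Pow {..<n}. facet_index_set d n X S}"
      by (auto simp: facet_index_set_def)
    then show ?thesis
      unfolding num_facets_gaussian_polytope[OF d(1)] using that
      by (simp add: F_def indicator_def sum.If_cases Int_def)
  qed
  have "AE X in ?M. (\<forall>T\<in>\<T>. nondegenerate d T X) \<and> (\<forall>T\<in>\<T>. \<forall>j\<in>{..<n} - T. facet_height d T X (X j) \<noteq> 0)"
  proof (intro AE_conjI AE_finite_allI fin\<T>(1))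
    fix T assume "T \<in> \<T>"
    then have T: "finite T" "card T = d" "T \<subseteq> {..<n}" by (auto simp: \<T>_def intro: finite_subset)
    show "AE X in ?M. nondegenerate d T X"
      unfolding gaussian_sample_def using T d by (intro AE_nondegenerate) auto
    show "AE X in ?M. facet_height d T X (X j) \<noteq> 0" if "j \<in> {..<n} - T" for j
      unfolding gaussian_sample_def using T d that by (intro AE_facet_height_nonzero) auto
  qed auto
  then have ae: "AE X in ?M. (\<Sum>S\<in>Pow {..<n}. indicator (F S) X) = (\<Sum>T\<in>\<T>. indicator (E T) X :: real)"
    using AE_space
  proof eventually_elim
    case (elim X)
    have "{S. facet_index_set d n X S} = {T \<in> \<T>. facet_event d n T X}"
      using facet_index_set_general_position[of n d X, OF _ _ d(1)] elim(1)
      by (auto simp: \<T>_def facet_event_def)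
    then have "real (card {S. facet_index_set d n X S}) = (\<Sum>T\<in>\<T>. indicator (E T) X)"
      using elim(2) fin\<T>(1) by (simp add: E_def indicator_def sum.If_cases Int_def)
    then show ?case using sum_F[OF elim(2)] unfolding num_facets_gaussian_polytope[OF d(1)] by simp
  qed
  have \<psi>_bound: "0 \<le> ?\<psi> x" "\<bar>?\<psi> x\<bar> \<le> 2" for x
  proof -
    have "0 \<le> normal_tail x" "normal_tail x \<le> 1" using normal_tail_pos[of x] normal_tail_less_1[of x] by auto
    then have "0 \<le> normal_tail x ^ (n - d)" "normal_tail x ^ (n - d) \<le> 1"
      "0 \<le> (1 - normal_tail x) ^ (n - d)" "(1 - normal_tail x) ^ (n - d) \<le> 1" by (auto intro: power_le_one)
    then show "0 \<le> ?\<psi> x" "\<bar>?\<psi> x\<bar> \<le> 2" by auto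
  qed
  have measE: "measure ?M (E T) = (\<integral>x. ?\<psi> x \<partial>?Q)" if "T \<in> \<T>" for T
  proof -
    have "integrable ?Q ?\<psi>" by (rule Q.integrable_const_bound[where B = 2]) (use \<psi>_bound in auto)
    then have "(\<integral>\<^sup>+x. ennreal (?\<psi> x) \<partial>?Q) = ennreal (\<integral>x. ?\<psi> x \<partial>?Q)"
      using \<psi>_bound by (intro nn_integral_eq_integral) auto
    then have "emeasure ?M (E T) = ennreal (\<integral>x. ?\<psi> x \<partial>?Q)"
      using emeasure_facet_event[of T n d] that d unfolding E_def by (auto simp: \<T>_def)
    moreover have "0 \<le> (\<integral>x. ?\<psi> x \<partial>?Q)" using \<psi>_bound by (intro integral_nonneg_AE) auto
    ultimately show ?thesis by (simp add: measure_def)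
  qed
  have "expected_facets n d = (\<integral>X. (\<Sum>S\<in>Pow {..<n}. indicator (F S) X) \<partial>?M)"
    unfolding expected_facets_def by (intro Bochner_Integration.integral_cong refl sum_F)
  also have "\<dots> = (\<integral>X. (\<Sum>T\<in>\<T>. indicator (E T) X) \<partial>?M)"
    using F E by (intro integral_cong_AE ae borel_measurable_sum borel_measurable_indicator) auto
  also have "\<dots> = (\<Sum>T\<in>\<T>. measure ?M (E T))"
    using E by (subst Bochner_Integration.integral_sum) (auto simp: M.emeasure_eq_measure less_top[symmetric])
  also have "\<dots> = real (n choose d) * (\<integral>x. ?\<psi> x \<partial>?Q)"
    by (simp add: measE fin\<T>(2))
  finally show ?thesis .
qed

section \<open>The asymptotic formula\<close>

text \<open>
  The density on the left is a multiple of \<open>\<phi>\<^sup>d\<close>, which is \<open>\<phi> * (normal_tail * normal_hazard)\<^sup>d\<^sup>-\<^sup>1\<close>. The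
  factor \<open>L\<close> is free and serves to normalise the hazard rate.
\<close>
lemma normal_density_eq_hazard_power:
  assumes d: "1 \<le> d" and L: "0 < L"
  shows "normal_density 0 (1 / sqrt (real d)) x =
    sqrt (real d) * (4 * pi * L) powr ((real d - 1) / 2) *
    (std_normal_density x * (normal_tail x ^ (d - 1) * ((normal_hazard x)\<^sup>2 / 2 / L) powr ((real d - 1) / 2)))"
proof -
  define m where "m = (real d - 1) / 2"
  define l where "l = normal_hazard x"
  have l: "0 < l" by (simp add: l_def normal_hazard_pos)
  have "(4 * pi * L) powr m * (l\<^sup>2 / 2 / L) powr m = (4 * pi * L * (l\<^sup>2 / 2 / L)) powr m"
    using L l by (subst powr_mult) auto
  also have "4 * pi * L * (l\<^sup>2 / 2 / L) = 2 * pi * l\<^sup>2" using L by simp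
  also have "(2 * pi * l\<^sup>2) powr m = (2 * pi) powr m * (l\<^sup>2) powr m" using l by (subst powr_mult) auto
  also have "(l\<^sup>2) powr m = l ^ (d - 1)"
  proof -
    have "(l\<^sup>2) powr m = l powr (2 * m)" using l by (simp add: powr_powr flip: powr_numeral)
    also have "2 * m = real (d - 1)" using d by (simp add: m_def of_nat_diff)
    finally show ?thesis using l by (simp only: powr_realpow)
  qed
  finally have 1: "(4 * pi * L) powr m * (l\<^sup>2 / 2 / L) powr m = (2 * pi) powr m * l ^ (d - 1)" .
  have "std_normal_density x * (normal_tail x ^ (d - 1) * l ^ (d - 1)) = std_normal_density x ^ Suc (d - 1)"
    using normal_tail_pos[of x] by (simp add: l_def normal_hazard_def flip: power_mult_distrib)
  also have "\<dots> = std_normal_density x ^ d" using d by simp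
  also have "\<dots> = (2 * pi) powr (- real d / 2) * exp (- real d * x\<^sup>2 / 2)"
  proof -
    have "std_normal_density x = (2 * pi) powr (- 1 / 2) * exp (- x\<^sup>2 / 2)"
      by (simp add: std_normal_density_def powr_minus_divide powr_half_sqrt)
    then show ?thesis
      by (simp add: power_mult_distrib powr_power mult.commute flip: exp_of_nat_mult)
  qed
  finally have 2: "(2 * pi) powr m * (std_normal_density x * (normal_tail x ^ (d - 1) * l ^ (d - 1))) =
      (2 * pi) powr (m + - real d / 2) * exp (- real d * x\<^sup>2 / 2)"
    by (simp only: powr_add mult.assoc)
  have "m + - real d / 2 = - 1 / 2" by (simp add: m_def field_simps)
  then have 3: "(2 * pi) powr (m + - real d / 2) = 1 / sqrt (2 * pi)"
    by (simp add: powr_minus_divide powr_half_sqrt)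
  have "normal_density 0 (1 / sqrt (real d)) x = sqrt (real d) * (1 / sqrt (2 * pi) * exp (- real d * x\<^sup>2 / 2))"
    using d by (simp add: normal_density_def power_divide real_sqrt_divide mult.commute)
  also have "\<dots> = sqrt (real d) * ((2 * pi) powr m * (std_normal_density x * (normal_tail x ^ (d - 1) * l ^ (d - 1))))"
    unfolding 2 3 ..
  also have "\<dots> = sqrt (real d) * (((4 * pi * L) powr m * (l\<^sup>2 / 2 / L) powr m) * (std_normal_density x * normal_tail x ^ (d - 1)))"
    unfolding 1 by (simp add: mult_ac)
  finally show ?thesis by (simp add: m_def l_def mult_ac)
qed

lemma integral_even_tail_power:
  assumes "0 < \<sigma>"
  shows "(\<integral>x. normal_tail x ^ k + (1 - normal_tail x) ^ k \<partial>density lborel (normal_density 0 \<sigma>)) =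
    2 * (\<integral>x. (1 - normal_tail x) ^ k * normal_density 0 \<sigma> x \<partial>lborel)"
proof -
  let ?q = "normal_density 0 \<sigma>"
  interpret Q: prob_space "density lborel ?q" using assms by (rule prob_space_normal_density)
  have int: "integrable (density lborel ?q) (\<lambda>x. normal_tail x ^ k)" "integrable (density lborel ?q) (\<lambda>x. (1 - normal_tail x) ^ k)"
    using normal_tail_pos normal_tail_less_1
    by (auto intro!: Q.integrable_const_bound[where B = 1] AE_I2 power_le_one simp: less_imp_le)
  have "(\<integral>x. normal_tail x ^ k \<partial>density lborel ?q) = (\<integral>x. ?q x * normal_tail x ^ k \<partial>lborel)"
    by (subst integral_density) auto
  also have "\<dots> = \<bar>-1\<bar> *\<^sub>R (\<integral>x. ?q (0 + -1 * x) * normal_tail (0 + -1 * x) ^ k \<partial>lborel)"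
    by (rule lborel_integral_real_affine) simp
  also have "\<dots> = (\<integral>x. (1 - normal_tail x) ^ k * ?q x \<partial>lborel)"
    by (simp add: normal_tail_symmetric normal_density_def mult.commute)
  finally have 1: "(\<integral>x. normal_tail x ^ k \<partial>density lborel ?q) = (\<integral>x. (1 - normal_tail x) ^ k * ?q x \<partial>lborel)" .
  have "(\<integral>x. (1 - normal_tail x) ^ k \<partial>density lborel ?q) = (\<integral>x. (1 - normal_tail x) ^ k * ?q x \<partial>lborel)"
    by (subst integral_density) (auto simp: mult.commute)
  then show ?thesis using 1 int by simp
qed

text \<open>
  The binomial coefficient cancels against the Beta integral, as \<open>(n choose d) * B = 1 / d\<close>.
\<close>
lemma expected_facets_eq_hazard_moment:
  fixes d n :: nat
  assumes d: "1 \<le> d" "d < n" and L: "0 < L"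
  defines "m \<equiv> (real d - 1) / 2"
  defines "B \<equiv> \<integral>y. cdf_weight (n - d) (d - 1) y \<partial>std_normal_distribution"
  defines "Z \<equiv> \<integral>y. cdf_weight (n - d) (d - 1) y * ((normal_hazard y)\<^sup>2 / 2 / L) powr m \<partial>std_normal_distribution"
  shows "expected_facets n d = 2 ^ d * pi powr m * real d powr (- (1 / 2)) * L powr m * (Z / B)"
proof -
  have "expected_facets n d = real (n choose d) * (2 * (\<integral>x. (1 - normal_tail x) ^ (n - d) * normal_density 0 (1 / sqrt (real d)) x \<partial>lborel))"
    using d by (simp add: expected_facets_integral integral_even_tail_power)
  also have "(\<integral>x. (1 - normal_tail x) ^ (n - d) * normal_density 0 (1 / sqrt (real d)) x \<partial>lborel) =
      (\<integral>x. sqrt (real d) * (4 * pi * L) powr m * (std_normal_density x *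
         (cdf_weight (n - d) (d - 1) x * ((normal_hazard x)\<^sup>2 / 2 / L) powr m)) \<partial>lborel)"
    unfolding normal_density_eq_hazard_power[OF d(1) L] m_def by (simp add: mult_ac)
  also have "\<dots> = sqrt (real d) * (4 * pi * L) powr m * Z"
    unfolding Z_def by (subst integral_density) auto
  finally have E: "expected_facets n d = real (n choose d) * (2 * (sqrt (real d) * (4 * pi * L) powr m * Z))" .
  have "real (n choose d) * B = 1 / real d"
  proof -
    have "n - d + (d - 1) + 1 = n" using d by linarith
    moreover have "real d * fact (d - 1) = fact d" using d by (simp add: fact_reduce)
    ultimately show ?thesis
      unfolding B_def cdf_weight_integral using d by (simp add: binomial_fact field_simps)
  qed
  moreover have B0: "0 < B" unfolding B_def cdf_weight_integral by simp
  ultimately have C: "real (n choose d) = 1 / (real d * B)" using d by (simp add: field_simps)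
  have four: "(4 * pi * L) powr m = (4 powr m) * (pi powr m * L powr m)"
    using L by (simp add: powr_mult)
  have "2 * 4 powr m = (2::real) powr (1 + 2 * m)"
    using powr_powr[of 2 2 m] by (simp add: powr_add)
  also have "1 + 2 * m = real d" by (simp add: m_def field_simps)
  also have "2 powr real d = 2 ^ d" by (simp add: powr_realpow)
  finally have two: "2 * 4 powr m = (2::real) ^ d" .
  have root: "1 / real d * sqrt (real d) = real d powr (- (1 / 2))"
    using d by (simp add: powr_minus_divide powr_half_sqrt real_div_sqrt field_simps)
  have "expected_facets n d =
      (1 / real d * sqrt (real d)) * ((2 * 4 powr m) * (pi powr m * L powr m) * (Z / B))"
    unfolding E C four by (simp add: mult_ac)
  then show ?thesis unfolding root two by (simp only: mult_ac)
qed

theorem theorem1p1: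
  shows "\<exists>C::real. C > 0 \<and>
    (\<forall>(d::nat) (n::nat). d \<ge> 78 \<and> real n \<ge> exp (exp 1) * real d \<longrightarrow>
      (\<exists>(\<theta>::real) (R::real). - 34 \<le> \<theta> \<and> \<theta> \<le> 2 \<and>
         \<bar>R\<bar> \<le> C * sqrt (real d) * exp (- (1 / 10) * real d) \<and>
         expected_facets n d =
           2 ^ d * pi powr ((real d - 1) / 2) * real d powr (- (1 / 2)) *
           exp ((real d - 1) / 2 * ln (ln (real n / real d))
                - (real d - 1) / 4 * (ln (ln (real n / real d)) / ln (real n / real d))
                + (real d - 1) * (\<theta> / ln (real n / real d))
                + R)))"
proof (rule exI[of _ 2], intro conjI allI impI)
  fix d n :: nat
  assume "78 \<le> d \<and> exp (exp 1) * real d \<le> real n"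
  then have d: "78 \<le> d" and n: "exp (exp 1) * real d \<le> real n" by auto
  define L where "L = ln (real n / real d)"
  define m where "m = (real d - 1) / 2"
  define B where "B = (\<integral>y. cdf_weight (n - d) (d - 1) y \<partial>std_normal_distribution)"
  define Z where "Z = (\<integral>y. cdf_weight (n - d) (d - 1) y * ((normal_hazard y)\<^sup>2 / 2 / L) powr m \<partial>std_normal_distribution)"
  define x where "x = (1 / 2 :: real) ^ d"
  have nd: "exp (exp 1) \<le> real n / real d" using n d by (simp add: field_simps)
  have npos: "0 < real n / real d" using nd by (rule less_le_trans[OF exp_gt_zero])
  have "exp 1 \<le> L" unfolding L_def using nd npos by (subst ln_ge_iff) auto
  then have L: "0 < L" by (rule less_le_trans[OF exp_gt_zero])
  have "1 * real d < exp (exp 1) * real d" using d by (intro mult_strict_right_mono) auto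
  then have dn: "d < n" using n by linarith
  have m0: "0 < m" using d by (simp add: m_def)
  have B0: "0 < B" unfolding B_def cdf_weight_integral by simp
  have x: "0 < x" "x \<le> 1 / 2" unfolding x_def using power_decreasing[of 1 d "1 / 2 :: real"] d by auto
  have d2: "2 \<le> d" using d by simp
  have upper: "Z \<le> B * exp (m * ((4 - ln L / 2) / L))"
    using hazard_power_integral_bounds(1)[OF d2 n] by (simp add: Z_def B_def L_def m_def)
  have lower: "B * ((1 - x) * exp (- m * ((ln L / 2 + 68) / L))) \<le> Z"
    using hazard_power_integral_bounds(2)[OF d2 n] by (simp add: Z_def B_def L_def m_def x_def)
  have "0 < B * ((1 - x) * exp (- m * ((ln L / 2 + 68) / L)))" using B0 x by simp
  then have Z0: "0 < Z" using lower by linarith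
  \<comment> \<open>It remains to split \<open>Q\<close> as \<open>- m * (ln L / 2) / L + 2 * m * \<theta> / L + R\<close>.\<close>
  define Q where "Q = ln (Z / B)"
  have QU: "Q \<le> m * ((4 - ln L / 2) / L)"
  proof -
    have "Z / B \<le> exp (m * ((4 - ln L / 2) / L))" using upper B0 by (simp add: pos_divide_le_eq mult.commute)
    then have "ln (Z / B) \<le> ln (exp (m * ((4 - ln L / 2) / L)))" using B0 Z0 by (subst ln_le_cancel_iff) auto
    then show ?thesis by (simp add: Q_def)
  qed
  have QL: "ln (1 - x) - m * ((ln L / 2 + 68) / L) \<le> Q"
  proof -
    have "(1 - x) * exp (- m * ((ln L / 2 + 68) / L)) \<le> Z / B" using lower B0 by (simp add: pos_le_divide_eq mult.commute)
    then have "ln ((1 - x) * exp (- m * ((ln L / 2 + 68) / L))) \<le> Q"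
      unfolding Q_def using B0 Z0 x by (subst ln_le_cancel_iff) auto
    then show ?thesis using x by (simp add: ln_mult)
  qed
  have E: "expected_facets n d = 2 ^ d * pi powr m * real d powr (- (1 / 2)) * exp (m * ln L + Q)"
  proof -
    have "expected_facets n d = 2 ^ d * pi powr m * real d powr (- (1 / 2)) * L powr m * (Z / B)"
      unfolding Z_def B_def m_def using d by (intro expected_facets_eq_hazard_moment dn L) simp
    moreover have "L powr m = exp (m * ln L)" "Z / B = exp Q"
      using L Z0 B0 by (auto simp: powr_def Q_def)
    ultimately show ?thesis by (simp add: exp_add)
  qed
  define Q' where "Q' = Q + m * (ln L / 2) / L"
  have Q'U: "Q' \<le> 2 * (2 * m / L)"
    using QU by (simp add: Q'_def diff_divide_distrib right_diff_distrib)
  have Q'L: "ln (1 - x) - 34 * (2 * m / L) \<le> Q'"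
    using QL by (simp add: Q'_def add_divide_distrib distrib_left)
  have R: "- ln (1 - x) \<le> 2 * sqrt (real d) * exp (- (1 / 10) * real d)"
  proof -
    have "- x - 2 * x\<^sup>2 \<le> ln (1 - x)" using x by (intro ln_one_minus_pos_lower_bound) auto
    moreover have "x * x \<le> x * (1 / 2)" using x by (intro mult_left_mono) auto
    ultimately have "- ln (1 - x) \<le> 2 * 1 * x" by (simp add: power2_eq_square)
    also have "\<dots> \<le> 2 * sqrt (real d) * exp (- (1 / 10) * real d)"
    proof (intro mult_mono)
      have "x = exp (- ln 2) ^ d" by (simp add: x_def exp_minus inverse_eq_divide)
      also have "\<dots> = exp (- (real d * ln 2))" by (simp flip: exp_of_nat_mult)
      also have "\<dots> \<le> exp (- (real d * (1 / 10)))"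
        using ln2_ge_two_thirds by (intro exp_mono le_imp_neg_le mult_left_mono) auto
      finally show "x \<le> exp (- (1 / 10) * real d)" by (simp add: mult.commute)
      show "1 \<le> sqrt (real d)" using d by simp
    qed (use x in auto)
    finally show ?thesis .
  qed
  define y where "y = 2 * m / L"
  have y: "0 < y" using m0 L by (simp add: y_def)
  \<comment> \<open>All of \<open>Q'\<close> goes into \<open>\<theta>\<close> unless this would push \<open>\<theta>\<close> below \<open>- 34\<close>; then \<open>\<theta> = - 34\<close>, and the
    rest is at least \<open>ln (1 - x)\<close>.\<close>
  obtain \<theta> R where tR: "- 34 \<le> \<theta>" "\<theta> \<le> 2" "\<bar>R\<bar> \<le> 2 * sqrt (real d) * exp (- (1 / 10) * real d)" "Q' = \<theta> * y + R"
  proof (cases "- 34 * y \<le> Q'")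
    case True
    show ?thesis
    proof (rule that[of "Q' / y" 0])
      show "- 34 \<le> Q' / y" "Q' / y \<le> 2"
        using True Q'U y unfolding y_def[symmetric] by (simp_all add: pos_le_divide_eq pos_divide_le_eq)
    qed (use y in auto)
  next
    case False
    show ?thesis
      by (rule that[of "- 34" "Q' + 34 * y"]) (use False Q'L R in \<open>auto simp: y_def[symmetric]\<close>)
  qed
  have "m * ln L + Q = (real d - 1) / 2 * ln L - (real d - 1) / 4 * (ln L / L) + (real d - 1) * (\<theta> / L) + R"
  proof -
    have "Q = \<theta> * y + R - m * (ln L / 2) / L" using tR(4) by (simp add: Q'_def)
    moreover have "(real d - 1) / 4 = m / 2" "(real d - 1) / 2 = m" "real d - 1 = 2 * m"
      by (simp_all add: m_def field_simps)
    ultimately show ?thesis by (simp only:) (simp add: y_def)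
  qed
  then show "\<exists>\<theta> R. - 34 \<le> \<theta> \<and> \<theta> \<le> 2 \<and>
         \<bar>R\<bar> \<le> 2 * sqrt (real d) * exp (- (1 / 10) * real d) \<and>
         expected_facets n d =
           2 ^ d * pi powr ((real d - 1) / 2) * real d powr (- (1 / 2)) *
           exp ((real d - 1) / 2 * ln (ln (real n / real d))
                - (real d - 1) / 4 * (ln (ln (real n / real d)) / ln (real n / real d))
                + (real d - 1) * (\<theta> / ln (real n / real d))
                + R)"
    using tR E unfolding L_def[symmetric] m_def[symmetric] by metis
qed simp

end
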